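(* Let $\mu$ be a non-zero positive pluriharmonic measure on $\mathrm{b}D$. Then $\mu$ has a vaguely continuous disintegration $(\mu_\xi)_{\xi\in\widehat{\mathrm{b}D}}$ relative to its pseudo-image measure $\widehat\beta$ under $\pi$ (that is, a disintegration for which the map $\xi\mapsto\mu_\xi$ is continuous for the vague topology). In addition, $$(\mathcal{P}\mu)(z)=\int_{\mathrm{b}D}\frac{1-|z|^2}{|\zeta-z|^2}\,\mathrm{d}\mu_\xi(\zeta)$$ for every $\xi\in\widehat{\mathrm{b}D}$ and for every $z\in\mathbb{D}_\xi$.
   Context: Setting. $D\subseteq\mathbb{C}^n$ is a bounded symmetric domain (a bounded connected open set such that for every $z\in D$ there is a holomorphic involution of $D$ having $z$ as an isolated fixed point) which is convex and circular ($\alpha z\in D$ for all $z\in D$ and $\alpha\in\mathbb{T}$). Here $\mathbb{D}$ is the open unit disc in $\mathbb{C}$ and $\mathbb{T}=\partial\mathbb{D}$. $\mathrm{b}D$ is the Silov boundary of $D$: the smallest closed subset of $\partial D$ such that $\sup_D|f|=\max_{\mathrm{b}D}|f|$ for every holomorphic $f$ on $D$ extending continuously to the closure $\overline{D}$. $K$ is the compact group of linear automorphisms of $D$; it acts transitively on $\mathrm{b}D$, and it is assumed that $K\subseteq U(n)$ and that $\mathrm{b}D$ is contained in the Euclidean unit sphere ($|\cdot|$ is the Euclidean norm on $\mathbb{C}^n$). $\beta$ is the unique $K$-invariant probability measure on $\mathrm{b}D$. Measures are complex Radon measures; positive means $\ge 0$; the vague topology is the weak-* topology on measures on $\mathrm{b}D$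 in duality with $C(\mathrm{b}D)$. Kernels. The Hardy space $H^2(D)$ is the space of holomorphic $f$ on $D$ with $\|f\|^2=\sup_{0\le\rho<1}\int_{\mathrm{b}D}|f(\rho\zeta)|^2\,\mathrm{d}\beta(\zeta)<\infty$; $\mathcal{C}$ is its reproducing kernel, which extends to a sesqui-holomorphic function on a neighbourhood of $D\times\overline{D}$. The Poisson–Szegő kernel is $\mathcal{P}(z,\zeta)=|\mathcal{C}(z,\zeta)|^2/\mathcal{C}(z,z)$ for $z\in D$, $\zeta\in\mathrm{b}D$, and $(\mathcal{P}\mu)(z)=\int_{\mathrm{b}D}\mathcal{P}(z,\zeta)\,\mathrm{d}\mu(\zeta)$. A measure $\mu$ on $\mathrm{b}D$ is pluriharmonic if $\mathcal{P}\mu$ is pluriharmonic on $D$, i.e. harmonic on the intersection of $D$ with every complex line. Quotient. $\widehat{\mathrm{b}D}$ is the quotient of $\mathrm{b}D$ by the action $(\alpha,\zeta)\mapsto\alpha\zeta$ of $\mathbb{T}$, $\pi\colon\mathrm{b}D\to\widehat{\mathrm{b}D}$ is the canonical projection, $\widehat\beta=\pi_*(\beta)$. For $\xi\in\widehat{\mathrm{b}D}$, $\mathbb{D}_\xi=\{w\zeta: w\in\mathbb{D},\ \zeta\in\pi^{-1}(\xi)\}$. Disintegration. For $X,Y$ locally compact spaces with countable base, complex Radon measures $\mu$ on $X$ and $\nu$ on $Y$, and a $\mu$-measurable $p\colon X\to Y$: $\nu$ is a pseudo-image measure (resp. weak pseudo-image measure) of $\mu$ under $p$ if a subset $N$ of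 $Y$ is $\nu$-negligible if and only if (resp. only if) $p^{-1}(N)$ is $\mu$-negligible. When $\nu$ is a weak pseudo-image measure, a disintegration of $\mu$ relative to $\nu$ is a family $(\mu_y)_{y\in Y}$ of complex Radon measures on $X$ such that: for $\nu$-almost every $y$, $\mu_y$ is concentrated on $p^{-1}(y)$; and for every $\mu$-integrable $f$, $f$ is $\mu_y$-integrable for $\nu$-almost every $y$, the map $y\mapsto\int_X f\,\mathrm{d}\mu_y$ is $\nu$-integrable, and $\int_X f\,\mathrm{d}\mu=\int_Y\int_X f\,\mathrm{d}\mu_y\,\mathrm{d}\nu(y)$. Here $X=\mathrm{b}D$, $Y=\widehat{\mathrm{b}D}$, $p=\pi$, $\nu=\widehat\beta$. *)

theory Defs
  imports "HOL-Probability.Probability"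
begin

section \<open>Holomorphic and pluriharmonic functions\<close>

text \<open>The type \<^typ>\<open>complex ^ 'n\<close> is complex n-space with its Euclidean norm; multiplication by a
  complex scalar is \<open>*s\<close>.\<close>

definition holo_on :: "(complex ^ 'n) set \<Rightarrow> (complex ^ 'n \<Rightarrow> complex) \<Rightarrow> bool" where
  "holo_on D f \<longleftrightarrow> (\<forall>z\<in>D. \<exists>f'. (f has_derivative f') (at z) \<and> (\<forall>c v. f' (c *s v) = c * f' v))"

text \<open>\<open>hx\<close>, \<open>hy\<close> are the first-order and \<open>hxx\<close>, \<open>hxy\<close>, \<open>hyx\<close>, \<open>hyy\<close> the second-order partial
  derivatives with respect to the real coordinates: the function is of class C2 and its Laplacian
  vanishes.\<close>

definition harmonic_fun_on :: "complex set \<Rightarrow> (complex \<Rightarrow> complex) \<Rightarrow> bool" where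
  "harmonic_fun_on U h \<longleftrightarrow>
    (\<exists>hx hy hxx hxy hyx hyy.
       continuous_on U hxx \<and> continuous_on U hxy \<and> continuous_on U hyx \<and> continuous_on U hyy \<and>
       (\<forall>z\<in>U.
          (h has_derivative (\<lambda>v. Re v *\<^sub>R hx z + Im v *\<^sub>R hy z)) (at z) \<and>
          (hx has_derivative (\<lambda>v. Re v *\<^sub>R hxx z + Im v *\<^sub>R hxy z)) (at z) \<and>
          (hy has_derivative (\<lambda>v. Re v *\<^sub>R hyx z + Im v *\<^sub>R hyy z)) (at z) \<and>
          hxx z + hyy z = 0))"

definition pluriharmonic_on :: "(complex ^ 'n) set \<Rightarrow> (complex ^ 'n \<Rightarrow> complex) \<Rightarrow> bool" where
  "pluriharmonic_on D u \<longleftrightarrow>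
    (\<forall>a v. v \<noteq> 0 \<longrightarrow> harmonic_fun_on {w. a + w *s v \<in> D} (\<lambda>w. u (a + w *s v)))"

section \<open>Bounded symmetric domains\<close>

definition bounded_symmetric_domain :: "(complex ^ 'n) set \<Rightarrow> bool" where
  "bounded_symmetric_domain D \<longleftrightarrow>
    D \<noteq> {} \<and> open D \<and> connected D \<and> bounded D \<and>
    (\<forall>z\<in>D. \<exists>s. s ` D \<subseteq> D \<and> (\<forall>i. holo_on D (\<lambda>x. s x $ i)) \<and> (\<forall>x\<in>D. s (s x) = x) \<and>
       s z = z \<and> (\<exists>e>0. \<forall>x\<in>D \<inter> ball z e. s x = x \<longrightarrow> x = z))"

definition circular :: "(complex ^ 'n) set \<Rightarrow> bool" where
  "circular D \<longleftrightarrow> (\<forall>z\<in>D. \<forall>\<alpha>. cmod \<alpha> = 1 \<longrightarrow> \<alpha> *s z \<in> D)"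

definition boundary_set :: "(complex ^ 'n) set \<Rightarrow> (complex ^ 'n) set \<Rightarrow> bool" where
  "boundary_set D B \<longleftrightarrow>
    closed B \<and> B \<subseteq> frontier D \<and>
    (\<forall>f. holo_on D f \<and> continuous_on (closure D) f \<longrightarrow>
       (\<exists>\<zeta>\<in>B. cmod (f \<zeta>) = (SUP z\<in>D. cmod (f z)) \<and> (\<forall>\<eta>\<in>B. cmod (f \<eta>) \<le> cmod (f \<zeta>))))"

definition silov_boundary :: "(complex ^ 'n) set \<Rightarrow> (complex ^ 'n) set \<Rightarrow> bool" where
  "silov_boundary D B \<longleftrightarrow> boundary_set D B \<and> (\<forall>B'. boundary_set D B' \<longrightarrow> B \<subseteq> B')"

definition linear_automorphisms :: "(complex ^ 'n) set \<Rightarrow> (complex ^ 'n ^ 'n) set" where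
  "linear_automorphisms D = {A. invertible A \<and> (\<lambda>z. A *v z) ` D = D}"

definition unitary_group :: "(complex ^ 'n ^ 'n) set" where
  "unitary_group = {A. map_matrix cnj (transpose A) ** A = mat 1}"

section \<open>Complex Radon measures\<close>

definition borel_of :: "'a topology \<Rightarrow> 'a measure" where
  "borel_of X = sigma (topspace X) {U. openin X U}"

text \<open>All spaces considered are locally compact with countable base, so that a positive Radon measure
  is a Borel measure which is finite on compact sets.\<close>

definition radon_measure :: "'a topology \<Rightarrow> 'a measure \<Rightarrow> bool" where
  "radon_measure X m \<longleftrightarrow>
    space m = topspace X \<and> sets m = sets (borel_of X) \<and> (\<forall>K. compactin X K \<longrightarrow> emeasure m K < \<infinity>)"

text \<open>A complex Radon measure is represented by its polar decomposition: the pair \<open>(m, h)\<close> stands for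
  the measure with density \<open>h\<close> relative to \<open>m\<close>, where \<open>h\<close> has modulus 1, so that \<open>m\<close> is its total
  variation. Integrability and negligibility are thus those relative to \<open>m\<close>. As customary for Radon
  measures, they refer to arbitrary functions and subsets (not only to Borel ones), hence the use of
  completions.\<close>

type_synonym 'a cmeasure = "'a measure \<times> ('a \<Rightarrow> complex)"

definition complex_radon_measure :: "'a topology \<Rightarrow> 'a cmeasure \<Rightarrow> bool" where
  "complex_radon_measure X \<mu> \<longleftrightarrow>
    radon_measure X (fst \<mu>) \<and> snd \<mu> \<in> borel_measurable (fst \<mu>) \<and> (AE x in fst \<mu>. cmod (snd \<mu> x) = 1)"

definition of_positive :: "'a measure \<Rightarrow> 'a cmeasure" where
  "of_positive m = (m, \<lambda>_. 1)"

definition cm_integrable :: "'a cmeasure \<Rightarrow> ('a \<Rightarrow> complex) \<Rightarrow> bool" where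
  "cm_integrable \<mu> f \<longleftrightarrow> integrable (completion (fst \<mu>)) f"

definition cm_integral :: "'a cmeasure \<Rightarrow> ('a \<Rightarrow> complex) \<Rightarrow> complex" where
  "cm_integral \<mu> f = (\<integral>x. f x * snd \<mu> x \<partial>completion (fst \<mu>))"

definition cm_negligible :: "'a cmeasure \<Rightarrow> 'a set \<Rightarrow> bool" where
  "cm_negligible \<mu> N \<longleftrightarrow> N \<in> null_sets (completion (fst \<mu>))"

section \<open>Disintegrations\<close>

definition pseudo_image_measure ::
    "'a topology \<Rightarrow> 'b topology \<Rightarrow> ('a \<Rightarrow> 'b) \<Rightarrow> 'a cmeasure \<Rightarrow> 'b cmeasure \<Rightarrow> bool" where
  "pseudo_image_measure X Y p \<mu> \<nu> \<longleftrightarrow>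
    (\<forall>N. N \<subseteq> topspace Y \<longrightarrow> (cm_negligible \<nu> N \<longleftrightarrow> cm_negligible \<mu> {x \<in> topspace X. p x \<in> N}))"

definition weak_pseudo_image_measure ::
    "'a topology \<Rightarrow> 'b topology \<Rightarrow> ('a \<Rightarrow> 'b) \<Rightarrow> 'a cmeasure \<Rightarrow> 'b cmeasure \<Rightarrow> bool" where
  "weak_pseudo_image_measure X Y p \<mu> \<nu> \<longleftrightarrow>
    (\<forall>N. N \<subseteq> topspace Y \<longrightarrow> cm_negligible \<nu> N \<longrightarrow> cm_negligible \<mu> {x \<in> topspace X. p x \<in> N})"

definition disintegration ::
    "'a topology \<Rightarrow> 'b topology \<Rightarrow> ('a \<Rightarrow> 'b) \<Rightarrow> 'a cmeasure \<Rightarrow> 'b cmeasure \<Rightarrow> ('b \<Rightarrow> 'a cmeasure) \<Rightarrow> bool"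
  where
  "disintegration X Y p \<mu> \<nu> M \<longleftrightarrow>
    weak_pseudo_image_measure X Y p \<mu> \<nu> \<and>
    (\<forall>y\<in>topspace Y. complex_radon_measure X (M y)) \<and>
    (AE y in fst \<nu>. cm_negligible (M y) {x \<in> topspace X. p x \<noteq> y}) \<and>
    (\<forall>f. cm_integrable \<mu> f \<longrightarrow>
       (AE y in fst \<nu>. cm_integrable (M y) f) \<and>
       cm_integrable \<nu> (\<lambda>y. cm_integral (M y) f) \<and>
       cm_integral \<mu> f = cm_integral \<nu> (\<lambda>y. cm_integral (M y) f))"

text \<open>Continuity for the weak-* topology in duality with the continuous functions on the compact
  space \<open>X\<close>.\<close>

definition vaguely_continuous :: "'a topology \<Rightarrow> 'b topology \<Rightarrow> ('b \<Rightarrow> 'a cmeasure) \<Rightarrow> bool" where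
  "vaguely_continuous X Y M \<longleftrightarrow>
    (\<forall>g. continuous_map X euclidean g \<longrightarrow> continuous_map Y euclidean (\<lambda>y. cm_integral (M y) g))"

section \<open>Hardy space and kernels\<close>

definition K_invariant_probability ::
    "(complex ^ 'n) set \<Rightarrow> (complex ^ 'n) set \<Rightarrow> (complex ^ 'n) measure \<Rightarrow> bool" where
  "K_invariant_probability D B \<beta> \<longleftrightarrow>
    radon_measure (top_of_set B) \<beta> \<and> prob_space \<beta> \<and>
    (\<forall>A\<in>linear_automorphisms D. distr \<beta> \<beta> (\<lambda>\<zeta>. A *v \<zeta>) = \<beta>)"

definition hardy_mean :: "(complex ^ 'n) measure \<Rightarrow> (complex ^ 'n \<Rightarrow> complex) \<Rightarrow> real \<Rightarrow> real" where
  "hardy_mean \<beta> f \<rho> = (\<integral>\<zeta>. (cmod (f (\<rho> *\<^sub>R \<zeta>)))\<^sup>2 \<partial>\<beta>)"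

definition hardy_space ::
    "(complex ^ 'n) set \<Rightarrow> (complex ^ 'n) measure \<Rightarrow> (complex ^ 'n \<Rightarrow> complex) set" where
  "hardy_space D \<beta> = {f. holo_on D f \<and> bdd_above (hardy_mean \<beta> f ` {0..<1})}"

definition hardy_norm :: "(complex ^ 'n) measure \<Rightarrow> (complex ^ 'n \<Rightarrow> complex) \<Rightarrow> real" where
  "hardy_norm \<beta> f = sqrt (SUP \<rho>\<in>{0..<1}. hardy_mean \<beta> f \<rho>)"

text \<open>The scalar product of the Hardy space (linear in the first argument) is recovered from the norm
  by polarization.\<close>

definition hardy_inner ::
    "(complex ^ 'n) measure \<Rightarrow> (complex ^ 'n \<Rightarrow> complex) \<Rightarrow> (complex ^ 'n \<Rightarrow> complex) \<Rightarrow> complex" where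
  "hardy_inner \<beta> f g =
    (\<Sum>k<4. \<i> ^ k * of_real ((hardy_norm \<beta> (\<lambda>z. f z + \<i> ^ k * g z))\<^sup>2)) / 4"

definition reproducing_kernel ::
    "(complex ^ 'n) set \<Rightarrow> (complex ^ 'n) measure \<Rightarrow> (complex ^ 'n \<Rightarrow> complex ^ 'n \<Rightarrow> complex) \<Rightarrow> bool"
  where
  "reproducing_kernel D \<beta> C \<longleftrightarrow>
    (\<forall>w\<in>D. (\<lambda>z. C z w) \<in> hardy_space D \<beta> \<and>
       (\<forall>f\<in>hardy_space D \<beta>. f w = hardy_inner \<beta> f (\<lambda>z. C z w)))"

text \<open>The values at the points of the boundary of the sesqui-holomorphic extension of the kernel. By
  continuity, they are determined by the values of the kernel on \<open>D \<times> D\<close>.\<close>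

definition kernel_boundary_value ::
    "(complex ^ 'n) set \<Rightarrow> (complex ^ 'n \<Rightarrow> complex ^ 'n \<Rightarrow> complex) \<Rightarrow>
     complex ^ 'n \<Rightarrow> complex ^ 'n \<Rightarrow> complex" where
  "kernel_boundary_value D C z \<zeta> = Lim (at \<zeta> within D) (\<lambda>w. C z w)"

definition poisson_szego ::
    "(complex ^ 'n) set \<Rightarrow> (complex ^ 'n \<Rightarrow> complex ^ 'n \<Rightarrow> complex) \<Rightarrow>
     complex ^ 'n \<Rightarrow> complex ^ 'n \<Rightarrow> complex" where
  "poisson_szego D C z \<zeta> = of_real ((cmod (kernel_boundary_value D C z \<zeta>))\<^sup>2) / C z z"

definition poisson_integral ::
    "(complex ^ 'n) set \<Rightarrow> (complex ^ 'n \<Rightarrow> complex ^ 'n \<Rightarrow> complex) \<Rightarrow>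
     (complex ^ 'n) cmeasure \<Rightarrow> complex ^ 'n \<Rightarrow> complex" where
  "poisson_integral D C \<mu> z = cm_integral \<mu> (\<lambda>\<zeta>. poisson_szego D C z \<zeta>)"

definition pluriharmonic_measure ::
    "(complex ^ 'n) set \<Rightarrow> (complex ^ 'n \<Rightarrow> complex ^ 'n \<Rightarrow> complex) \<Rightarrow> (complex ^ 'n) cmeasure \<Rightarrow> bool"
  where
  "pluriharmonic_measure D C \<mu> \<longleftrightarrow> pluriharmonic_on D (poisson_integral D C \<mu>)"

section \<open>The quotient by the circle action\<close>

definition circle_orbit :: "complex ^ 'n \<Rightarrow> (complex ^ 'n) set" where
  "circle_orbit \<zeta> = {\<alpha> *s \<zeta> | \<alpha>. cmod \<alpha> = 1}"

definition quotient_topology :: "'a topology \<Rightarrow> ('a \<Rightarrow> 'b) \<Rightarrow> 'b topology" where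
  "quotient_topology X p =
    topology (\<lambda>V. V \<subseteq> p ` topspace X \<and> openin X {x \<in> topspace X. p x \<in> V})"

lemma openin_quotient_topology:
  "openin (quotient_topology X p) V \<longleftrightarrow>
     V \<subseteq> p ` topspace X \<and> openin X {x \<in> topspace X. p x \<in> V}"
proof -
  have "istopology (\<lambda>V. V \<subseteq> p ` topspace X \<and> openin X {x \<in> topspace X. p x \<in> V})"
    unfolding istopology_def
  proof (intro conjI allI impI)
    fix S T
    assume "S \<subseteq> p ` topspace X \<and> openin X {x \<in> topspace X. p x \<in> S}"
      and "T \<subseteq> p ` topspace X \<and> openin X {x \<in> topspace X. p x \<in> T}"
    moreover have "{x \<in> topspace X. p x \<in> S \<inter> T} =
        {x \<in> topspace X. p x \<in> S} \<inter> {x \<in> topspace X. p x \<in> T}" by auto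
    ultimately show "S \<inter> T \<subseteq> p ` topspace X" "openin X {x \<in> topspace X. p x \<in> S \<inter> T}"
      by auto
  next
    fix \<K>
    assume *: "\<forall>V\<in>\<K>. V \<subseteq> p ` topspace X \<and> openin X {x \<in> topspace X. p x \<in> V}"
    have "{x \<in> topspace X. p x \<in> \<Union>\<K>} = (\<Union>V\<in>\<K>. {x \<in> topspace X. p x \<in> V})" by auto
    then show "openin X {x \<in> topspace X. p x \<in> \<Union>\<K>}" using * by auto
    show "\<Union>\<K> \<subseteq> p ` topspace X" using * by auto
  qed
  then show ?thesis by (simp add: quotient_topology_def)
qed

definition hat_boundary :: "(complex ^ 'n) set \<Rightarrow> (complex ^ 'n) set topology" where
  "hat_boundary B = quotient_topology (top_of_set B) circle_orbit"

definition hat_measure ::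
    "(complex ^ 'n) set \<Rightarrow> (complex ^ 'n) measure \<Rightarrow> (complex ^ 'n) set measure" where
  "hat_measure B \<beta> = distr \<beta> (borel_of (hat_boundary B)) circle_orbit"

definition orbit_disc :: "(complex ^ 'n) set \<Rightarrow> (complex ^ 'n) set \<Rightarrow> (complex ^ 'n) set" where
  "orbit_disc B \<xi> = {w *s \<zeta> | w \<zeta>. cmod w < 1 \<and> \<zeta> \<in> B \<and> circle_orbit \<zeta> = \<xi>}"

end

theory Submission
  imports Defs "HOL-Complex_Analysis.Complex_Analysis"
begin

text \<open>Write \<open>u\<close> for the Poisson-Szego integral of \<open>\<mu>\<close>. Along each disc \<open>w \<mapsto> w \<zeta>\<close> with \<open>\<zeta>\<close> on the
  Silov boundary, \<open>u\<close> is a nonnegative harmonic function, so that by Herglotz's theorem it is the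
  Poisson integral of a positive measure on the circle orbit of \<open>\<zeta>\<close>, whose mass is
  \<open>u 0 = \<mu>(bD)\<close> (\<open>boundary_measure_exists\<close>). These are the measures of the disintegration, and the
  Poisson formula on discs holds by construction. It remains to see that they depend
  continuously on the orbit and that their average is \<open>\<mu>\<close>.

  Both follow from one estimate (\<open>approximate_identity_bound\<close>): if \<open>p\<close> is a nonnegative kernel
  on \<open>K \<times> K\<close> whose sections have mass 1 and mean square distance at most \<open>\<delta>\<close> from their
  centre, then integrating a continuous \<open>g\<close> against the smoothed measure differs from integrating it against
  the measure itself by a quantity which depends only on the mass, on \<open>\<delta>\<close> and on the modulus of continuity
  of \<open>g\<close>. For the Poisson kernel of the disc with poles of modulus \<open>r\<close>, \<open>\<delta> = 2 - 2 r\<close>. Thus the integral of \<open>g\<close>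
  against the measure of an orbit is the limit, uniformly in \<open>\<zeta>\<close>, of the circle means of \<open>g \<sqdot> u (r \<sqdot>)\<close>,
  which are continuous in \<open>\<zeta>\<close> and depend only on the orbit.

  The Poisson-Szego kernel of the domain satisfies the same estimate with the same \<open>\<delta>\<close>.
  Indeed, integrating against the kernel with pole \<open>r \<eta>\<close> reproduces the value at \<open>r \<eta>\<close> of a holomorphic function, in
  particular of the linear form \<open>\<zeta> \<mapsto> \<langle>\<zeta>, \<eta>\<rangle>\<close>; since the boundary lies in
  the unit sphere, the squared distance of \<open>\<zeta>\<close> and \<open>\<eta>\<close> is \<open>2 - 2 Re \<langle>\<zeta>, \<eta>\<rangle>\<close>, and its mean is
  \<open>2 - 2 r\<close> (\<open>radial_poisson_spread\<close>). Hence \<open>u (r \<sqdot>) \<beta>\<close> tends to \<open>\<mu>\<close>; as the circle means have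
  the same average as the functions they come from, the measures of the orbits average to \<open>\<mu>\<close>.

  What is needed of the Szego kernel comes from its uniqueness. The form
  \<open>pairing f g a b\<close> depends only on the product of the radii (\<open>pairing_shift\<close>), so that a
  dilation may be moved from one argument of the kernel to the other (\<open>kernel_dilation\<close>); this yields its boundary
  values, while linear automorphisms, being isometries, yield joint continuity
  (\<open>continuous_boundary_kernel\<close>).

  Finally, a family of measures whose integrals of continuous functions are
  measurable and average to those of \<open>\<mu>\<close> is a kernel of measures with mixture \<open>\<mu>\<close>
  (\<open>measure_mixture_compact\<close>). If each of its members lives on its own fibre, with a common positive mass,
  then it is a disintegration, and null sets of the base are exactly those with null
  preimage (\<open>disintegration_of_mixture\<close>).\<close>


section \<open>Finite measures on compact sets\<close>

definition finite_measure_on :: "'a::topological_space set \<Rightarrow> 'a measure \<Rightarrow> bool" where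
  "finite_measure_on K M \<longleftrightarrow> compact K \<and> finite_measure M \<and> sets M = sets (restrict_space borel K)"

lemma finite_measure_on_space:
  "finite_measure_on K M \<Longrightarrow> space M = K"
  using sets_eq_imp_space_eq[of M "restrict_space borel K"]
  by (auto simp: finite_measure_on_def space_restrict_space)

lemma borel_measurable_continuous:
  assumes "finite_measure_on K M" "continuous_on K f"
  shows "f \<in> borel_measurable M"
  using borel_measurable_continuous_on_restrict[OF assms(2)] assms(1)
  by (simp add: finite_measure_on_def cong: measurable_cong_sets)

lemma integrable_continuous:
  fixes f :: "'a::topological_space \<Rightarrow> 'b::{banach, second_countable_topology}"
  assumes M: "finite_measure_on K M" and f: "continuous_on K f"
  shows "integrable M f"
proof -
  interpret finite_measure M using M by (simp add: finite_measure_on_def)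
  have "compact K" using M by (simp add: finite_measure_on_def)
  then obtain B where "0 \<le> B" "\<And>x. x \<in> K \<Longrightarrow> norm (f x) \<le> B"
    by (rule continuous_on_compact_bound[OF _ f]) (rule that, auto)
  then show ?thesis
    using M by (intro integrable_const_bound[of _ B] borel_measurable_continuous[OF M f])
      (auto simp: finite_measure_on_space)
qed

lemma Fubini_continuous:
  fixes f :: "'a::{t2_space, second_countable_topology} \<Rightarrow> 'b::{t2_space, second_countable_topology}
    \<Rightarrow> 'c::{banach, second_countable_topology}"
  assumes M: "finite_measure_on K M" and N: "finite_measure_on L N"
    and f: "continuous_on (K \<times> L) (\<lambda>p. f (fst p) (snd p))"
  shows "(\<integral>x. (\<integral>y. f x y \<partial>N) \<partial>M) = (\<integral>y. (\<integral>x. f x y \<partial>M) \<partial>N)"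
proof -
  interpret M: finite_measure M using M by (simp add: finite_measure_on_def)
  interpret N: finite_measure N using N by (simp add: finite_measure_on_def)
  interpret MN: pair_sigma_finite M N ..
  interpret P: finite_measure "M \<Otimes>\<^sub>M N"
    by (rule finite_measure_pair_measure) unfold_locales
  have sp: "space M = K" "space N = L" using M N by (auto simp: finite_measure_on_space)
  have id: "(\<lambda>p. (fst p, snd p)) \<in> M \<Otimes>\<^sub>M N \<rightarrow>\<^sub>M restrict_space borel (K \<times> L)"
  proof (rule measurable_restrict_space2)
    show "(\<lambda>p. (fst p, snd p)) \<in> space (M \<Otimes>\<^sub>M N) \<rightarrow> K \<times> L"
      by (auto simp: space_pair_measure sp)
    have 1: "(\<lambda>x. x) \<in> M \<rightarrow>\<^sub>M borel" "(\<lambda>x. x) \<in> N \<rightarrow>\<^sub>M borel"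
      by (rule borel_measurable_continuous[OF M continuous_on_id] borel_measurable_continuous[OF N continuous_on_id])+
    have "fst \<in> M \<Otimes>\<^sub>M N \<rightarrow>\<^sub>M borel" "snd \<in> M \<Otimes>\<^sub>M N \<rightarrow>\<^sub>M borel"
      using measurable_compose[OF measurable_fst 1(1)] measurable_compose[OF measurable_snd 1(2)] by auto
    then show "(\<lambda>p. (fst p, snd p)) \<in> M \<Otimes>\<^sub>M N \<rightarrow>\<^sub>M borel"
      by (rule borel_measurable_Pair)
  qed
  have meas: "(\<lambda>p. f (fst p) (snd p)) \<in> borel_measurable (M \<Otimes>\<^sub>M N)"
    using measurable_compose[OF id borel_measurable_continuous_on_restrict[OF f]] by simp
  have "compact (K \<times> L)" using M N by (auto simp: finite_measure_on_def intro: compact_Times)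
  then obtain B where B: "0 \<le> B" "\<And>p. p \<in> K \<times> L \<Longrightarrow> norm (f (fst p) (snd p)) \<le> B"
    by (rule continuous_on_compact_bound[OF _ f]) (rule that, auto)
  have "integrable (M \<Otimes>\<^sub>M N) (\<lambda>p. f (fst p) (snd p))"
    by (rule P.integrable_const_bound[of _ B, OF _ meas])
       (use B in \<open>auto simp: space_pair_measure sp\<close>)
  then have "integrable (M \<Otimes>\<^sub>M N) (case_prod f)" by (simp add: case_prod_unfold)
  from MN.Fubini_integral[OF this] show ?thesis by simp
qed

lemma continuous_on_integral_parameter:
  fixes f :: "'a::{first_countable_topology, t2_space} \<Rightarrow> 'b::{metric_space}
    \<Rightarrow> 'c::{banach, second_countable_topology}"
  assumes M: "finite_measure_on K M" and L: "compact L"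
    and f: "continuous_on (K \<times> L) (\<lambda>p. f (fst p) (snd p))"
  shows "continuous_on L (\<lambda>y. \<integral>x. f x y \<partial>M)"
  unfolding continuous_on_sequentially comp_def
proof (intro allI impI ballI)
  fix X a assume a: "a \<in> L" and "(\<forall>n. X n \<in> L) \<and> X \<longlonglongrightarrow> a"
  then have X: "\<And>n. X n \<in> L" "X \<longlonglongrightarrow> a" by auto
  interpret M: finite_measure M using M by (simp add: finite_measure_on_def)
  have "compact (K \<times> L)" using M L by (auto simp: finite_measure_on_def intro: compact_Times)
  then obtain B where B: "0 \<le> B" "\<And>p. p \<in> K \<times> L \<Longrightarrow> norm (f (fst p) (snd p)) \<le> B"
    by (rule continuous_on_compact_bound[OF _ f]) (rule that, auto)
  have cont: "continuous_on K (\<lambda>x. f x y)" if "y \<in> L" for y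
    using that by (intro continuous_on_compose2[OF f, of K "\<lambda>x. (x, y)", simplified]) (auto intro!: continuous_intros)
  show "(\<lambda>n. \<integral>x. f x (X n) \<partial>M) \<longlonglongrightarrow> (\<integral>x. f x a \<partial>M)"
  proof (rule integral_dominated_convergence[where w = "\<lambda>_. B"])
    show "AE x in M. (\<lambda>n. f x (X n)) \<longlonglongrightarrow> f x a"
    proof (rule AE_I2)
      fix x assume "x \<in> space M"
      then have x: "x \<in> K" using M by (simp add: finite_measure_on_space)
      have "continuous_on L (\<lambda>y. f x y)"
        using x by (intro continuous_on_compose2[OF f, of L "\<lambda>y. (x, y)", simplified]) (auto intro!: continuous_intros)
      then show "(\<lambda>n. f x (X n)) \<longlonglongrightarrow> f x a"
        using X a by (auto simp: continuous_on_sequentially comp_def)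
    qed
  qed (use X a B M cont in \<open>auto simp: finite_measure_on_space intro!: borel_measurable_continuous[OF M]\<close>)
qed

section \<open>Normalized arc length and the Poisson formula of the disc\<close>

text \<open>Presented as a measure on the real line, so that the selection theorem for probability measures on
  the line applies to densities relative to it.\<close>

definition unit_interval_measure :: "real measure" where
  "unit_interval_measure = density lborel (\<lambda>t. ennreal (indicator {0..1} t))"

definition arc_measure :: "complex measure" where
  "arc_measure = distr unit_interval_measure (restrict_space borel (sphere 0 1)) (circlepath 0 1)"

lemma prob_unit_interval: "prob_space unit_interval_measure"
  by (rule prob_spaceI) (simp add: unit_interval_measure_def emeasure_density ennreal_indicator)

lemma circlepath01: "circlepath 0 1 t = exp (2 * of_real pi * \<i> * of_real t)"
  by (simp add: circlepath)

lemma norm_circlepath01 [simp]: "norm (circlepath 0 1 t) = 1"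
  by (simp add: circlepath01 norm_exp_eq_Re)

lemma circlepath01_nz [simp]: "circlepath 0 1 t \<noteq> 0"
  by (simp add: circlepath01)

lemma continuous_circlepath01: "continuous_on S (circlepath 0 1)"
  unfolding circlepath by (intro continuous_intros)

lemma measurable_circlepath01:
  "circlepath 0 1 \<in> borel \<rightarrow>\<^sub>M restrict_space borel (sphere 0 1)"
  by (intro measurable_restrict_space2 borel_measurable_continuous_onI continuous_circlepath01)
     (auto simp: sphere_def dist_norm)

lemma sets_arc_measure: "sets arc_measure = sets (restrict_space borel (sphere 0 1))"
  by (simp add: arc_measure_def)

lemma measurable_unit_interval: "measurable unit_interval_measure M = measurable borel M"
  by (simp add: unit_interval_measure_def cong: measurable_cong_sets)

lemma prob_arc: "prob_space arc_measure"
  unfolding arc_measure_def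
  by (intro prob_space.prob_space_distr prob_unit_interval)
     (simp add: measurable_unit_interval measurable_circlepath01)

lemma finite_arc: "finite_measure_on (sphere 0 1) arc_measure"
  using prob_arc by (simp add: finite_measure_on_def sets_arc_measure prob_space_def)

lemma integral_arc:
  fixes \<phi> :: "complex \<Rightarrow> complex"
  assumes "continuous_on (sphere 0 1) \<phi>"
  shows "((\<lambda>t. \<phi> (circlepath 0 1 t)) has_integral (\<integral>\<kappa>. \<phi> \<kappa> \<partial>arc_measure)) {0..1}"
proof -
  let ?e = "circlepath 0 1"
  have meas: "\<phi> \<in> borel_measurable (restrict_space borel (sphere 0 1))"
    by (rule borel_measurable_continuous_on_restrict[OF assms])
  have 0: "(\<lambda>t. \<phi> (?e t)) \<in> borel_measurable borel"
    using measurable_compose[OF measurable_circlepath01 meas] by simp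
  have "(\<integral>\<kappa>. \<phi> \<kappa> \<partial>arc_measure) = (\<integral>t. \<phi> (?e t) \<partial>unit_interval_measure)"
    unfolding arc_measure_def
    by (rule integral_distr) (simp_all add: measurable_unit_interval measurable_circlepath01 meas)
  also have "\<dots> = (\<integral>t. indicator {0..1} t *\<^sub>R \<phi> (?e t) \<partial>lborel)"
    unfolding unit_interval_measure_def
    by (rule integral_density) (use 0 in auto)
  finally have eq: "(\<integral>\<kappa>. \<phi> \<kappa> \<partial>arc_measure) = set_lebesgue_integral lborel {0..1} (\<lambda>t. \<phi> (?e t))"
    by (simp add: set_lebesgue_integral_def)
  have "continuous_on {0..1} (\<lambda>t. \<phi> (?e t))"
    by (rule continuous_on_compose2[OF assms continuous_circlepath01]) (auto simp: dist_norm)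
  then have "set_integrable lborel {0..1} (\<lambda>t. \<phi> (?e t))"
    unfolding set_integrable_def by (intro borel_integrable_compact) auto
  show ?thesis using eq set_borel_integral_eq_integral[OF \<open>set_integrable lborel {0..1} (\<lambda>t. \<phi> (?e t))\<close>]
    by (simp add: has_integral_iff)
qed

lemma integral_arc_cnj:
  fixes \<phi> :: "complex \<Rightarrow> complex"
  assumes "continuous_on (sphere 0 1) \<phi>"
  shows "(\<integral>\<kappa>. \<phi> (cnj \<kappa>) \<partial>arc_measure) = (\<integral>\<kappa>. \<phi> \<kappa> \<partial>arc_measure)"
proof -
  have c: "continuous_on (sphere 0 1) (\<lambda>\<kappa>. \<phi> (cnj \<kappa>))"
    by (rule continuous_on_compose2[OF assms]) (auto intro!: continuous_intros)
  have *: "circlepath 0 1 (1 - t) = cnj (circlepath 0 1 t)" for t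
  proof -
    have "circlepath 0 1 (1 - t) = exp (2 * of_real pi * \<i>) * exp (- (2 * of_real pi * \<i> * of_real t))"
      unfolding circlepath01 exp_add[symmetric] by (simp add: algebra_simps)
    also have "\<dots> = cnj (circlepath 0 1 t)"
      by (simp add: circlepath01 exp_cnj)
    finally show ?thesis .
  qed
  have "((\<lambda>t. \<phi> (circlepath 0 1 (1 - t))) has_integral (\<integral>\<kappa>. \<phi> \<kappa> \<partial>arc_measure)) {0..1}"
    using has_integral_affinity[OF integral_arc[OF assms, folded cbox_interval], of "-1" 1] by (simp add: image_affinity_atLeastAtMost_diff)
  then have "((\<lambda>t. \<phi> (cnj (circlepath 0 1 t))) has_integral (\<integral>\<kappa>. \<phi> \<kappa> \<partial>arc_measure)) {0..1}"
    by (simp add: *)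
  with integral_arc[OF c] show ?thesis by (rule has_integral_unique)
qed

lemma has_contour_integral_arc:
  fixes \<phi> :: "complex \<Rightarrow> complex"
  assumes "continuous_on (sphere 0 1) \<phi>"
  shows "((\<lambda>z. \<phi> z / z) has_contour_integral (2 * of_real pi * \<i> * (\<integral>\<kappa>. \<phi> \<kappa> \<partial>arc_measure))) (circlepath 0 1)"
  unfolding has_contour_integral_def
proof (rule has_integral_eq[rotated])
  show "((\<lambda>t. 2 * of_real pi * \<i> * \<phi> (circlepath 0 1 t)) has_integral
     (2 * of_real pi * \<i> * (\<integral>\<kappa>. \<phi> \<kappa> \<partial>arc_measure))) {0..1}"
    by (rule has_integral_mult_right[OF integral_arc[OF assms]])
  fix t :: real assume "t \<in> {0..1}"
  then show "2 * of_real pi * \<i> * \<phi> (circlepath 0 1 t) =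
     \<phi> (circlepath 0 1 t) / circlepath 0 1 t * vector_derivative (circlepath 0 1) (at t within {0..1})"
    by (simp add: vector_derivative_circlepath01) (simp add: circlepath01)
qed

text \<open>Rotating the circle amounts to starting the path at another of its points, which does not affect
  contour integrals.\<close>

lemma integral_arc_rotate:
  fixes \<phi> :: "complex \<Rightarrow> complex"
  assumes c: "continuous_on (sphere 0 1) \<phi>" and \<alpha>: "cmod \<alpha> = 1"
  shows "(\<integral>\<kappa>. \<phi> (\<alpha> * \<kappa>) \<partial>arc_measure) = (\<integral>\<kappa>. \<phi> \<kappa> \<partial>arc_measure)"
proof -
  let ?e = "circlepath 0 1 :: real \<Rightarrow> complex"
  obtain s where s: "s \<in> {0..1}" "?e s = \<alpha>"
  proof -
    have "\<alpha> \<in> path_image (circlepath 0 1)" using \<alpha> by (simp add: sphere_def)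
    then show ?thesis using that by (auto simp: path_image_def)
  qed
  have add: "?e (a + b) = ?e a * ?e b" for a b
    by (simp add: circlepath01 exp_add ring_distribs)
  have one: "?e 1 = 1" "?e (-1) = 1" by (simp_all add: circlepath01 exp_minus)
  have sh: "shiftpath s ?e t = \<alpha> * ?e t" for t
    using add[of s t] add[of "s + t" "-1"] s one by (simp add: shiftpath_def algebra_simps)
  have c': "continuous_on (sphere 0 1) (\<lambda>\<kappa>. \<phi> (\<alpha> * \<kappa>))"
    by (rule continuous_on_compose2[OF c]) (auto intro!: continuous_intros simp: norm_mult \<alpha>)
  have "((\<lambda>z. \<phi> z / z) has_contour_integral (2 * of_real pi * \<i> * (\<integral>\<kappa>. \<phi> \<kappa> \<partial>arc_measure))) (shiftpath s ?e)"
    by (rule has_contour_integral_shiftpath[OF has_contour_integral_arc[OF c] _ s(1)]) simp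
  moreover have "shiftpath s ?e = (\<lambda>t. \<alpha> * ?e t)" using sh by auto
  ultimately have H: "((\<lambda>t. \<phi> (\<alpha> * ?e t) / (\<alpha> * ?e t) * vector_derivative (\<lambda>t. \<alpha> * ?e t) (at t within {0..1}))
     has_integral (2 * of_real pi * \<i> * (\<integral>\<kappa>. \<phi> \<kappa> \<partial>arc_measure))) {0..1}"
    by (simp add: has_contour_integral_def)
  have V: "vector_derivative (\<lambda>t. \<alpha> * ?e t) (at t within {0..1}) = \<alpha> * (2 * of_real pi * \<i> * ?e t)"
    if "t \<in> {0..1}" for t :: real
  proof (rule vector_derivative_at_within_ivl[of _ _ _ 0 1])
    have "(?e has_vector_derivative (2 * of_real pi * \<i> * ?e t)) (at t)"
      using has_vector_derivative_circlepath[of 0 1 t UNIV] by (simp add: circlepath)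
    then show "((\<lambda>t. \<alpha> * ?e t) has_vector_derivative \<alpha> * (2 * of_real pi * \<i> * ?e t)) (at t)"
      by (rule has_vector_derivative_mult_right)
  qed (use that in auto)
  have "((\<lambda>t. 2 * of_real pi * \<i> * \<phi> (\<alpha> * ?e t)) has_integral
      (2 * of_real pi * \<i> * (\<integral>\<kappa>. \<phi> \<kappa> \<partial>arc_measure))) {0..1}"
    by (rule has_integral_eq[OF _ H]) (use \<alpha> V in \<open>auto simp: field_simps\<close>)
  moreover have "((\<lambda>t. 2 * of_real pi * \<i> * \<phi> (\<alpha> * ?e t)) has_integral
      (2 * of_real pi * \<i> * (\<integral>\<kappa>. \<phi> (\<alpha> * \<kappa>) \<partial>arc_measure))) {0..1}"
    by (rule has_integral_mult_right[OF integral_arc[OF c']])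
  ultimately show ?thesis by (auto dest: has_integral_unique)
qed

lemma mult_cnj_sphere: "cmod \<kappa> = 1 \<Longrightarrow> \<kappa> * cnj \<kappa> = 1"
  using complex_norm_square[of \<kappa>] by simp

lemma szego_denominator: "cmod w < 1 \<Longrightarrow> cmod \<kappa> = 1 \<Longrightarrow> 1 - w * cnj \<kappa> \<noteq> 0"
  by (metis complex_mod_cnj mult.right_neutral norm_mult norm_one order_less_irrefl eq_iff_diff_eq_0)

text \<open>Cauchy's formula: on the unit circle, \<open>cnj \<kappa>\<close> is the inverse of
  \<open>\<kappa>\<close>.\<close>

lemma Cauchy_szego:
  assumes F: "continuous_on (cball 0 1) F" "F holomorphic_on ball 0 1" and w: "cmod w < 1"
  shows "(\<integral>\<kappa>. F \<kappa> / (1 - w * cnj \<kappa>) \<partial>arc_measure) = F w"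
proof -
  have c: "continuous_on (sphere 0 1) (\<lambda>\<kappa>. F \<kappa> / (1 - w * cnj \<kappa>))"
    using szego_denominator[OF w]
    by (intro continuous_intros continuous_on_subset[OF F(1)]) auto
  have "((\<lambda>u. F u / (u - w)) has_contour_integral (2 * of_real pi * \<i> * F w)) (circlepath 0 1)"
    by (rule Cauchy_integral_circlepath[OF F]) (use w in simp)
  moreover have "((\<lambda>u. F u / (u - w)) has_contour_integral
     (2 * of_real pi * \<i> * (\<integral>\<kappa>. F \<kappa> / (1 - w * cnj \<kappa>) \<partial>arc_measure))) (circlepath 0 1)"
  proof (rule has_contour_integral_eq[OF has_contour_integral_arc[OF c]])
    fix u assume "u \<in> path_image (circlepath 0 1)"
    then have "cmod u = 1" by (simp add: sphere_def)
    then have "(1 - w * cnj u) * u = u - w" using mult_cnj_sphere[of u] by (simp add: algebra_simps)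
    then show "F u / (1 - w * cnj u) / u = F u / (u - w)" by (metis divide_divide_eq_left)
  qed
  ultimately have "2 * of_real pi * \<i> * F w = 2 * of_real pi * \<i> * (\<integral>\<kappa>. F \<kappa> / (1 - w * cnj \<kappa>) \<partial>arc_measure)"
    by (rule has_contour_integral_unique)
  then show ?thesis by simp
qed

definition disc_poisson :: "complex \<Rightarrow> complex \<Rightarrow> real" where
  "disc_poisson w \<kappa> = (1 - (cmod w)\<^sup>2) / (cmod (\<kappa> - w))\<^sup>2"

text \<open>Up to the second summand, which is holomorphic in \<open>\<kappa>\<close> and vanishes at 0, the
  Poisson kernel is the Cauchy kernel.\<close>

lemma disc_poisson_decompose:
  assumes w: "cmod w < 1" and \<kappa>: "cmod \<kappa> = 1"
  shows "complex_of_real (disc_poisson w \<kappa>) = 1 / (1 - w * cnj \<kappa>) + cnj w * \<kappa> / (1 - cnj w * \<kappa>)"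
proof -
  have n1: "1 - w * cnj \<kappa> \<noteq> 0" using szego_denominator[OF w \<kappa>] .
  then have n2: "1 - cnj w * \<kappa> \<noteq> 0"
    by (metis complex_cnj_cnj complex_cnj_diff complex_cnj_mult complex_cnj_one complex_cnj_zero)
  have kk: "\<kappa> * cnj \<kappa> = 1" by (rule mult_cnj_sphere[OF \<kappa>])
  have d: "of_real ((cmod (\<kappa> - w))\<^sup>2) = (1 - w * cnj \<kappa>) * (1 - cnj w * \<kappa>)"
  proof -
    have "of_real ((cmod (\<kappa> - w))\<^sup>2) = (\<kappa> - w) * cnj (\<kappa> - w)" by (rule complex_norm_square)
    also have "\<dots> = (1 - w * cnj \<kappa>) * (1 - cnj w * \<kappa>) + (\<kappa> * cnj \<kappa> - 1) * (1 - w * cnj w)"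
      by (simp add: algebra_simps)
    finally show ?thesis using kk by simp
  qed
  have "complex_of_real (disc_poisson w \<kappa>) = (1 - w * cnj w) / ((1 - w * cnj \<kappa>) * (1 - cnj w * \<kappa>))"
    unfolding disc_poisson_def of_real_divide d
    by (simp only: of_real_diff of_real_1 complex_norm_square)
  also have "(1 - w * cnj w) = (1 - cnj w * \<kappa>) + cnj w * \<kappa> * (1 - w * cnj \<kappa>)"
    using kk by (simp add: algebra_simps)
  finally show ?thesis using n1 n2 by (simp add: add_divide_distrib)
qed

lemma continuous_disc_poisson:
  "cmod w < 1 \<Longrightarrow> continuous_on (sphere 0 1) (disc_poisson w)"
  unfolding disc_poisson_def by (intro continuous_intros) auto

lemma disc_poisson_nonneg: "cmod w < 1 \<Longrightarrow> 0 \<le> disc_poisson w \<kappa>"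
  unfolding disc_poisson_def
  by (intro divide_nonneg_nonneg) (auto simp: abs_square_le_1)

text \<open>The Cauchy part of the kernel gives \<open>F w\<close>. The other part gives the value at 0 of the
  product of \<open>F\<close> with a function vanishing there.\<close>

lemma Poisson_formula:
  assumes F: "continuous_on (cball 0 1) F" "F holomorphic_on ball 0 1" and w: "cmod w < 1"
  shows "(\<integral>\<kappa>. of_real (disc_poisson w \<kappa>) * F \<kappa> \<partial>arc_measure) = F w"
proof -
  let ?G = "\<lambda>\<kappa>. F \<kappa> * (cnj w * \<kappa>) / (1 - cnj w * \<kappa>)"
  have nz: "1 - cnj w * \<kappa> \<noteq> 0" if "cmod \<kappa> \<le> 1" for \<kappa>
  proof
    assume "1 - cnj w * \<kappa> = 0"
    then have "cmod w * cmod \<kappa> = 1" by (metis complex_mod_cnj eq_iff_diff_eq_0 norm_mult norm_one)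
    moreover have "cmod w * cmod \<kappa> \<le> cmod w" using that by (simp add: mult_left_le)
    ultimately show False using w by simp
  qed
  have G: "continuous_on (cball 0 1) ?G" "?G holomorphic_on ball 0 1"
    using nz by (auto intro!: continuous_intros holomorphic_intros F)
  have c1: "continuous_on (sphere 0 1) (\<lambda>\<kappa>. F \<kappa> / (1 - w * cnj \<kappa>))"
    using szego_denominator[OF w]
    by (intro continuous_intros continuous_on_subset[OF F(1)]) auto
  have c2: "continuous_on (sphere 0 1) ?G" by (rule continuous_on_subset[OF G(1)]) auto
  have "(\<integral>\<kappa>. of_real (disc_poisson w \<kappa>) * F \<kappa> \<partial>arc_measure)
      = (\<integral>\<kappa>. F \<kappa> / (1 - w * cnj \<kappa>) + ?G \<kappa> \<partial>arc_measure)"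
    by (rule Bochner_Integration.integral_cong)
       (auto simp: finite_measure_on_space[OF finite_arc] disc_poisson_decompose[OF w] algebra_simps)
  also have "\<dots> = F w + (\<integral>\<kappa>. ?G \<kappa> / (1 - 0 * cnj \<kappa>) \<partial>arc_measure)"
    using c1 c2 by (subst Bochner_Integration.integral_add)
      (auto intro!: integrable_continuous[OF finite_arc] simp: Cauchy_szego[OF F w])
  also have "\<dots> = F w"
    using Cauchy_szego[OF G, of 0] by simp
  finally show ?thesis .
qed

lemma disc_poisson_symmetric:
  assumes "cmod \<kappa> = 1" "cmod \<alpha> = 1" "0 \<le> r"
  shows "disc_poisson (of_real r * \<kappa>) \<alpha> = disc_poisson (of_real r * \<alpha>) \<kappa>"
proof -
  have kk: "\<kappa> * cnj \<kappa> = 1" "\<alpha> * cnj \<alpha> = 1" using assms by (auto intro: mult_cnj_sphere)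
  have "\<alpha> - of_real r * \<kappa> = \<alpha> * \<kappa> * (cnj \<kappa> - of_real r * cnj \<alpha>)"
  proof -
    have "\<alpha> * \<kappa> * (cnj \<kappa> - of_real r * cnj \<alpha>) = \<alpha> * (\<kappa> * cnj \<kappa>) - of_real r * \<kappa> * (\<alpha> * cnj \<alpha>)"
      by (simp add: algebra_simps)
    then show ?thesis by (simp add: kk)
  qed
  also have "cmod \<dots> = cmod (cnj (\<kappa> - of_real r * \<alpha>))"
    by (simp add: norm_mult assms)
  finally have "cmod (\<alpha> - of_real r * \<kappa>) = cmod (\<kappa> - of_real r * \<alpha>)" by (simp only: complex_mod_cnj)
  then show ?thesis by (simp add: disc_poisson_def norm_mult assms)
qed


section \<open>Harmonic functions on the disc and their boundary measures\<close>

text \<open>The mean value theorem, applied first in the direction \<open>a\<close> and then in the direction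
  \<open>b\<close>. The left-hand side is symmetric in \<open>a\<close> and \<open>b\<close>, whence the
  symmetry of second derivatives.\<close>

lemma second_difference_mean_value:
  fixes f :: "'a::real_normed_vector \<Rightarrow> real"
  assumes f: "\<And>x. x \<in> ball z e \<Longrightarrow> (f has_derivative f' x) (at x)"
    and g: "\<And>x. x \<in> ball z e \<Longrightarrow> ((\<lambda>x. f' x a) has_derivative g' x) (at x)"
    and ab: "norm a = 1" "norm b = 1" and t: "0 < t" "2 * t < e"
  shows "\<exists>p\<in>ball z e. f (z + t *\<^sub>R a + t *\<^sub>R b) - f (z + t *\<^sub>R a) - f (z + t *\<^sub>R b) + f z = t\<^sup>2 * g' p b"
proof -
  have inball: "z + x *\<^sub>R a + y *\<^sub>R b \<in> ball z e" if "0 \<le> x" "x \<le> t" "0 \<le> y" "y \<le> t" for x y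
  proof -
    have "norm (x *\<^sub>R a + y *\<^sub>R b) \<le> x + y"
      using norm_triangle_ineq[of "x *\<^sub>R a" "y *\<^sub>R b"] that ab by simp
    moreover have "dist z (z + x *\<^sub>R a + y *\<^sub>R b) = norm (x *\<^sub>R a + y *\<^sub>R b)"
      by (simp add: dist_norm norm_minus_commute algebra_simps)
    ultimately show ?thesis using that t by simp
  qed
  have lin: "f' x (s *\<^sub>R v) = s * f' x v" if "x \<in> ball z e" for x s v
    using linear_scale[OF has_derivative_linear[OF f[OF that]]] by simp
  have lin2: "g' x (s *\<^sub>R v) = s * g' x v" if "x \<in> ball z e" for x s v
    using linear_scale[OF has_derivative_linear[OF g[OF that]]] by simp
  define G where "G x = f (z + x *\<^sub>R a + t *\<^sub>R b) - f (z + x *\<^sub>R a)" for x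
  have "\<exists>\<xi>\<in>{0..t}. G t - G 0 =
      f' (z + \<xi> *\<^sub>R a + t *\<^sub>R b) ((t - 0) *\<^sub>R a) - f' (z + \<xi> *\<^sub>R a) ((t - 0) *\<^sub>R a)"
  proof (rule mvt_very_simple)
    fix x assume x: "0 \<le> x" "x \<le> t"
    have 1: "((\<lambda>x. z + x *\<^sub>R a + t *\<^sub>R b) has_derivative (\<lambda>h. h *\<^sub>R a)) (at x within {0..t})"
            "((\<lambda>x. z + x *\<^sub>R a) has_derivative (\<lambda>h. h *\<^sub>R a)) (at x within {0..t})"
      by (auto intro!: derivative_eq_intros)
    show "(G has_derivative (\<lambda>h. f' (z + x *\<^sub>R a + t *\<^sub>R b) (h *\<^sub>R a) - f' (z + x *\<^sub>R a) (h *\<^sub>R a)))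
        (at x within {0..t})"
      unfolding G_def
      using has_derivative_compose[OF 1(1) f[OF inball]] has_derivative_compose[OF 1(2) f]
        inball[of x 0] x t
      by (intro has_derivative_diff) auto
  qed (use t in simp)
  then obtain \<xi> where \<xi>: "0 \<le> \<xi>" "\<xi> \<le> t" and eq1:
    "G t - G 0 = f' (z + \<xi> *\<^sub>R a + t *\<^sub>R b) ((t - 0) *\<^sub>R a) - f' (z + \<xi> *\<^sub>R a) ((t - 0) *\<^sub>R a)"
    by auto
  define H where "H y = f' (z + \<xi> *\<^sub>R a + y *\<^sub>R b) a" for y
  have "\<exists>\<eta>\<in>{0..t}. H t - H 0 = g' (z + \<xi> *\<^sub>R a + \<eta> *\<^sub>R b) ((t - 0) *\<^sub>R b)"
  proof (rule mvt_very_simple)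
    fix y assume y: "0 \<le> y" "y \<le> t"
    have 1: "((\<lambda>y. z + \<xi> *\<^sub>R a + y *\<^sub>R b) has_derivative (\<lambda>h. h *\<^sub>R b)) (at y within {0..t})"
      by (auto intro!: derivative_eq_intros)
    show "(H has_derivative (\<lambda>h. g' (z + \<xi> *\<^sub>R a + y *\<^sub>R b) (h *\<^sub>R b))) (at y within {0..t})"
      unfolding H_def by (rule has_derivative_compose[OF 1 g[OF inball]]) (use \<xi> y in auto)
  qed (use t in simp)
  then obtain \<eta> where \<eta>: "0 \<le> \<eta>" "\<eta> \<le> t" and eq2: "H t - H 0 = g' (z + \<xi> *\<^sub>R a + \<eta> *\<^sub>R b) ((t - 0) *\<^sub>R b)"
    by auto
  have "G t - G 0 = t * (H t - H 0)"
    using eq1 lin[OF inball[of \<xi> t]] lin[of "z + \<xi> *\<^sub>R a"] inball[of \<xi> 0] \<xi> t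
    by (simp add: H_def algebra_simps)
  also have "\<dots> = t\<^sup>2 * g' (z + \<xi> *\<^sub>R a + \<eta> *\<^sub>R b) b"
    using eq2 lin2[OF inball[OF \<xi> \<eta>]] by (simp add: power2_eq_square)
  finally have "f (z + t *\<^sub>R a + t *\<^sub>R b) - f (z + t *\<^sub>R a) - f (z + t *\<^sub>R b) + f z
      = t\<^sup>2 * g' (z + \<xi> *\<^sub>R a + \<eta> *\<^sub>R b) b"
    by (simp add: G_def algebra_simps)
  then show ?thesis using inball[OF \<xi> \<eta>] by blast
qed

lemma second_derivative_symmetric:
  fixes f :: "'a::real_normed_vector \<Rightarrow> real"
  assumes U: "open U" "z \<in> U"
    and f: "\<And>x. x \<in> U \<Longrightarrow> (f has_derivative f' x) (at x)"
    and g: "\<And>x. x \<in> U \<Longrightarrow> ((\<lambda>x. f' x a) has_derivative g' x) (at x)"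
    and h: "\<And>x. x \<in> U \<Longrightarrow> ((\<lambda>x. f' x b) has_derivative h' x) (at x)"
    and cont: "continuous_on U (\<lambda>x. g' x b)" "continuous_on U (\<lambda>x. h' x a)"
    and ab: "norm a = 1" "norm b = 1"
  shows "g' z b = h' z a"
proof (rule ccontr)
  assume ne: "g' z b \<noteq> h' z a"
  define d where "d = \<bar>g' z b - h' z a\<bar> / 2"
  have d: "d > 0" using ne by (simp add: d_def)
  have "isCont (\<lambda>x. g' x b) z" "isCont (\<lambda>x. h' x a) z"
    using cont U by (auto simp: continuous_on_eq_continuous_at)
  then have lim: "((\<lambda>x. g' x b) \<longlongrightarrow> g' z b) (nhds z)" "((\<lambda>x. h' x a) \<longlongrightarrow> h' z a) (nhds z)"
    using tendsto_at_iff_tendsto_nhds[of "\<lambda>x. g' x b" z] tendsto_at_iff_tendsto_nhds[of "\<lambda>x. h' x a" z]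
    by (simp_all add: isCont_def)
  note tendstoD[OF lim(1) d] tendstoD[OF lim(2) d]
  moreover have "\<forall>\<^sub>F x in nhds z. x \<in> U" using U by (simp add: eventually_nhds_in_open)
  ultimately have "\<forall>\<^sub>F x in nhds z. x \<in> U \<and> dist (g' x b) (g' z b) < d \<and> dist (h' x a) (h' z a) < d"
    by eventually_elim auto
  then obtain e where e: "e > 0" and near:
    "\<And>x. x \<in> ball z e \<Longrightarrow> x \<in> U \<and> dist (g' x b) (g' z b) < d \<and> dist (h' x a) (h' z a) < d"
    unfolding eventually_nhds_metric by (auto simp: dist_commute)
  have t: "0 < e / 4" "2 * (e / 4) < e" using e by auto
  obtain p where p: "p \<in> ball z e" and p2:
    "f (z + (e/4) *\<^sub>R a + (e/4) *\<^sub>R b) - f (z + (e/4) *\<^sub>R a) - f (z + (e/4) *\<^sub>R b) + f z = (e/4)\<^sup>2 * g' p b"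
    using second_difference_mean_value[of z e f f' a g' b "e/4", OF _ _ ab t] f g near by blast
  obtain q where q: "q \<in> ball z e" and q2:
    "f (z + (e/4) *\<^sub>R b + (e/4) *\<^sub>R a) - f (z + (e/4) *\<^sub>R b) - f (z + (e/4) *\<^sub>R a) + f z = (e/4)\<^sup>2 * h' q a"
    using second_difference_mean_value[of z e f f' b h' a "e/4", OF _ _ ab(2,1) t] f h near by blast
  have "(e/4)\<^sup>2 * g' p b = (e/4)\<^sup>2 * h' q a"
    unfolding p2[symmetric] q2[symmetric] by (simp add: algebra_simps)
  then have "g' p b = h' q a" using e by simp
  moreover have "\<bar>g' p b - g' z b\<bar> < d" "\<bar>h' q a - h' z a\<bar> < d"
    using near[OF p] near[OF q] by (auto simp: dist_real_def)
  ultimately show False by (auto simp: d_def abs_if split: if_splits)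
qed

text \<open>The function \<open>\<partial>\<^sub>x (Re h) - \<i> \<partial>\<^sub>y (Re h)\<close> satisfies
  the Cauchy-Riemann equations, by the Laplace equation and by the symmetry of second derivatives. A primitive
  of it is the required function, up to a constant.\<close>

lemma harmonic_imp_Re_holomorphic:
  assumes h: "harmonic_fun_on U h" and S: "S \<subseteq> U" "open S" "convex S"
  obtains F where "F holomorphic_on S" "\<And>z. z \<in> S \<Longrightarrow> Re (h z) = Re (F z)"
proof -
  obtain hx hy hxx hxy hyx hyy where
    cont: "continuous_on U hxy" "continuous_on U hyx" and
    d0: "\<And>z. z \<in> U \<Longrightarrow> (h has_derivative (\<lambda>v. Re v *\<^sub>R hx z + Im v *\<^sub>R hy z)) (at z)" and
    dx: "\<And>z. z \<in> U \<Longrightarrow> (hx has_derivative (\<lambda>v. Re v *\<^sub>R hxx z + Im v *\<^sub>R hxy z)) (at z)" and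
    dy: "\<And>z. z \<in> U \<Longrightarrow> (hy has_derivative (\<lambda>v. Re v *\<^sub>R hyx z + Im v *\<^sub>R hyy z)) (at z)" and
    lap: "\<And>z. z \<in> U \<Longrightarrow> hxx z + hyy z = 0"
    using h unfolding harmonic_fun_on_def by blast
  have r0: "((\<lambda>z. Re (h z)) has_derivative (\<lambda>v. Re v * Re (hx z) + Im v * Re (hy z))) (at z)"
    if "z \<in> S" for z
    using has_derivative_Re[OF d0[of z]] that S by auto
  have rx: "((\<lambda>z. Re (hx z)) has_derivative (\<lambda>v. Re v * Re (hxx z) + Im v * Re (hxy z))) (at z)"
    if "z \<in> S" for z
    using has_derivative_Re[OF dx[of z]] that S by auto
  have ry: "((\<lambda>z. Re (hy z)) has_derivative (\<lambda>v. Re v * Re (hyx z) + Im v * Re (hyy z))) (at z)"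
    if "z \<in> S" for z
    using has_derivative_Re[OF dy[of z]] that S by auto
  have sym: "Re (hxy z) = Re (hyx z)" if "z \<in> S" for z
    using second_derivative_symmetric[of S z "\<lambda>z. Re (h z)" "\<lambda>z v. Re v * Re (hx z) + Im v * Re (hy z)"
        1 "\<lambda>z v. Re v * Re (hxx z) + Im v * Re (hxy z)" \<i> "\<lambda>z v. Re v * Re (hyx z) + Im v * Re (hyy z)"]
      that S r0 rx ry
    by (auto intro!: continuous_intros intro: continuous_on_subset[OF cont(1)] continuous_on_subset[OF cont(2)])
  define \<phi> where "\<phi> z = of_real (Re (hx z)) - \<i> * of_real (Re (hy z))" for z
  have \<phi>: "(\<phi> has_field_derivative Complex (Re (hxx z)) (- Re (hyx z))) (at z)" if "z \<in> S" for z
  proof -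
    have l: "Re (hyy z) = - Re (hxx z)" using lap[of z] that S by (metis add_eq_0_iff plus_complex.sel(1) subsetD uminus_complex.sel(1))
    have "(\<phi> has_derivative (\<lambda>v. of_real (Re v * Re (hxx z) + Im v * Re (hxy z))
        - \<i> * of_real (Re v * Re (hyx z) + Im v * Re (hyy z)))) (at z)"
      unfolding \<phi>_def
      by (intro has_derivative_diff has_derivative_mult_right has_derivative_of_real rx ry that)
    also have "(\<lambda>v. complex_of_real (Re v * Re (hxx z) + Im v * Re (hxy z))
        - \<i> * of_real (Re v * Re (hyx z) + Im v * Re (hyy z))) = (*) (Complex (Re (hxx z)) (- Re (hyx z)))"
      by (rule ext) (simp add: complex_eq_iff sym[OF that] l algebra_simps)
    finally show ?thesis by (simp add: has_field_derivative_def)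
  qed
  then have "\<phi> holomorphic_on S"
    using S by (auto simp: holomorphic_on_open)
  from holomorphic_convex_primitive'[OF S(3,2) this]
  obtain g where g: "\<And>x. x \<in> S \<Longrightarrow> (g has_field_derivative \<phi> x) (at x within S)" by blast
  \<comment> \<open>The differentials of \<open>Re h\<close> and \<open>Re g\<close> agree.\<close>
  have "\<exists>c. \<forall>x\<in>S. Re (h x) - Re (g x) = c"
  proof (rule has_derivative_zero_constant[OF S(3)])
    fix x assume x: "x \<in> S"
    have "((\<lambda>x. Re (g x)) has_derivative (\<lambda>v. Re (\<phi> x * v))) (at x within S)"
      using g[OF x] by (intro has_derivative_Re) (simp add: has_field_derivative_def)
    then have "((\<lambda>x. Re (h x) - Re (g x)) has_derivative
        (\<lambda>v. Re v * Re (hx x) + Im v * Re (hy x) - Re (\<phi> x * v))) (at x within S)"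
      using has_derivative_at_withinI[OF r0[OF x]] by (rule_tac has_derivative_diff)
    also have "(\<lambda>v. Re v * Re (hx x) + Im v * Re (hy x) - Re (\<phi> x * v)) = (\<lambda>v. 0)"
      by (simp add: \<phi>_def algebra_simps)
    finally show "((\<lambda>x. Re (h x) - Re (g x)) has_derivative (\<lambda>v. 0)) (at x within S)" .
  qed
  then obtain c where c: "\<And>x. x \<in> S \<Longrightarrow> Re (h x) - Re (g x) = c" by blast
  show ?thesis
  proof (rule that[of "\<lambda>z. g z + of_real c"])
    show "(\<lambda>z. g z + of_real c) holomorphic_on S"
      using g by (intro holomorphic_intros) (auto simp: holomorphic_on_def field_differentiable_def)
    show "Re (h z) = Re (g z + of_real c)" if "z \<in> S" for z
      using c[OF that] by simp
  qed
qed

text \<open>A fixed sequence of radii in the half-open unit interval which increases to 1.\<close>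

definition radius :: "nat \<Rightarrow> real" where
  "radius n = 1 - inverse (real (Suc n))"

lemma radius: "0 \<le> radius n" "radius n < 1"
  by (auto simp: radius_def field_simps)

lemma radius_tendsto: "radius \<longlonglongrightarrow> 1"
  unfolding radius_def
  using tendsto_diff[OF tendsto_const LIMSEQ_inverse_real_of_nat, of 1] by simp

lemma dilation_in_disc: "0 \<le> r \<Longrightarrow> r < 1 \<Longrightarrow> cmod w \<le> 1 \<Longrightarrow> cmod (of_real r * w) < 1"
  by (simp add: norm_mult) (metis mult_left_le order_le_less_trans)

lemma Poisson_formula_dilated:
  assumes F: "F holomorphic_on ball 0 1" and r: "0 \<le> r" "r < 1" and w: "cmod w < 1"
  shows "(\<integral>\<kappa>. disc_poisson w \<kappa> * Re (F (of_real r * \<kappa>)) \<partial>arc_measure) = Re (F (of_real r * w))"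
proof -
  have sub: "(\<lambda>z. of_real r * z) ` cball 0 1 \<subseteq> ball (0::complex) 1"
    using dilation_in_disc[OF r] by (auto simp: dist_norm)
  have c: "continuous_on (cball 0 1) (\<lambda>z. F (of_real r * z))"
    by (rule continuous_on_compose2[OF holomorphic_on_imp_continuous_on[OF F] _ sub])
       (intro continuous_intros)
  have "(\<lambda>z. F (of_real r * z)) holomorphic_on ball 0 1"
  proof (rule holomorphic_on_compose_gen[OF _ F, unfolded o_def])
    show "(\<lambda>z. of_real r * z) ` ball 0 1 \<subseteq> ball (0::complex) 1"
      by (rule order_trans[OF image_mono[OF ball_subset_cball] sub])
  qed (auto intro!: holomorphic_intros)
  note P = Poisson_formula[OF c this w]
  have "continuous_on (sphere 0 1) (\<lambda>\<kappa>. of_real (disc_poisson w \<kappa>) * F (of_real r * \<kappa>))"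
    using continuous_disc_poisson[OF w] continuous_on_subset[OF c, of "sphere 0 1"]
    by (intro continuous_intros) auto
  note I = integrable_continuous[OF finite_arc this]
  show ?thesis
    using arg_cong[OF P, of Re] unfolding integral_Re[OF I, symmetric] by simp
qed

lemma integral_arc_real:
  assumes "continuous_on (sphere 0 1) \<phi>"
  shows "(\<integral>\<kappa>. \<phi> \<kappa> \<partial>arc_measure) = (\<integral>t. (\<phi> (circlepath 0 1 t) :: real) \<partial>unit_interval_measure)"
  unfolding arc_measure_def
  by (rule integral_distr)
     (simp_all add: measurable_unit_interval measurable_circlepath01 borel_measurable_continuous_on_restrict[OF assms])

lemma continuous_circlepath01_compose:
  "continuous_on (sphere 0 1) \<phi> \<Longrightarrow> continuous_on S (\<lambda>t. \<phi> (circlepath 0 1 t))"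
  by (rule continuous_on_compose2[OF _ continuous_circlepath01]) auto

text \<open>The functions \<open>Re F\<close> on the circles of radius tending to 1, divided by \<open>Re (F
  0)\<close>, are densities of probability measures. They are carried to the line, where Helly's theorem gives
  a weak limit of a subsequence; its image on the circle is the required measure, since the Poisson kernel is
  a continuous test function and reproduces the values of \<open>Re F\<close> at each stage.\<close>

lemma Herglotz:
  assumes F: "F holomorphic_on ball 0 1" and nn: "\<And>w. cmod w < 1 \<Longrightarrow> 0 \<le> Re (F w)" and pos: "0 < Re (F 0)"
  obtains m where "finite_measure_on (sphere 0 1) m" "emeasure m (sphere 0 1) = ennreal (Re (F 0))"
    "\<And>w. cmod w < 1 \<Longrightarrow> (\<integral>\<kappa>. disc_poisson w \<kappa> \<partial>m) = Re (F w)"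
proof -
  let ?e = "circlepath 0 1 :: real \<Rightarrow> complex"
  let ?U = unit_interval_measure
  define c where "c = Re (F 0)"
  define h where "h n \<kappa> = Re (F (of_real (radius n) * \<kappa>)) / c" for n \<kappa>
  have hc: "continuous_on (sphere 0 1) (h n)" for n
    unfolding h_def using dilation_in_disc[OF radius] pos
    by (intro continuous_intros continuous_on_compose2[OF holomorphic_on_imp_continuous_on[OF F]]) (auto simp: c_def)
  have hnn: "0 \<le> h n \<kappa>" if "cmod \<kappa> = 1" for n \<kappa>
    using nn[OF dilation_in_disc[OF radius]] pos that by (simp add: h_def c_def)
  have hm [measurable]: "(\<lambda>t. h n (?e t)) \<in> borel_measurable borel" for n
    by (intro borel_measurable_continuous_onI continuous_circlepath01_compose hc)
  have hP: "(\<integral>\<kappa>. disc_poisson w \<kappa> * h n \<kappa> \<partial>arc_measure) = Re (F (of_real (radius n) * w)) / c" if "cmod w < 1" for w n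
    using Poisson_formula_dilated[OF F radius that, of n] by (simp add: h_def)
  \<comment> \<open>The normalized boundary values on the circle of radius \<open>radius n\<close>, transported to the line.\<close>
  define N where "N n = density ?U (\<lambda>t. ennreal (h n (?e t)))" for n
  have sN: "sets (N n) = sets borel" "space (N n) = UNIV" for n
    by (auto simp: N_def unit_interval_measure_def)
  have intN: "(\<integral>t. G (?e t) \<partial>N n) = (\<integral>\<kappa>. G \<kappa> * h n \<kappa> \<partial>arc_measure)" if "continuous_on (sphere 0 1) G" for G :: "complex \<Rightarrow> real" and n
  proof -
    have "(\<integral>t. G (?e t) \<partial>N n) = (\<integral>t. h n (?e t) *\<^sub>R G (?e t) \<partial>?U)"
      unfolding N_def
      by (rule integral_density)
         (auto simp: measurable_unit_interval hnn intro!: borel_measurable_continuous_onI continuous_circlepath01_compose that)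
    also have "\<dots> = (\<integral>\<kappa>. G \<kappa> * h n \<kappa> \<partial>arc_measure)"
      by (subst integral_arc_real) (auto intro!: continuous_intros that hc simp: mult.commute)
    finally show ?thesis .
  qed
  have prob: "prob_space (N n)" for n
  proof (rule prob_spaceI)
    have "emeasure (N n) (space (N n)) = (\<integral>\<^sup>+t. ennreal (h n (?e t)) \<partial>?U)"
      by (simp add: N_def emeasure_density measurable_unit_interval)
    also have "\<dots> = ennreal (\<integral>t. h n (?e t) \<partial>?U)"
    proof (rule nn_integral_eq_integral)
      interpret prob_space ?U by (rule prob_unit_interval)
      obtain B where "0 \<le> B" "\<And>x. x \<in> sphere 0 1 \<Longrightarrow> norm (h n x) \<le> B"
        by (rule continuous_on_compact_bound[OF compact_sphere hc]) (rule that, auto)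
      then show "integrable ?U (\<lambda>t. h n (?e t))"
        by (intro integrable_const_bound[of _ B]) (auto simp: measurable_unit_interval)
    qed (simp add: hnn)
    also have "(\<integral>t. h n (?e t) \<partial>?U) = (\<integral>\<kappa>. disc_poisson 0 \<kappa> * h n \<kappa> \<partial>arc_measure)"
      unfolding integral_arc_real[OF hc, symmetric]
      by (rule Bochner_Integration.integral_cong) (auto simp: finite_measure_on_space[OF finite_arc] disc_poisson_def)
    also have "\<dots> = 1" unfolding hP[of 0, simplified] using pos by (simp add: c_def)
    finally show "emeasure (N n) (space (N n)) = 1" by simp
  qed
  have rd: "real_distribution (N n)" for n
    by (intro real_distribution.intro real_distribution_axioms.intro prob sN)
  have "tight N"
    unfolding tight_def
  proof (intro conjI allI impI)
    show "real_distribution (N n)" for n by (rule rd)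
    fix \<epsilon> :: real assume \<epsilon>: "\<epsilon> > 0"
    have "measure (N n) {-1<..1} = 1" for n
    proof -
      interpret prob_space "N n" by (rule prob)
      have "AE t in N n. t \<in> {-1<..1}"
        unfolding N_def unit_interval_measure_def
        by (subst AE_density, simp add: hm cong: measurable_cong_sets, subst AE_density) (auto simp: indicator_def)
      then show ?thesis by (subst (asm) AE_in_set_eq_1) (auto simp: sN)
    qed
    then show "\<exists>a b. a < b \<and> (\<forall>n. 1 - \<epsilon> < measure (N n) {a<..b})"
      using \<epsilon> by (intro exI[of _ "-1"] exI[of _ 1]) auto
  qed
  from tight_imp_convergent_subsubsequence[OF this strict_mono_id]
  obtain k M where k: "strict_mono (k::nat\<Rightarrow>nat)" and M: "real_distribution M" "weak_conv_m (N \<circ> id \<circ> k) M" by blast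
  interpret M: real_distribution M by (rule M(1))
  have lim: "(\<lambda>n. \<integral>t. G (?e t) \<partial>N (k n)) \<longlonglongrightarrow> (\<integral>t. G (?e t) \<partial>M)"
    if "continuous_on (sphere 0 1) G" for G :: "complex \<Rightarrow> real"
  proof -
    note G = that
    obtain B where B: "0 \<le> B" "\<And>x. x \<in> sphere 0 1 \<Longrightarrow> norm (G x) \<le> B"
      by (rule continuous_on_compact_bound[OF compact_sphere G]) (rule that, auto)
    have "(\<lambda>n. \<integral>t. G (?e t) \<partial>(N \<circ> id \<circ> k) n) \<longlonglongrightarrow> (\<integral>t. G (?e t) \<partial>M)"
    proof (rule weak_conv_imp_integral_bdd_continuous_conv)
      show "isCont (\<lambda>t. G (?e t)) x" for x
        using continuous_circlepath01_compose[OF that, of UNIV] by (simp add: continuous_on_eq_continuous_at)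
      show "norm (G (?e x)) \<le> B" for x by (rule B(2)) (simp add: dist_norm)
    qed (use M rd in \<open>auto simp: o_def\<close>)
    then show ?thesis by simp
  qed
  have meas_e: "?e \<in> M \<rightarrow>\<^sub>M restrict_space borel (sphere 0 1)"
    using measurable_circlepath01 by (simp cong: measurable_cong_sets)
  define m where "m = density (distr M (restrict_space borel (sphere 0 1)) ?e) (\<lambda>_. ennreal c)"
  have sm: "sets m = sets (restrict_space borel (sphere 0 1))" by (simp add: m_def)
  have spm: "space m = sphere 0 1" using sets_eq_imp_space_eq[OF sm] by (simp add: space_restrict_space)
  have em: "emeasure m (sphere 0 1) = ennreal c"
  proof -
    have "emeasure (distr M (restrict_space borel (sphere 0 1)) ?e) (sphere 0 1) = 1"
      using prob_space.emeasure_space_1[OF M.prob_space_distr[OF meas_e]] by (simp add: space_restrict_space)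
    then show ?thesis
      unfolding m_def by (subst emeasure_density_const) (auto simp: sets_restrict_space)
  qed
  have fm: "finite_measure_on (sphere 0 1) m"
    unfolding finite_measure_on_def using sm em spm by (auto intro!: finite_measureI)
  have "(\<integral>\<kappa>. disc_poisson w \<kappa> \<partial>m) = Re (F w)" if w: "cmod w < 1" for w
  proof -
    have cp: "continuous_on (sphere 0 1) (disc_poisson w)" by (rule continuous_disc_poisson[OF w])
    have "(\<integral>\<kappa>. disc_poisson w \<kappa> \<partial>m) = c * (\<integral>\<kappa>. disc_poisson w \<kappa> \<partial>distr M (restrict_space borel (sphere 0 1)) ?e)"
      using pos unfolding m_def
      by (subst integral_density) (auto simp: c_def intro: borel_measurable_continuous_on_restrict cp)
    also have "\<dots> = c * (\<integral>t. disc_poisson w (?e t) \<partial>M)"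
      by (subst integral_distr[OF meas_e]) (auto intro: borel_measurable_continuous_on_restrict cp)
    finally have 1: "(\<integral>\<kappa>. disc_poisson w \<kappa> \<partial>m) = c * (\<integral>t. disc_poisson w (?e t) \<partial>M)" .
    have "(\<lambda>n. c * (\<integral>t. disc_poisson w (?e t) \<partial>N (k n))) \<longlonglongrightarrow> c * (\<integral>t. disc_poisson w (?e t) \<partial>M)"
      by (intro tendsto_intros lim cp)
    moreover have "c * (\<integral>t. disc_poisson w (?e t) \<partial>N (k n)) = Re (F (of_real (radius (k n)) * w))" for n
      using pos by (simp add: intN[OF cp] hP[OF w] c_def)
    moreover have "(\<lambda>n. Re (F (of_real (radius (k n)) * w))) \<longlonglongrightarrow> Re (F w)"
    proof -
      have 2: "(\<lambda>n. of_real (radius (k n)) * w) \<longlonglongrightarrow> of_real 1 * w"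
        using LIMSEQ_subseq_LIMSEQ[OF radius_tendsto k] by (intro tendsto_intros) (simp add: o_def)
      have "isCont F w" using F w by (auto simp: continuous_on_eq_continuous_at dest!: holomorphic_on_imp_continuous_on)
      from isCont_tendsto_compose[OF this, of "\<lambda>n. of_real (radius (k n)) * w"] 2
      show ?thesis by (intro tendsto_Re) simp
    qed
    ultimately show ?thesis unfolding 1 by (simp add: LIMSEQ_unique)
  qed
  with fm em show ?thesis using that by (simp add: c_def)
qed

section \<open>Approximate identities\<close>

text \<open>The modulus of continuity in the form in which it can be integrated against a kernel with small
  mean square distance from its centre: near points are taken care of by \<open>\<epsilon>\<close>, distant
  ones by the quadratic term.\<close>

lemma uniform_continuity_quadratic:
  fixes g :: "'a::metric_space \<Rightarrow> complex"
  assumes K: "compact K" and g: "continuous_on K g" and \<epsilon>: "0 < \<epsilon>"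
  obtains L where "0 \<le> L" "\<And>x y. x \<in> K \<Longrightarrow> y \<in> K \<Longrightarrow> norm (g x - g y) \<le> \<epsilon> + L * (dist x y)\<^sup>2"
proof -
  obtain d where d: "d > 0" and near: "\<And>x y. x \<in> K \<Longrightarrow> y \<in> K \<Longrightarrow> dist x y < d \<Longrightarrow> dist (g x) (g y) < \<epsilon>"
    using compact_uniformly_continuous[OF g K] \<epsilon> unfolding uniformly_continuous_on_def by metis
  obtain B where B0: "0 \<le> B" and B: "\<And>x. x \<in> K \<Longrightarrow> norm (g x) \<le> B"
    by (rule continuous_on_compact_bound[OF K g]) (rule that, auto)
  \<comment> \<open>Beyond distance \<open>d\<close>, the quadratic term is at least the crude bound \<open>2 B\<close>.\<close>
  show ?thesis
  proof (rule that[of "2 * B / d\<^sup>2"])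
    fix x y assume xy: "x \<in> K" "y \<in> K"
    show "norm (g x - g y) \<le> \<epsilon> + 2 * B / d\<^sup>2 * (dist x y)\<^sup>2"
    proof (cases "dist x y < d")
      case True
      then have "norm (g x - g y) < \<epsilon>" using near[OF xy] by (simp add: dist_norm)
      moreover have "0 \<le> 2 * B / d\<^sup>2 * (dist x y)\<^sup>2" using B0 by simp
      ultimately show ?thesis by linarith
    next
      case False
      have "norm (g x - g y) \<le> norm (g x) + norm (g y)" by (rule norm_triangle_ineq4)
      also have "\<dots> \<le> 2 * B" using B[OF xy(1)] B[OF xy(2)] by linarith
      also have "\<dots> \<le> 2 * B * ((dist x y)\<^sup>2 / d\<^sup>2)"
      proof -
        have "d\<^sup>2 \<le> (dist x y)\<^sup>2" using False d by (intro power_mono) auto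
        then have "1 \<le> (dist x y)\<^sup>2 / d\<^sup>2" using d by simp
        then show ?thesis using mult_left_mono[of 1 "(dist x y)\<^sup>2 / d\<^sup>2" "2 * B"] B0 by simp
      qed
      finally show ?thesis using \<epsilon> by simp
    qed
  qed (use B0 in simp)
qed

text \<open>By Fubini, the difference is the integral against \<open>m\<close> of the error committed by the
  average of \<open>g\<close> around \<open>y\<close>, and this error is at most the average of
  \<open>\<epsilon> + L (dist x y)\<^sup>2\<close>.\<close>

lemma approximate_identity_bound:
  fixes g :: "'a::euclidean_space \<Rightarrow> complex"
  assumes \<sigma>: "finite_measure_on K \<sigma>" and m: "finite_measure_on K m"
    and p: "continuous_on (K \<times> K) (\<lambda>q. p (fst q) (snd q))" "\<And>x y. x \<in> K \<Longrightarrow> y \<in> K \<Longrightarrow> 0 \<le> p x y"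
    and mass: "\<And>y. y \<in> K \<Longrightarrow> (\<integral>x. p x y \<partial>\<sigma>) = 1"
    and spread: "\<And>y. y \<in> K \<Longrightarrow> (\<integral>x. (dist x y)\<^sup>2 * p x y \<partial>\<sigma>) \<le> \<delta>"
    and g: "continuous_on K g" "\<And>x y. x \<in> K \<Longrightarrow> y \<in> K \<Longrightarrow> norm (g x - g y) \<le> \<epsilon> + L * (dist x y)\<^sup>2" "0 \<le> L"
  shows "norm ((\<integral>x. g x * of_real (\<integral>y. p x y \<partial>m) \<partial>\<sigma>) - (\<integral>y. g y \<partial>m)) \<le> measure m K * (\<epsilon> + L * \<delta>)"
proof -
  interpret m: finite_measure m using m by (simp add: finite_measure_on_def)
  have K: "compact K" using m by (simp add: finite_measure_on_def)
  have p1: "continuous_on K (\<lambda>x. p x y)" if "y \<in> K" for y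
    using that by (intro continuous_on_compose2[OF p(1), of K "\<lambda>x. (x, y)", simplified]) (auto intro!: continuous_intros)
  have p2: "continuous_on K (\<lambda>y. p x y)" if "x \<in> K" for x
    using that by (intro continuous_on_compose2[OF p(1), of K "\<lambda>y. (x, y)", simplified]) (auto intro!: continuous_intros)
  have gp: "continuous_on (K \<times> K) (\<lambda>q. g (fst q) * complex_of_real (p (fst q) (snd q)))"
    by (intro continuous_intros p(1) continuous_on_compose2[OF g(1) continuous_on_fst]) auto
  have "(\<integral>x. g x * of_real (\<integral>y. p x y \<partial>m) \<partial>\<sigma>) = (\<integral>x. (\<integral>y. g x * of_real (p x y) \<partial>m) \<partial>\<sigma>)"
    by simp
  also have "\<dots> = (\<integral>y. (\<integral>x. g x * of_real (p x y) \<partial>\<sigma>) \<partial>m)"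
    by (rule Fubini_continuous[OF \<sigma> m gp])
  finally have eq: "(\<integral>x. g x * of_real (\<integral>y. p x y \<partial>m) \<partial>\<sigma>) - (\<integral>y. g y \<partial>m)
      = (\<integral>y. (\<integral>x. g x * of_real (p x y) \<partial>\<sigma>) - g y \<partial>m)"
    using integrable_continuous[OF m g(1)]
      integrable_continuous[OF m continuous_on_integral_parameter[OF \<sigma> K gp]]
    by (simp add: Bochner_Integration.integral_diff)
  have pointwise: "norm ((\<integral>x. g x * of_real (p x y) \<partial>\<sigma>) - g y) \<le> \<epsilon> + L * \<delta>" if y: "y \<in> K" for y
  proof -
    note I = integrable_continuous[OF \<sigma>]
    have "(\<integral>x. g x * of_real (p x y) \<partial>\<sigma>) - g y = (\<integral>x. g x * of_real (p x y) \<partial>\<sigma>) - (\<integral>x. g y * of_real (p x y) \<partial>\<sigma>)"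
      using mass[OF y] by simp
    also have "\<dots> = (\<integral>x. (g x - g y) * of_real (p x y) \<partial>\<sigma>)"
      by (subst Bochner_Integration.integral_diff[symmetric])
         (auto intro!: I continuous_intros g p1 y simp: algebra_simps)
    also have "norm \<dots> \<le> (\<integral>x. \<epsilon> * p x y + L * ((dist x y)\<^sup>2 * p x y) \<partial>\<sigma>)"
    proof (rule Bochner_Integration.integral_norm_bound_integral)
      fix x assume "x \<in> space \<sigma>"
      then have x: "x \<in> K" using \<sigma> by (simp add: finite_measure_on_space)
      show "norm ((g x - g y) * complex_of_real (p x y)) \<le> \<epsilon> * p x y + L * ((dist x y)\<^sup>2 * p x y)"
        unfolding norm_mult norm_of_real abs_of_nonneg[OF p(2)[OF x y]]
        using mult_right_mono[OF g(2)[OF x y] p(2)[OF x y]] by (simp only: distrib_right mult.assoc)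
    qed (auto intro!: I continuous_intros g p1 y)
    also have "\<dots> = \<epsilon> + L * (\<integral>x. (dist x y)\<^sup>2 * p x y \<partial>\<sigma>)"
      by (subst Bochner_Integration.integral_add) (auto intro!: I continuous_intros p1 y simp: mass[OF y])
    also have "\<dots> \<le> \<epsilon> + L * \<delta>" using spread[OF y] g(3) by (simp add: mult_left_mono)
    finally show ?thesis .
  qed
  have c: "continuous_on K (\<lambda>y. (\<integral>x. g x * of_real (p x y) \<partial>\<sigma>) - g y)"
    by (intro continuous_intros g continuous_on_integral_parameter[OF \<sigma> K gp])
  have "norm (\<integral>y. (\<integral>x. g x * of_real (p x y) \<partial>\<sigma>) - g y \<partial>m) \<le> (\<integral>y. \<epsilon> + L * \<delta> \<partial>m)"
    by (rule Bochner_Integration.integral_norm_bound_integral)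
       (use pointwise m in \<open>auto intro!: integrable_continuous[OF m c] simp: finite_measure_on_space\<close>)
  also have "\<dots> = measure m K * (\<epsilon> + L * \<delta>)" using m by (simp add: finite_measure_on_space)
  finally show ?thesis unfolding eq .
qed

lemma disc_poisson_mass:
  assumes "cmod w < 1" shows "(\<integral>\<kappa>. disc_poisson w \<kappa> \<partial>arc_measure) = 1"
  using arg_cong[OF Poisson_formula[of "\<lambda>_. 1", OF _ _ assms], of Re]
  by (simp add: integral_complex_of_real)

text \<open>On the unit circle the squared distance from \<open>\<kappa>\<close> is the real part of the
  affine function \<open>2 - 2 cnj \<kappa> \<alpha>\<close> of \<open>\<alpha>\<close>, which the Poisson
  kernel evaluates at its pole.\<close>

lemma disc_poisson_spread:
  assumes r: "0 \<le> r" "r < 1" and \<kappa>: "cmod \<kappa> = 1"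
  shows "(\<integral>\<alpha>. (dist \<alpha> \<kappa>)\<^sup>2 * disc_poisson (of_real r * \<kappa>) \<alpha> \<partial>arc_measure) = 2 - 2 * r"
proof -
  let ?p = "disc_poisson (of_real r * \<kappa>)"
  have w: "cmod (of_real r * \<kappa>) < 1" using dilation_in_disc[OF r] \<kappa> by simp
  have c: "continuous_on (sphere 0 1) ?p" by (rule continuous_disc_poisson[OF w])
  have "(\<integral>\<alpha>. of_real (?p \<alpha>) * (2 - 2 * cnj \<kappa> * \<alpha>) \<partial>arc_measure) = 2 - 2 * cnj \<kappa> * (of_real r * \<kappa>)"
    by (rule Poisson_formula[OF _ _ w]) (auto intro!: continuous_intros holomorphic_intros)
  also have "\<dots> = of_real (2 - 2 * r)" using mult_cnj_sphere[OF \<kappa>] by (simp add: algebra_simps)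
  finally have P: "(\<integral>\<alpha>. of_real (?p \<alpha>) * (2 - 2 * cnj \<kappa> * \<alpha>) \<partial>arc_measure) = of_real (2 - 2 * r)" .
  have I: "integrable arc_measure (\<lambda>\<alpha>. of_real (?p \<alpha>) * (2 - 2 * cnj \<kappa> * \<alpha>))"
    by (intro integrable_continuous[OF finite_arc] continuous_intros c)
  have "(\<integral>\<alpha>. (dist \<alpha> \<kappa>)\<^sup>2 * ?p \<alpha> \<partial>arc_measure) = (\<integral>\<alpha>. Re (of_real (?p \<alpha>) * (2 - 2 * cnj \<kappa> * \<alpha>)) \<partial>arc_measure)"
  proof (rule Bochner_Integration.integral_cong)
    fix \<alpha> assume "\<alpha> \<in> space arc_measure"
    then have \<alpha>: "cmod \<alpha> = 1" by (simp add: finite_measure_on_space[OF finite_arc])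
    have "complex_of_real ((cmod (\<alpha> - \<kappa>))\<^sup>2) = (\<alpha> - \<kappa>) * cnj (\<alpha> - \<kappa>)" by (rule complex_norm_square)
    also have "\<dots> = \<alpha> * cnj \<alpha> + \<kappa> * cnj \<kappa> - (cnj \<kappa> * \<alpha> + cnj (cnj \<kappa> * \<alpha>))" by (simp add: algebra_simps)
    also have "\<dots> = of_real (2 - 2 * Re (cnj \<kappa> * \<alpha>))"
      unfolding mult_cnj_sphere[OF \<alpha>] mult_cnj_sphere[OF \<kappa>] complex_add_cnj by simp
    finally have "(cmod (\<alpha> - \<kappa>))\<^sup>2 = 2 - 2 * Re (cnj \<kappa> * \<alpha>)" by (simp only: of_real_eq_iff)
    moreover have "Re (of_real (?p \<alpha>) * (2 - 2 * cnj \<kappa> * \<alpha>)) = ?p \<alpha> * (2 - 2 * Re (cnj \<kappa> * \<alpha>))"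
      by (simp add: algebra_simps)
    ultimately show "(dist \<alpha> \<kappa>)\<^sup>2 * ?p \<alpha> = Re (of_real (?p \<alpha>) * (2 - 2 * cnj \<kappa> * \<alpha>))"
      by (simp only: dist_norm mult.commute)
  qed simp
  also have "\<dots> = 2 - 2 * r"
    using arg_cong[OF P, of Re] unfolding integral_Re[OF I] by simp
  finally show ?thesis .
qed


section \<open>Complex scalar multiplication and linear automorphisms\<close>

lemma norm_smult: "norm (c *s (v::complex^'n)) = cmod c * norm v"
  by (simp add: norm_vec_def L2_set_def norm_mult power_mult_distrib sum_distrib_left[symmetric] real_sqrt_mult)

lemma of_real_smult: "of_real r *s (v::complex^'n) = r *\<^sub>R v"
  by (simp add: vec_eq_iff scaleR_conv_of_real[where 'a = complex])

lemma continuous_on_smult [continuous_intros]: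
  fixes v :: "_ \<Rightarrow> complex^'n"
  assumes "continuous_on S c" "continuous_on S v"
  shows "continuous_on S (\<lambda>x. c x *s v x)"
  unfolding vector_scalar_mult_def
  by (intro continuous_on_vec_lambda continuous_intros assms)

lemma bounded_linear_smult_left: "bounded_linear (\<lambda>c. c *s (v::complex^'n))"
proof (rule bounded_linear_intro[where K = "norm v"])
  show "(x + y) *s v = x *s v + y *s v" for x y :: complex by (rule vector_sadd_rdistrib)
  show "(r *\<^sub>R x) *s v = r *\<^sub>R (x *s v)" for r and x :: complex
    by (simp add: vec_eq_iff)
  show "norm (x *s v) \<le> norm x * norm v" for x :: complex by (simp add: norm_smult)
qed

lemma bounded_linear_matrix: "bounded_linear (\<lambda>z. (A::complex^'n^'n) *v z)"
proof -
  have "linear (\<lambda>z. A *v z)"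
  proof (rule linearI)
    show "A *v (x + y) = A *v x + A *v y" for x y by (rule matrix_vector_right_distrib)
    show "A *v (r *\<^sub>R x) = r *\<^sub>R (A *v x)" for r x
      unfolding of_real_smult[symmetric] by (rule vector_scalar_commute)
  qed
  then show ?thesis by (simp add: linear_conv_bounded_linear)
qed

lemma continuous_on_matrix: "continuous_on S (\<lambda>z. (A::complex^'n^'n) *v z)"
  by (rule bounded_linear.continuous_on[OF bounded_linear_matrix continuous_on_id])

lemma mat_vector_mult: "mat (c::complex) *v (z::complex^'n) = c *s z"
proof -
  have "(\<Sum>j\<in>UNIV. (if i = j then c else 0) * z $ j) = c * z $ i" for i
    using sum.delta[of UNIV i "\<lambda>j. c * z $ j"] by (simp add: if_distrib[of "\<lambda>x. x * _"] cong: if_cong)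
  then show ?thesis by (simp add: vec_eq_iff matrix_vector_mult_def mat_def)
qed

definition hermitian_inner :: "complex^'n \<Rightarrow> complex^'n \<Rightarrow> complex" where
  "hermitian_inner x y = (\<Sum>i\<in>UNIV. x $ i * cnj (y $ i))"

lemma Re_hermitian_inner: "Re (hermitian_inner x y) = x \<bullet> y"
  by (simp add: hermitian_inner_def inner_vec_def inner_complex_def)

lemma hermitian_inner_self: "hermitian_inner x x = of_real ((norm x)\<^sup>2)"
  unfolding hermitian_inner_def norm_vec_def L2_set_def
  by (simp add: complex_norm_square[symmetric] sum_nonneg)

lemma unitary_isometry:
  fixes A :: "complex^'n^'n"
  assumes "A \<in> unitary_group" shows "norm (A *v x) = norm x"
proof -
  have U: "(\<Sum>i\<in>UNIV. cnj (A $ i $ j) * A $ i $ k) = (if j = k then 1 else 0)" for j k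
    using arg_cong[OF assms[unfolded unitary_group_def mem_Collect_eq], of "\<lambda>M. M $ j $ k"]
    by (simp add: matrix_matrix_mult_def mat_def map_matrix_def transpose_def)
  have "hermitian_inner (A *v x) (A *v x)
      = (\<Sum>i\<in>UNIV. (\<Sum>k\<in>UNIV. A $ i $ k * x $ k) * (\<Sum>j\<in>UNIV. cnj (A $ i $ j) * cnj (x $ j)))"
    by (simp add: hermitian_inner_def matrix_vector_mult_def)
  also have "\<dots> = (\<Sum>i\<in>UNIV. \<Sum>k\<in>UNIV. \<Sum>j\<in>UNIV. cnj (A $ i $ j) * A $ i $ k * (x $ k * cnj (x $ j)))"
    by (simp add: sum_product mult_ac)
  also have "\<dots> = (\<Sum>k\<in>UNIV. \<Sum>i\<in>UNIV. \<Sum>j\<in>UNIV. cnj (A $ i $ j) * A $ i $ k * (x $ k * cnj (x $ j)))"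
    by (rule sum.swap)
  also have "\<dots> = (\<Sum>k\<in>UNIV. \<Sum>j\<in>UNIV. \<Sum>i\<in>UNIV. cnj (A $ i $ j) * A $ i $ k * (x $ k * cnj (x $ j)))"
    by (rule sum.cong[OF refl sum.swap])
  also have "\<dots> = (\<Sum>k\<in>UNIV. \<Sum>j\<in>UNIV. (if j = k then 1 else 0) * (x $ k * cnj (x $ j)))"
    by (simp only: sum_distrib_right[symmetric] U)
  also have "\<dots> = hermitian_inner x x"
    by (simp add: hermitian_inner_def if_distrib[of "\<lambda>y. y * _"] cong: if_cong)
  finally have "complex_of_real ((norm (A *v x))\<^sup>2) = of_real ((norm x)\<^sup>2)"
    by (simp only: hermitian_inner_self)
  then have "(norm (A *v x))\<^sup>2 = (norm x)\<^sup>2" by (simp only: of_real_eq_iff)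
  then show ?thesis by simp
qed

lemma linear_automorphism_inverse:
  assumes "A \<in> linear_automorphisms D"
  shows "\<exists>A'\<in>linear_automorphisms D. (\<forall>z. A' *v (A *v z) = z) \<and> (\<forall>z. A *v (A' *v z) = z)"
proof -
  obtain A' where A': "A ** A' = mat 1" "A' ** A = mat 1"
    using assms by (auto simp: linear_automorphisms_def invertible_def)
  have inv: "A' *v (A *v z) = z" "A *v (A' *v z) = z" for z
    by (simp_all add: matrix_vector_mul_assoc A')
  have "A' \<in> linear_automorphisms D"
    unfolding linear_automorphisms_def
  proof (intro CollectI conjI)
    show "invertible A'" using A' by (auto simp: invertible_def)
    have D: "(\<lambda>z. A *v z) ` D = D" using assms by (simp add: linear_automorphisms_def)
    have "(\<lambda>z. A' *v z) ` D = (\<lambda>z. A' *v z) ` (\<lambda>z. A *v z) ` D" by (simp only: D)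
    then show "(\<lambda>z. A' *v z) ` D = D" by (simp add: image_image inv)
  qed
  then show ?thesis using inv by auto
qed

lemma rotation_linear_automorphism:
  assumes "circular D" "cmod \<alpha> = 1"
  shows "mat \<alpha> \<in> linear_automorphisms D"
  unfolding linear_automorphisms_def
proof (intro CollectI conjI)
  have a: "\<alpha> * cnj \<alpha> = 1" by (rule mult_cnj_sphere[OF assms(2)])
  have "mat \<alpha> ** mat (cnj \<alpha>) = (mat 1 :: complex^'n^'n)" "mat (cnj \<alpha>) ** mat \<alpha> = (mat 1 :: complex^'n^'n)"
    unfolding matrix_eq by (simp_all add: matrix_vector_mul_assoc[symmetric] mat_vector_mult a mult.commute[of "cnj \<alpha>"])
  then show "invertible (mat \<alpha> :: complex^'n^'n)" unfolding invertible_def by blast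
  show "(*v) (mat \<alpha>) ` D = D"
  proof
    show "(*v) (mat \<alpha>) ` D \<subseteq> D" using assms by (auto simp: mat_vector_mult circular_def)
    show "D \<subseteq> (*v) (mat \<alpha>) ` D"
    proof
      fix z assume "z \<in> D"
      then have "cnj \<alpha> *s z \<in> D" using assms by (simp add: circular_def)
      moreover have "z = mat \<alpha> *v (cnj \<alpha> *s z)" by (simp add: mat_vector_mult a)
      ultimately show "z \<in> (*v) (mat \<alpha>) ` D" by blast
    qed
  qed
qed

section \<open>Holomorphic functions of several variables\<close>

lemma holo_on_continuous: "holo_on D f \<Longrightarrow> continuous_on D f"
  unfolding holo_on_def
  by (meson continuous_at_imp_continuous_on has_derivative_continuous)

lemma holo_on_compose_linear:
  assumes f: "holo_on D f" and L: "bounded_linear L" "\<And>c v. L (c *s v) = c *s L v" "L ` S \<subseteq> D"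
  shows "holo_on S (\<lambda>z. f (L z))"
  unfolding holo_on_def
proof
  fix z assume "z \<in> S"
  then obtain f' where f': "(f has_derivative f') (at (L z))" "\<And>c v. f' (c *s v) = c * f' v"
    using f L(3) unfolding holo_on_def by blast
  have "(L has_derivative L) (at z)" by (rule bounded_linear_imp_has_derivative[OF L(1)])
  from has_derivative_compose[OF this f'(1)] show
    "\<exists>f'. ((\<lambda>z. f (L z)) has_derivative f') (at z) \<and> (\<forall>c v. f' (c *s v) = c * f' v)"
    by (intro exI[of _ "\<lambda>v. f' (L v)"]) (simp add: L f')
qed

lemma holo_on_slice:
  assumes f: "holo_on D f" and sub: "\<And>w. w \<in> S \<Longrightarrow> w *s \<zeta> \<in> D" and S: "open S"
  shows "(\<lambda>w. f (w *s \<zeta>)) holomorphic_on S"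
  unfolding holomorphic_on_open[OF S]
proof
  fix w assume "w \<in> S"
  then obtain f' where f': "(f has_derivative f') (at (w *s \<zeta>))" "\<And>c v. f' (c *s v) = c * f' v"
    using f sub unfolding holo_on_def by blast
  have "((\<lambda>w. w *s \<zeta>) has_derivative (\<lambda>w. w *s \<zeta>)) (at w)"
    by (rule bounded_linear_imp_has_derivative[OF bounded_linear_smult_left])
  from has_derivative_compose[OF this f'(1)]
  show "\<exists>d. ((\<lambda>w. f (w *s \<zeta>)) has_field_derivative d) (at w)"
    by (intro exI[of _ "f' \<zeta>"]) (simp add: has_field_derivative_def f' mult_commute_abs)
qed

lemma holo_on_mult:
  assumes "holo_on D f" "holo_on D g" shows "holo_on D (\<lambda>z. f z * g z)"
  unfolding holo_on_def
proof
  fix z assume z: "z \<in> D"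
  obtain f' where f': "(f has_derivative f') (at z)" "\<And>c v. f' (c *s v) = c * f' v"
    using assms(1) z unfolding holo_on_def by blast
  obtain g' where g': "(g has_derivative g') (at z)" "\<And>c v. g' (c *s v) = c * g' v"
    using assms(2) z unfolding holo_on_def by blast
  show "\<exists>h. ((\<lambda>z. f z * g z) has_derivative h) (at z) \<and> (\<forall>c v. h (c *s v) = c * h v)"
    using has_derivative_mult[OF f'(1) g'(1)]
    by (intro exI[of _ "\<lambda>v. f z * g' v + f' v * g z"]) (simp add: f' g' algebra_simps)
qed

lemma holo_on_add_mult:
  assumes "holo_on D f" "holo_on D g" shows "holo_on D (\<lambda>z. f z + c * g z)"
  unfolding holo_on_def
proof
  fix z assume z: "z \<in> D"
  obtain f' where f': "(f has_derivative f') (at z)" "\<And>c v. f' (c *s v) = c * f' v"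
    using assms(1) z unfolding holo_on_def by blast
  obtain g' where g': "(g has_derivative g') (at z)" "\<And>c v. g' (c *s v) = c * g' v"
    using assms(2) z unfolding holo_on_def by blast
  show "\<exists>h. ((\<lambda>z. f z + c * g z) has_derivative h) (at z) \<and> (\<forall>c v. h (c *s v) = c * h v)"
    using has_derivative_add[OF f'(1) has_derivative_mult_right[OF g'(1), of c]]
    by (intro exI[of _ "\<lambda>v. f' v + c * g' v"]) (simp add: f' g' algebra_simps)
qed

lemma holo_on_const: "holo_on D (\<lambda>_. c)"
  unfolding holo_on_def by (auto intro!: exI[of _ "\<lambda>_. 0"])

lemma bounded_linear_hermitian_inner: "bounded_linear (\<lambda>x. hermitian_inner x y)"
  unfolding hermitian_inner_def
  by (rule bounded_linear_sum) (rule bounded_linear_compose[OF bounded_linear_mult_left bounded_linear_vec_nth])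

lemma holo_on_hermitian_inner: "holo_on D (\<lambda>x. hermitian_inner x y)"
  unfolding holo_on_def
proof
  fix z
  show "\<exists>f'. ((\<lambda>x. hermitian_inner x y) has_derivative f') (at z) \<and> (\<forall>c v. f' (c *s v) = c * f' v)"
    using bounded_linear_imp_has_derivative[OF bounded_linear_hermitian_inner, of y "at z"]
    by (intro exI[of _ "\<lambda>x. hermitian_inner x y"]) (simp add: hermitian_inner_def sum_distrib_left mult_ac)
qed

section \<open>Borel sets of subspaces, and the Silov boundary\<close>

lemma sets_borel_of_subspace:
  assumes "closed B"
  shows "sets (borel_of (top_of_set B)) = sets (restrict_space borel B)"
proof -
  have o: "{U. openin (top_of_set B) U} = (\<inter>) B ` {S. open S}"
    by (auto simp: openin_open)
  have "sets (borel_of (top_of_set B)) = sigma_sets B {U. openin (top_of_set B) U}"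
    unfolding borel_of_def by (subst sets_measure_of) (auto dest: openin_imp_subset)
  also have "\<dots> = (\<inter>) B ` sigma_sets UNIV {S. open S}"
    unfolding o using assms by (intro sigma_sets_Int[symmetric]) (auto simp: borel_def[symmetric] sets_borel[symmetric] intro: borel_closed)
  also have "\<dots> = sets (restrict_space borel B)"
    by (simp add: sets_restrict_space sets_borel)
  finally show ?thesis .
qed

lemma radon_measure_finite_measure_on:
  fixes B :: "'a::t2_space set"
  assumes "radon_measure (top_of_set B) m" "compact B"
  shows "finite_measure_on B m"
proof -
  have "sets m = sets (restrict_space borel B)"
    using assms(1) sets_borel_of_subspace[OF compact_imp_closed[OF assms(2)]] by (simp add: radon_measure_def)
  moreover have "compactin (top_of_set B) B" using assms(2) by (simp add: compactin_subtopology)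
  then have "space m = B" "emeasure m B < \<infinity>"
    using assms(1) unfolding radon_measure_def by auto
  ultimately show ?thesis using assms(2) by (auto simp: finite_measure_on_def intro!: finite_measureI)
qed

text \<open>A linear automorphism carries boundary sets to boundary sets, so that the smallest one is
  contained in its image. Apply this to the inverse as well.\<close>

lemma silov_boundary_automorphism:
  assumes B: "silov_boundary D B" and A: "A \<in> linear_automorphisms D" and x: "\<zeta> \<in> B"
  shows "A *v \<zeta> \<in> B"
proof -
  have sub: "B \<subseteq> (\<lambda>z. A *v z) ` B" if A: "A \<in> linear_automorphisms D" for A
  proof -
    obtain A' where A': "\<And>z. A' *v (A *v z) = z" "\<And>z. A *v (A' *v z) = z"
      using linear_automorphism_inverse[OF A] by blast
    have inj: "inj (\<lambda>z. A *v z)" by (metis A'(1) injI)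
    have lin: "linear (\<lambda>z. A *v z)" using bounded_linear_matrix by (rule bounded_linear.linear)
    have D: "(\<lambda>z. A *v z) ` D = D" using A by (simp add: linear_automorphisms_def)
    have cl: "(\<lambda>z. A *v z) ` closure D = closure D"
      using closure_injective_linear_image[OF lin inj, of D] unfolding D .
    have int: "(\<lambda>z. A *v z) ` interior D = interior D"
      using interior_injective_linear_image[OF lin inj, of D] unfolding D by (rule sym)
    have fr: "(\<lambda>z. A *v z) ` frontier D = frontier D"
      unfolding frontier_def by (simp add: image_set_diff[OF inj] cl int)
    have bB: "boundary_set D B" using B by (simp add: silov_boundary_def)
    have "boundary_set D ((\<lambda>z. A *v z) ` B)"
      unfolding boundary_set_def
    proof (intro conjI allI impI)
      show "closed ((\<lambda>z. A *v z) ` B)"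
        using bB lin inj by (auto simp: boundary_set_def intro: closed_injective_linear_image)
      show "(\<lambda>z. A *v z) ` B \<subseteq> frontier D"
        using bB fr unfolding boundary_set_def by blast
      fix f assume f: "holo_on D f \<and> continuous_on (closure D) f"
      have "holo_on D (\<lambda>z. f (A *v z))"
        using f D by (intro holo_on_compose_linear[OF _ bounded_linear_matrix]) (auto simp: vector_scalar_commute)
      moreover have "continuous_on (closure D) (\<lambda>z. f (A *v z))"
        using f cl by (intro continuous_on_compose2[OF _ continuous_on_matrix, of "closure D"]) auto
      ultimately obtain \<zeta> where z: "\<zeta> \<in> B" "cmod (f (A *v \<zeta>)) = (SUP z\<in>D. cmod (f (A *v z)))"
          "\<forall>\<eta>\<in>B. cmod (f (A *v \<eta>)) \<le> cmod (f (A *v \<zeta>))"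
        using bB unfolding boundary_set_def by blast
      have "(\<lambda>z. cmod (f (A *v z))) ` D = (\<lambda>z. cmod (f z)) ` (\<lambda>z. A *v z) ` D" by (simp add: image_image)
      with z D show "\<exists>\<zeta>\<in>(\<lambda>z. A *v z) ` B. cmod (f \<zeta>) = (SUP z\<in>D. cmod (f z)) \<and>
          (\<forall>\<eta>\<in>(\<lambda>z. A *v z) ` B. cmod (f \<eta>) \<le> cmod (f \<zeta>))" by auto
    qed
    then show ?thesis using B by (simp add: silov_boundary_def)
  qed
  obtain A' where A': "A' \<in> linear_automorphisms D" "\<And>z. A *v (A' *v z) = z"
    using linear_automorphism_inverse[OF A] by blast
  obtain \<eta> where "\<eta> \<in> B" "\<zeta> = A' *v \<eta>" using sub[OF A'(1)] x by blast
  then show ?thesis using A' by simp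
qed

section \<open>The Hardy space\<close>

text \<open>A convex sequence which increases once grows at least linearly ever after.\<close>

lemma convex_bounded_above_decreasing:
  fixes \<phi> :: "nat \<Rightarrow> real"
  assumes conv: "\<And>k. 2 * \<phi> (Suc k) \<le> \<phi> k + \<phi> (Suc (Suc k))" and B: "\<And>k. \<phi> k \<le> B"
  shows "\<phi> 1 \<le> \<phi> 0"
proof (rule ccontr)
  define e where "e = \<phi> 1 - \<phi> 0"
  assume "\<not> \<phi> 1 \<le> \<phi> 0"
  then have e: "e > 0" by (simp add: e_def)
  \<comment> \<open>Increments of a convex sequence increase.\<close>
  have step: "e \<le> \<phi> (Suc k) - \<phi> k" for k
  proof (induction k)
    case (Suc k) then show ?case using conv[of k] by simp
  qed (simp add: e_def)
  have grow: "\<phi> 0 + real k * e \<le> \<phi> k" for k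
  proof (induction k)
    case (Suc k) then show ?case using step[of k] by (simp add: algebra_simps)
  qed simp
  obtain k where "B - \<phi> 0 < real k * e" using reals_Archimedean3[OF e] by blast
  then show False using grow[of k] B[of k] by simp
qed

lemma SUP_limit_radius:
  fixes g :: "real \<Rightarrow> real"
  assumes mono: "\<And>x y. 0 \<le> x \<Longrightarrow> x \<le> y \<Longrightarrow> y < 1 \<Longrightarrow> g x \<le> g y" and bdd: "bdd_above (g ` {0..<1})"
  shows "(\<lambda>n. g (radius n)) \<longlonglongrightarrow> (SUP x\<in>{0..<1}. g x)"
proof (rule order_tendstoI)
  have le: "g (radius n) \<le> (SUP x\<in>{0..<1}. g x)" for n
    using radius[of n] by (intro cSUP_upper bdd) auto
  fix a
  { assume "a > (SUP x\<in>{0..<1}. g x)"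
    then show "\<forall>\<^sub>F n in sequentially. g (radius n) < a"
      by (intro always_eventually allI order_le_less_trans[OF le]) }
  assume "a < (SUP x\<in>{0..<1}. g x)"
  then obtain x where x: "0 \<le> x" "x < 1" "a < g x"
    using less_cSUP_iff[of "{0..<1::real}" g a] bdd by auto
  have "\<forall>\<^sub>F n in sequentially. x < radius n"
    using order_tendstoD(1)[OF radius_tendsto x(2)] .
  then show "\<forall>\<^sub>F n in sequentially. a < g (radius n)"
  proof eventually_elim
    case (elim n)
    then show ?case using mono[OF x(1) _ radius(2), of n] x(3) by simp
  qed
qed

lemma polarization:
  fixes x y :: complex
  shows "(\<Sum>k<4. \<i> ^ k * of_real ((cmod (x + \<i> ^ k * y))\<^sup>2)) / 4 = x * cnj y"
proof -
  have k: "\<i> ^ 2 = -1" "\<i> ^ 3 = - \<i>" by (auto simp: power3_eq_cube)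
  have "{..<4} = {0, 1, 2, 3::nat}" by auto
  then have "(\<Sum>k<4. \<i> ^ k * of_real ((cmod (x + \<i> ^ k * y))\<^sup>2))
      = of_real ((cmod (x + y))\<^sup>2) + \<i> * of_real ((cmod (x + \<i> * y))\<^sup>2)
        - of_real ((cmod (x - y))\<^sup>2) - \<i> * of_real ((cmod (x - \<i> * y))\<^sup>2)"
    by (simp add: k)
  also have "\<dots> = 4 * (x * cnj y)"
    unfolding complex_norm_square by (simp add: algebra_simps)
  finally show ?thesis by simp
qed

locale hardy_setting =
  fixes D bD :: "(complex ^ 'n) set" and \<beta> :: "(complex ^ 'n) measure"
  assumes D_open: "open D" and D_convex: "convex D" and D_circular: "circular D" and D_nonempty: "D \<noteq> {}"
    and silov: "silov_boundary D bD" and bD_sphere: "bD \<subseteq> sphere 0 1"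
    and inv_measure: "K_invariant_probability D bD \<beta>"
begin

lemma bD_closed: "closed bD" and bD_frontier: "bD \<subseteq> frontier D"
  using silov by (auto simp: silov_boundary_def boundary_set_def)

lemma bD_compact: "compact bD"
  using bD_closed bD_sphere bounded_subset[OF bounded_sphere] compact_eq_bounded_closed by blast

lemma finite_beta: "finite_measure_on bD \<beta>"
  using inv_measure bD_compact by (simp add: K_invariant_probability_def radon_measure_finite_measure_on)

lemma prob_beta: "prob_space \<beta>"
  using inv_measure by (simp add: K_invariant_probability_def)

lemma space_beta: "space \<beta> = bD" by (rule finite_measure_on_space[OF finite_beta])

lemma rotate_bD: "\<zeta> \<in> bD \<Longrightarrow> cmod \<alpha> = 1 \<Longrightarrow> \<alpha> *s \<zeta> \<in> bD"
  using silov_boundary_automorphism[OF silov rotation_linear_automorphism[OF D_circular]] by (metis mat_vector_mult)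

lemma zero_in_D: "0 \<in> D"
proof -
  obtain z where z: "z \<in> D" using D_nonempty by blast
  have "(-1) *s z \<in> D" using D_circular z unfolding circular_def by (metis norm_minus_cancel norm_one)
  then have "(1/2) *\<^sub>R z + (1/2) *\<^sub>R ((-1) *s z) \<in> D" using z by (intro convexD[OF D_convex]) auto
  moreover have "(1/2) *\<^sub>R z + (1/2) *\<^sub>R ((-1) *s z) = 0" by (simp add: vec_eq_iff)
  ultimately show ?thesis by simp
qed

lemma dilate_closure_D:
  assumes "z \<in> closure D" "0 \<le> r" "r < 1" shows "r *\<^sub>R z \<in> D"
proof -
  have "z - (1 - r) *\<^sub>R (z - 0) \<in> interior D"
    using assms zero_in_D D_open by (intro mem_interior_closure_convex_shrink[OF D_convex]) (auto simp: interior_open)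
  moreover have "z - (1 - r) *\<^sub>R (z - 0) = r *\<^sub>R z" by (simp add: algebra_simps)
  ultimately show ?thesis using interior_subset by auto
qed

lemma dilate_D: "z \<in> D \<Longrightarrow> 0 \<le> r \<Longrightarrow> r < 1 \<Longrightarrow> r *\<^sub>R z \<in> D"
  using dilate_closure_D closure_subset by blast

lemma dilate_bD: "\<zeta> \<in> bD \<Longrightarrow> 0 \<le> r \<Longrightarrow> r < 1 \<Longrightarrow> r *\<^sub>R \<zeta> \<in> D"
  using dilate_closure_D bD_frontier by (auto simp: frontier_def)

lemma polar:
  assumes "cmod w < 1"
  obtains r \<alpha> where "0 \<le> r" "r < 1" "cmod \<alpha> = 1" "\<And>\<zeta>::complex^'n. w *s \<zeta> = r *\<^sub>R (\<alpha> *s \<zeta>)" "w = of_real r * \<alpha>"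
proof -
  define \<alpha> where "\<alpha> = (if w = 0 then 1 else sgn w)"
  have a: "cmod \<alpha> = 1" by (simp add: \<alpha>_def norm_sgn)
  have w: "w = of_real (cmod w) * \<alpha>" by (simp add: \<alpha>_def sgn_eq)
  have "w *s \<zeta> = cmod w *\<^sub>R (\<alpha> *s \<zeta>)" for \<zeta>::"complex^'n"
    using w by (metis of_real_smult vector_smult_assoc)
  then show ?thesis using that[of "cmod w" \<alpha>] assms a w by simp
qed

lemma disc_in_D: "\<zeta> \<in> bD \<Longrightarrow> cmod w < 1 \<Longrightarrow> w *s \<zeta> \<in> D"
  by (metis polar rotate_bD dilate_bD)

lemma aut_bD: "A \<in> linear_automorphisms D \<Longrightarrow> \<zeta> \<in> bD \<Longrightarrow> A *v \<zeta> \<in> bD"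
  by (rule silov_boundary_automorphism[OF silov])

lemma integral_automorphism:
  fixes \<phi> :: "complex^'n \<Rightarrow> 'b::{banach, second_countable_topology}"
  assumes A: "A \<in> linear_automorphisms D" and \<phi>: "continuous_on bD \<phi>"
  shows "(\<integral>\<zeta>. \<phi> (A *v \<zeta>) \<partial>\<beta>) = (\<integral>\<zeta>. \<phi> \<zeta> \<partial>\<beta>)"
proof -
  have s: "sets \<beta> = sets (restrict_space borel bD)" using finite_beta by (simp add: finite_measure_on_def)
  have "(\<lambda>\<zeta>. A *v \<zeta>) \<in> \<beta> \<rightarrow>\<^sub>M restrict_space borel bD"
    by (rule measurable_restrict_space2)
       (use aut_bD[OF A] in \<open>auto simp: space_beta intro!: borel_measurable_continuous[OF finite_beta] continuous_on_matrix\<close>)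
  then have m: "(\<lambda>\<zeta>. A *v \<zeta>) \<in> \<beta> \<rightarrow>\<^sub>M \<beta>" using s by (simp cong: measurable_cong_sets)
  have "(\<integral>\<zeta>. \<phi> \<zeta> \<partial>\<beta>) = (\<integral>\<zeta>. \<phi> \<zeta> \<partial>distr \<beta> \<beta> (\<lambda>\<zeta>. A *v \<zeta>))"
    using inv_measure A by (simp add: K_invariant_probability_def)
  also have "\<dots> = (\<integral>\<zeta>. \<phi> (A *v \<zeta>) \<partial>\<beta>)"
    by (rule integral_distr[OF m borel_measurable_continuous[OF finite_beta \<phi>]])
  finally show ?thesis by simp
qed

lemma integral_rotate:
  fixes \<phi> :: "complex^'n \<Rightarrow> 'b::{banach, second_countable_topology}"
  assumes "cmod \<alpha> = 1" and \<phi>: "continuous_on bD \<phi>"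
  shows "(\<integral>\<zeta>. \<phi> (\<alpha> *s \<zeta>) \<partial>\<beta>) = (\<integral>\<zeta>. \<phi> \<zeta> \<partial>\<beta>)"
  using integral_automorphism[OF rotation_linear_automorphism[OF D_circular assms(1)] \<phi>]
  by (simp add: mat_vector_mult)

lemma continuous_dilation:
  assumes "continuous_on D f" "0 \<le> r" "r < 1" shows "continuous_on bD (\<lambda>\<zeta>. f (r *\<^sub>R \<zeta>))"
  by (rule continuous_on_compose2[OF assms(1)]) (use assms dilate_bD in \<open>auto intro!: continuous_intros\<close>)

text \<open>The scalar product of the Hardy space is the limit of this form as both radii tend to 1; with two
  independent radii, dilations of the arguments can be compared.\<close>

definition pairing :: "(complex^'n \<Rightarrow> complex) \<Rightarrow> (complex^'n \<Rightarrow> complex) \<Rightarrow> real \<Rightarrow> real \<Rightarrow> complex" where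
  "pairing f g a b = (\<integral>\<zeta>. f (a *\<^sub>R \<zeta>) * cnj (g (b *\<^sub>R \<zeta>)) \<partial>\<beta>)"

lemma pairing_cnj: "pairing g f b a = cnj (pairing f g a b)"
  unfolding pairing_def by (subst Bochner_Integration.integral_cnj[symmetric]) (simp add: mult.commute)

lemma Cauchy_szego_dilation:
  assumes f: "holo_on D f" and \<zeta>: "\<zeta> \<in> bD" and a: "0 \<le> a" "a < 1" and s: "0 \<le> s" "s < 1"
  shows "(\<integral>\<kappa>. f (a *\<^sub>R (\<kappa> *s \<zeta>)) / (1 - of_real s * cnj \<kappa>) \<partial>arc_measure) = f ((s * a) *\<^sub>R \<zeta>)"
proof -
  have eq: "a *\<^sub>R (\<kappa> *s \<zeta>) = \<kappa> *s (a *\<^sub>R \<zeta>)" for \<kappa>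
    by (simp add: vec_eq_iff)
  have sub: "\<kappa> *s (a *\<^sub>R \<zeta>) \<in> D" if "cmod \<kappa> \<le> 1" for \<kappa>
  proof -
    have "\<kappa> *s (a *\<^sub>R \<zeta>) = (of_real a * \<kappa>) *s \<zeta>" by (simp add: vec_eq_iff scaleR_conv_of_real[where 'a = complex])
    then show ?thesis using disc_in_D[OF \<zeta> dilation_in_disc[OF a that]] by simp
  qed
  have "(\<integral>\<kappa>. f (\<kappa> *s (a *\<^sub>R \<zeta>)) / (1 - of_real s * cnj \<kappa>) \<partial>arc_measure) = f (of_real s *s (a *\<^sub>R \<zeta>))"
  proof (rule Cauchy_szego)
    show "continuous_on (cball 0 1) (\<lambda>\<kappa>. f (\<kappa> *s (a *\<^sub>R \<zeta>)))"
      by (rule continuous_on_compose2[OF holo_on_continuous[OF f]]) (use sub in \<open>auto intro!: continuous_intros\<close>)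
    show "(\<lambda>\<kappa>. f (\<kappa> *s (a *\<^sub>R \<zeta>))) holomorphic_on ball 0 1"
      by (rule holo_on_slice[OF f]) (use sub in auto)
  qed (use s in simp)
  then show ?thesis by (simp add: eq of_real_smult)
qed

text \<open>Cauchy's formula on the disc through \<open>\<zeta>\<close> writes the dilation of
  \<open>f\<close> by \<open>s\<close> as an average of its rotations. The invariance of
  \<open>\<beta>\<close> transfers the rotations to \<open>g\<close>, where the same formula, read backwards,
  yields the dilation of \<open>g\<close> by \<open>s\<close>. In terms of homogeneous expansions, components
  of different degrees are orthogonal.\<close>

lemma pairing_shift:
  assumes f: "holo_on D f" and g: "holo_on D g"
    and a: "0 \<le> a" "a < 1" and b: "0 \<le> b" "b < 1" and s: "0 \<le> s" "s < 1"
  shows "pairing f g (s * a) b = pairing f g a (s * b)"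
proof -
  let ?k = "\<lambda>\<kappa>. 1 - of_real s * cnj \<kappa> :: complex"
  have k0: "?k \<kappa> \<noteq> 0" if "cmod \<kappa> = 1" for \<kappa> using szego_denominator[of "of_real s" \<kappa>] s that by simp
  have cf: "continuous_on bD (\<lambda>\<zeta>. f (a *\<^sub>R \<zeta>))" "continuous_on bD (\<lambda>\<zeta>. g (b *\<^sub>R \<zeta>))"
    by (rule continuous_dilation[OF holo_on_continuous[OF f] a] continuous_dilation[OF holo_on_continuous[OF g] b])+
  have ck: "continuous_on (bD \<times> sphere 0 1) (\<lambda>p. ?k (snd p))" "continuous_on (sphere 0 1 \<times> bD) (\<lambda>p. ?k (fst p))"
    by (intro continuous_intros)+
  have rot: "\<kappa> *s \<zeta> \<in> bD" "cnj \<kappa> *s \<zeta> \<in> bD" if "\<zeta> \<in> bD" "cmod \<kappa> = 1" for \<kappa> \<zeta>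
    using rotate_bD that by auto
  have c1: "continuous_on (bD \<times> sphere 0 1) (\<lambda>p. f (a *\<^sub>R (snd p *s fst p)) / ?k (snd p) * cnj (g (b *\<^sub>R fst p)))"
    by (intro continuous_intros ck continuous_on_compose2[OF cf(1)] continuous_on_compose2[OF cf(2)])
       (use rot k0 in auto)
  have c2: "continuous_on (bD \<times> sphere 0 1) (\<lambda>p. f (a *\<^sub>R fst p) / ?k (snd p) * cnj (g (b *\<^sub>R (cnj (snd p) *s fst p))))"
    by (intro continuous_intros ck continuous_on_compose2[OF cf(1)] continuous_on_compose2[OF cf(2)])
       (use rot k0 in auto)
  have "pairing f g (s * a) b = (\<integral>\<zeta>. (\<integral>\<kappa>. f (a *\<^sub>R (\<kappa> *s \<zeta>)) / ?k \<kappa> * cnj (g (b *\<^sub>R \<zeta>)) \<partial>arc_measure) \<partial>\<beta>)"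
    unfolding pairing_def
    by (rule Bochner_Integration.integral_cong)
       (auto simp: space_beta Cauchy_szego_dilation[OF f _ a s] simp del: times_divide_eq_left)
  also have "\<dots> = (\<integral>\<kappa>. (\<integral>\<zeta>. f (a *\<^sub>R (\<kappa> *s \<zeta>)) / ?k \<kappa> * cnj (g (b *\<^sub>R \<zeta>)) \<partial>\<beta>) \<partial>arc_measure)"
    by (rule Fubini_continuous[OF finite_beta finite_arc c1])
  also have "\<dots> = (\<integral>\<kappa>. (\<integral>\<zeta>. f (a *\<^sub>R \<zeta>) / ?k \<kappa> * cnj (g (b *\<^sub>R (cnj \<kappa> *s \<zeta>))) \<partial>\<beta>) \<partial>arc_measure)"
  proof (rule Bochner_Integration.integral_cong)
    fix \<kappa> assume "\<kappa> \<in> space arc_measure"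
    then have \<kappa>: "cmod \<kappa> = 1" by (simp add: finite_measure_on_space[OF finite_arc])
    have c: "continuous_on bD (\<lambda>\<zeta>. f (a *\<^sub>R (\<kappa> *s \<zeta>)) / ?k \<kappa> * cnj (g (b *\<^sub>R \<zeta>)))"
      by (intro continuous_intros cf(2) continuous_on_compose2[OF cf(1)]) (use rot \<kappa> k0 in auto)
    have "\<kappa> *s (cnj \<kappa> *s \<zeta>) = \<zeta>" for \<zeta> :: "complex^'n"
      by (simp add: mult_cnj_sphere[OF \<kappa>])
    then show "(\<integral>\<zeta>. f (a *\<^sub>R (\<kappa> *s \<zeta>)) / ?k \<kappa> * cnj (g (b *\<^sub>R \<zeta>)) \<partial>\<beta>)
        = (\<integral>\<zeta>. f (a *\<^sub>R \<zeta>) / ?k \<kappa> * cnj (g (b *\<^sub>R (cnj \<kappa> *s \<zeta>))) \<partial>\<beta>)"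
      using integral_rotate[OF _ c, of "cnj \<kappa>"] \<kappa> by (simp only: complex_mod_cnj)
  qed simp
  also have "\<dots> = (\<integral>\<zeta>. (\<integral>\<kappa>. f (a *\<^sub>R \<zeta>) / ?k \<kappa> * cnj (g (b *\<^sub>R (cnj \<kappa> *s \<zeta>))) \<partial>arc_measure) \<partial>\<beta>)"
    by (rule Fubini_continuous[OF finite_beta finite_arc c2, symmetric])
  also have "\<dots> = pairing f g a (s * b)"
    unfolding pairing_def
  proof (rule Bochner_Integration.integral_cong)
    fix \<zeta> assume "\<zeta> \<in> space \<beta>"
    then have \<zeta>: "\<zeta> \<in> bD" by (simp add: space_beta)
    have c: "continuous_on (sphere 0 1) (\<lambda>\<kappa>. g (b *\<^sub>R (\<kappa> *s \<zeta>)) / ?k \<kappa>)"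
      by (intro continuous_intros continuous_on_compose2[OF cf(2)]) (use rot \<zeta> k0 in auto)
    have "(\<integral>\<kappa>. f (a *\<^sub>R \<zeta>) / ?k \<kappa> * cnj (g (b *\<^sub>R (cnj \<kappa> *s \<zeta>))) \<partial>arc_measure)
        = (\<integral>\<kappa>. f (a *\<^sub>R \<zeta>) * cnj (g (b *\<^sub>R (cnj \<kappa> *s \<zeta>)) / ?k (cnj \<kappa>)) \<partial>arc_measure)"
      by simp
    also have "\<dots> = f (a *\<^sub>R \<zeta>) * cnj (\<integral>\<kappa>. g (b *\<^sub>R (cnj \<kappa> *s \<zeta>)) / ?k (cnj \<kappa>) \<partial>arc_measure)"
      by (simp only: Bochner_Integration.integral_cnj integral_mult_right_zero)
    also have "(\<integral>\<kappa>. g (b *\<^sub>R (cnj \<kappa> *s \<zeta>)) / ?k (cnj \<kappa>) \<partial>arc_measure) = (\<integral>\<kappa>. g (b *\<^sub>R (\<kappa> *s \<zeta>)) / ?k \<kappa> \<partial>arc_measure)"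
      by (rule integral_arc_cnj[OF c])
    also have "\<dots> = g ((s * b) *\<^sub>R \<zeta>)" by (rule Cauchy_szego_dilation[OF g \<zeta> b s])
    finally show "(\<integral>\<kappa>. f (a *\<^sub>R \<zeta>) / ?k \<kappa> * cnj (g (b *\<^sub>R (cnj \<kappa> *s \<zeta>))) \<partial>arc_measure)
        = f (a *\<^sub>R \<zeta>) * cnj (g ((s * b) *\<^sub>R \<zeta>))" .
  qed simp
  finally show ?thesis .
qed

lemma hardy_mean_pairing: "complex_of_real (hardy_mean \<beta> f \<rho>) = pairing f f \<rho> \<rho>"
  unfolding hardy_mean_def pairing_def
  by (subst integral_complex_of_real[symmetric]) (simp only: complex_norm_square)

lemma bounded_on_dilations:
  assumes f: "continuous_on D f" and r: "0 \<le> r" "r < 1"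
  obtains B where "\<And>\<rho> \<zeta>. 0 \<le> \<rho> \<Longrightarrow> \<rho> \<le> r \<Longrightarrow> \<zeta> \<in> bD \<Longrightarrow> norm (f (\<rho> *\<^sub>R \<zeta>)) \<le> B"
proof -
  let ?g = "\<lambda>p. f (fst p *\<^sub>R snd p)"
  have "continuous_on ({0..r} \<times> bD) ?g"
    by (rule continuous_on_compose2[OF f]) (use r dilate_bD in \<open>auto intro!: continuous_intros\<close>)
  then obtain B where "0 \<le> B" "\<And>p. p \<in> {0..r} \<times> bD \<Longrightarrow> norm (?g p) \<le> B"
    by (rule continuous_on_compact_bound[OF compact_Times[OF compact_Icc bD_compact]]) (rule that, auto)
  then show ?thesis using that[of B] by force
qed

lemma hardy_mean_le:
  assumes f: "continuous_on D f" and \<rho>: "0 \<le> \<rho>" "\<rho> < 1" and B: "\<And>\<zeta>. \<zeta> \<in> bD \<Longrightarrow> cmod (f (\<rho> *\<^sub>R \<zeta>)) \<le> B"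
  shows "hardy_mean \<beta> f \<rho> \<le> B\<^sup>2"
proof -
  interpret prob_space \<beta> by (rule prob_beta)
  have "hardy_mean \<beta> f \<rho> \<le> (\<integral>\<zeta>. B\<^sup>2 \<partial>\<beta>)"
    unfolding hardy_mean_def
    by (rule Bochner_Integration.integral_mono)
       (use B in \<open>auto simp: space_beta intro!: integrable_continuous[OF finite_beta] continuous_intros continuous_dilation f \<rho> power_mono\<close>)
  also have "\<dots> = B\<^sup>2" by (simp add: prob_space)
  finally show ?thesis .
qed

text \<open>By \<open>pairing_shift\<close>, the right-hand side minus the left-hand side is the mean square
  of the difference of two dilations of \<open>f\<close>.\<close>

lemma hardy_mean_convex:
  assumes f: "holo_on D f" and a: "0 \<le> a" "a < 1" and s: "0 \<le> s" "s < 1"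
  shows "2 * hardy_mean \<beta> f (s * a) \<le> hardy_mean \<beta> f a + hardy_mean \<beta> f (s * (s * a))"
proof -
  have sa: "0 \<le> s * a" "s * a < 1" "0 \<le> s * (s * a)" "s * (s * a) < 1"
  proof -
    have 1: "0 \<le> s * x \<and> s * x < 1" if "0 \<le> x" "x < 1" for x
      using that s mult_right_mono[of s 1 x] by auto
    then show "0 \<le> s * a" "s * a < 1" "0 \<le> s * (s * a)" "s * (s * a) < 1" using a by blast+
  qed
  let ?f = "\<lambda>r \<zeta>. f (r *\<^sub>R \<zeta>)"
  note c = continuous_dilation[OF holo_on_continuous[OF f]]
  note I = integrable_continuous[OF finite_beta]
  have "pairing f f (s * a) (s * a) = pairing f f a (s * (s * a))"
    by (rule pairing_shift[OF f f a sa(1,2) s])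
  then have sh: "hardy_mean \<beta> f (s * a) = Re (pairing f f a (s * (s * a)))"
    by (metis hardy_mean_pairing Re_complex_of_real)
  have "0 \<le> (\<integral>\<zeta>. (cmod (?f a \<zeta> - ?f (s * (s * a)) \<zeta>))\<^sup>2 \<partial>\<beta>)"
    by (rule Bochner_Integration.integral_nonneg) simp
  also have "\<dots> = (\<integral>\<zeta>. (cmod (?f a \<zeta>))\<^sup>2 + (cmod (?f (s * (s * a)) \<zeta>))\<^sup>2 - 2 * Re (?f a \<zeta> * cnj (?f (s * (s * a)) \<zeta>)) \<partial>\<beta>)"
  proof (rule Bochner_Integration.integral_cong)
    have "(cmod (x - y))\<^sup>2 = (cmod x)\<^sup>2 + (cmod y)\<^sup>2 - 2 * Re (x * cnj y)" for x y
      by (simp add: cmod_power2) (simp add: power2_eq_square algebra_simps)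
    then show "(cmod (?f a \<zeta> - ?f (s * (s * a)) \<zeta>))\<^sup>2 = (cmod (?f a \<zeta>))\<^sup>2 + (cmod (?f (s * (s * a)) \<zeta>))\<^sup>2
        - 2 * Re (?f a \<zeta> * cnj (?f (s * (s * a)) \<zeta>))" for \<zeta> .
  qed simp
  also have "\<dots> = hardy_mean \<beta> f a + hardy_mean \<beta> f (s * (s * a)) - 2 * (\<integral>\<zeta>. Re (?f a \<zeta> * cnj (?f (s * (s * a)) \<zeta>)) \<partial>\<beta>)"
    unfolding hardy_mean_def
    by (subst Bochner_Integration.integral_diff Bochner_Integration.integral_add;
        (intro I continuous_intros c a sa)?)+ (simp only: integral_mult_right_zero)
  also have "(\<integral>\<zeta>. Re (?f a \<zeta> * cnj (?f (s * (s * a)) \<zeta>)) \<partial>\<beta>) = Re (pairing f f a (s * (s * a)))"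
    unfolding pairing_def by (rule integral_Re) (intro I continuous_intros c a sa)
  finally show ?thesis using sh by simp
qed

text \<open>The means at the radii \<open>s\<^sup>k r\<close> form a convex sequence, which is bounded because
  \<open>f\<close> is bounded on the dilations of the boundary by factors at most \<open>r\<close>.\<close>

lemma hardy_mean_mono:
  assumes f: "holo_on D f" and \<rho>: "0 \<le> \<rho>" "\<rho> \<le> r" "r < 1"
  shows "hardy_mean \<beta> f \<rho> \<le> hardy_mean \<beta> f r"
proof (cases "\<rho> = r")
  case False
  define s where "s = \<rho> / r"
  have r: "0 < r" and s: "0 \<le> s" "s < 1" and sr: "s * r = \<rho>" using False \<rho> by (auto simp: s_def)
  have sk: "0 \<le> s ^ k * r" "s ^ k * r \<le> r" "s ^ k * r < 1" for k
  proof -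
    have "s ^ k \<le> 1" using s by (simp add: power_le_one)
    then show "0 \<le> s ^ k * r" "s ^ k * r \<le> r"
      using s r mult_right_mono[of "s ^ k" 1 r] by auto
    then show "s ^ k * r < 1" using \<rho> by linarith
  qed
  obtain B where B: "\<And>\<rho> \<zeta>. 0 \<le> \<rho> \<Longrightarrow> \<rho> \<le> r \<Longrightarrow> \<zeta> \<in> bD \<Longrightarrow> norm (f (\<rho> *\<^sub>R \<zeta>)) \<le> B"
    using bounded_on_dilations[OF holo_on_continuous[OF f], of r] r \<rho> by auto
  have "hardy_mean \<beta> f (s ^ 1 * r) \<le> hardy_mean \<beta> f (s ^ 0 * r)"
  proof (rule convex_bounded_above_decreasing[of "\<lambda>k. hardy_mean \<beta> f (s ^ k * r)"])
    show "2 * hardy_mean \<beta> f (s ^ Suc k * r) \<le> hardy_mean \<beta> f (s ^ k * r) + hardy_mean \<beta> f (s ^ Suc (Suc k) * r)" for k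
      using hardy_mean_convex[OF f sk(1) sk(3) s, of k] by (simp add: mult.assoc)
    show "hardy_mean \<beta> f (s ^ k * r) \<le> B\<^sup>2" for k
      by (rule hardy_mean_le[OF holo_on_continuous[OF f] sk(1) sk(3)]) (rule B[OF sk(1) sk(2)])
  qed
  then show ?thesis using sr by simp
qed simp

abbreviation "H2 \<equiv> hardy_space D \<beta>"

lemma H2_holo: "f \<in> H2 \<Longrightarrow> holo_on D f" by (simp add: hardy_space_def)

lemma hardy_norm_limit:
  assumes "f \<in> H2"
  shows "(\<lambda>n. hardy_mean \<beta> f (radius n)) \<longlonglongrightarrow> (hardy_norm \<beta> f)\<^sup>2"
proof -
  have bdd: "bdd_above (hardy_mean \<beta> f ` {0..<1})" using assms by (simp add: hardy_space_def)
  have "0 \<le> hardy_mean \<beta> f 0" unfolding hardy_mean_def by (rule Bochner_Integration.integral_nonneg) simp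
  also have "\<dots> \<le> (SUP \<rho>\<in>{0..<1}. hardy_mean \<beta> f \<rho>)" by (rule cSUP_upper[OF _ bdd]) simp
  finally have "(hardy_norm \<beta> f)\<^sup>2 = (SUP \<rho>\<in>{0..<1}. hardy_mean \<beta> f \<rho>)"
    by (simp add: hardy_norm_def)
  then show ?thesis using SUP_limit_radius[OF _ bdd] hardy_mean_mono[OF H2_holo[OF assms]] by simp
qed

lemma H2_add_mult:
  assumes f: "f \<in> H2" and g: "g \<in> H2" shows "(\<lambda>z. f z + c * g z) \<in> H2"
proof -
  have bdd: "bdd_above (hardy_mean \<beta> f ` {0..<1})" "bdd_above (hardy_mean \<beta> g ` {0..<1})"
    using f g by (auto simp: hardy_space_def)
  obtain A where A: "\<And>\<rho>. \<rho> \<in> {0..<1} \<Longrightarrow> hardy_mean \<beta> f \<rho> \<le> A"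
    using bdd(1) by (meson bdd_above_def imageI)
  obtain B where B: "\<And>\<rho>. \<rho> \<in> {0..<1} \<Longrightarrow> hardy_mean \<beta> g \<rho> \<le> B"
    using bdd(2) by (meson bdd_above_def imageI)
  have "hardy_mean \<beta> (\<lambda>z. f z + c * g z) \<rho> \<le> 2 * A + 2 * (cmod c)\<^sup>2 * B" if \<rho>: "\<rho> \<in> {0..<1}" for \<rho>
  proof -
    have r: "0 \<le> \<rho>" "\<rho> < 1" using \<rho> by auto
    note cf = continuous_dilation[OF holo_on_continuous[OF H2_holo[OF f]] r] continuous_dilation[OF holo_on_continuous[OF H2_holo[OF g]] r]
    have "hardy_mean \<beta> (\<lambda>z. f z + c * g z) \<rho> \<le> (\<integral>\<zeta>. 2 * (cmod (f (\<rho> *\<^sub>R \<zeta>)))\<^sup>2 + 2 * (cmod c)\<^sup>2 * (cmod (g (\<rho> *\<^sub>R \<zeta>)))\<^sup>2 \<partial>\<beta>)"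
      unfolding hardy_mean_def
    proof (rule Bochner_Integration.integral_mono)
      fix \<zeta>
      let ?x = "f (\<rho> *\<^sub>R \<zeta>)" and ?y = "c * g (\<rho> *\<^sub>R \<zeta>)"
      have "(cmod (?x + ?y))\<^sup>2 \<le> (cmod ?x + cmod ?y)\<^sup>2"
        by (intro power_mono norm_triangle_ineq) simp
      also have "\<dots> \<le> 2 * (cmod ?x)\<^sup>2 + 2 * (cmod ?y)\<^sup>2"
        using sum_squares_ge_zero[of "cmod ?x - cmod ?y" 0] by (simp add: power2_eq_square algebra_simps)
      finally show "(cmod (?x + ?y))\<^sup>2 \<le> 2 * (cmod ?x)\<^sup>2 + 2 * (cmod c)\<^sup>2 * (cmod (g (\<rho> *\<^sub>R \<zeta>)))\<^sup>2"
        by (simp add: norm_mult power_mult_distrib)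
    qed (intro integrable_continuous[OF finite_beta] continuous_intros cf)+
    also have "\<dots> = 2 * hardy_mean \<beta> f \<rho> + 2 * (cmod c)\<^sup>2 * hardy_mean \<beta> g \<rho>"
      unfolding hardy_mean_def
      by (subst Bochner_Integration.integral_add) (auto intro!: integrable_continuous[OF finite_beta] continuous_intros cf)
    also have "\<dots> \<le> 2 * A + 2 * (cmod c)\<^sup>2 * B"
      using A[OF \<rho>] B[OF \<rho>] by (intro add_mono mult_left_mono) auto
    finally show ?thesis .
  qed
  then have "bdd_above (hardy_mean \<beta> (\<lambda>z. f z + c * g z) ` {0..<1})" by (rule bdd_aboveI2)
  then show ?thesis using holo_on_add_mult[OF H2_holo[OF f] H2_holo[OF g]] by (simp add: hardy_space_def)
qed

text \<open>Since means increase with the radius, their suprema are limits, and the limits satisfy the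
  polarization identity.\<close>

lemma hardy_inner_limit:
  assumes f: "f \<in> H2" and g: "g \<in> H2"
  shows "(\<lambda>n. pairing f g (radius n) (radius n)) \<longlonglongrightarrow> hardy_inner \<beta> f g"
proof -
  have "(\<lambda>n. (\<Sum>k<4. \<i> ^ k * of_real (hardy_mean \<beta> (\<lambda>z. f z + \<i> ^ k * g z) (radius n))) / 4) \<longlonglongrightarrow> hardy_inner \<beta> f g"
    unfolding hardy_inner_def
    by (intro tendsto_intros hardy_norm_limit H2_add_mult f g) simp
  moreover have "(\<Sum>k<4. \<i> ^ k * of_real (hardy_mean \<beta> (\<lambda>z. f z + \<i> ^ k * g z) r)) / 4 = pairing f g r r"
    if r: "0 \<le> r" "r < 1" for r
  proof -
    note cf = continuous_dilation[OF holo_on_continuous[OF H2_holo[OF f]] r] continuous_dilation[OF holo_on_continuous[OF H2_holo[OF g]] r]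
    have "(\<Sum>k<4. \<i> ^ k * of_real (hardy_mean \<beta> (\<lambda>z. f z + \<i> ^ k * g z) r)) / 4
      = (\<Sum>k<4. (\<integral>\<zeta>. \<i> ^ k * of_real ((cmod (f (r *\<^sub>R \<zeta>) + \<i> ^ k * g (r *\<^sub>R \<zeta>)))\<^sup>2) \<partial>\<beta>)) / 4"
      by (simp only: hardy_mean_def integral_complex_of_real[symmetric] integral_mult_right_zero)
    also have "\<dots> = (\<integral>\<zeta>. (\<Sum>k<4. \<i> ^ k * of_real ((cmod (f (r *\<^sub>R \<zeta>) + \<i> ^ k * g (r *\<^sub>R \<zeta>)))\<^sup>2)) \<partial>\<beta>) / 4"
      by (subst Bochner_Integration.integral_sum)
         (auto intro!: integrable_continuous[OF finite_beta] continuous_intros cf simp del: of_real_power)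
    also have "\<dots> = pairing f g r r"
      unfolding pairing_def
      by (subst integral_divide_zero[symmetric]) (simp only: polarization)
    finally show ?thesis .
  qed
  ultimately show ?thesis using radius by simp
qed

lemma H2I:
  assumes f: "holo_on D f" and B: "\<And>\<rho> \<zeta>. 0 \<le> \<rho> \<Longrightarrow> \<rho> < 1 \<Longrightarrow> \<zeta> \<in> bD \<Longrightarrow> cmod (f (\<rho> *\<^sub>R \<zeta>)) \<le> B"
  shows "f \<in> H2"
proof -
  have "bdd_above (hardy_mean \<beta> f ` {0..<1})"
    by (rule bdd_aboveI2[of _ _ "B\<^sup>2"], rule hardy_mean_le[OF holo_on_continuous[OF f]]) (use B in auto)
  then show ?thesis using f by (simp add: hardy_space_def)
qed

lemma H2_dilation:
  assumes f: "f \<in> H2" and s: "0 \<le> s" "s < 1" shows "(\<lambda>z. f (s *\<^sub>R z)) \<in> H2"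
proof -
  obtain B where B: "\<And>\<rho> \<zeta>. 0 \<le> \<rho> \<Longrightarrow> \<rho> \<le> s \<Longrightarrow> \<zeta> \<in> bD \<Longrightarrow> norm (f (\<rho> *\<^sub>R \<zeta>)) \<le> B"
    using bounded_on_dilations[OF holo_on_continuous[OF H2_holo[OF f]] s] by blast
  show ?thesis
  proof (rule H2I)
    show "holo_on D (\<lambda>z. f (s *\<^sub>R z))"
      by (rule holo_on_compose_linear[OF H2_holo[OF f] bounded_linear_scaleR_right])
         (use s dilate_D in \<open>auto simp: vec_eq_iff\<close>)
    show "cmod (f (s *\<^sub>R (\<rho> *\<^sub>R \<zeta>))) \<le> B" if "0 \<le> \<rho>" "\<rho> < 1" "\<zeta> \<in> bD" for \<rho> \<zeta>
      using B[of "s * \<rho>" \<zeta>] that s by (simp add: mult_left_le)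
  qed
qed

lemma pairing_automorphism:
  assumes A: "A \<in> linear_automorphisms D" and f: "holo_on D f" "holo_on D g" and r: "0 \<le> r" "r < 1"
  shows "pairing (\<lambda>z. f (A *v z)) (\<lambda>z. g (A *v z)) r r = pairing f g r r"
proof -
  have e: "A *v (r *\<^sub>R z) = r *\<^sub>R (A *v z)" for z
    unfolding of_real_smult[symmetric] by (rule vector_scalar_commute)
  show ?thesis
    unfolding pairing_def e
    by (rule integral_automorphism[OF A]) (intro continuous_intros continuous_dilation holo_on_continuous f r)
qed

lemma holo_automorphism:
  assumes A: "A \<in> linear_automorphisms D" and f: "holo_on D f"
  shows "holo_on D (\<lambda>z. f (A *v z))"
  using A by (intro holo_on_compose_linear[OF f bounded_linear_matrix])
    (auto simp: vector_scalar_commute linear_automorphisms_def)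

lemma H2_automorphism:
  assumes A: "A \<in> linear_automorphisms D" and f: "f \<in> H2"
  shows "(\<lambda>z. f (A *v z)) \<in> H2"
proof -
  have "hardy_mean \<beta> (\<lambda>z. f (A *v z)) ` {0..<1} = hardy_mean \<beta> f ` {0..<1}"
  proof (rule image_cong)
    fix \<rho> :: real assume "\<rho> \<in> {0..<1}"
    then have "complex_of_real (hardy_mean \<beta> (\<lambda>z. f (A *v z)) \<rho>) = of_real (hardy_mean \<beta> f \<rho>)"
      unfolding hardy_mean_pairing using pairing_automorphism[OF A H2_holo[OF f] H2_holo[OF f]] by simp
    then show "hardy_mean \<beta> (\<lambda>z. f (A *v z)) \<rho> = hardy_mean \<beta> f \<rho>" by (simp only: of_real_eq_iff)
  qed simp
  then show ?thesis using f holo_automorphism[OF A H2_holo[OF f]] by (simp add: hardy_space_def)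
qed

end


section \<open>The Szego kernel and the Poisson-Szego kernel\<close>

locale szego_setting = hardy_setting D bD \<beta>
  for D bD :: "(complex ^ 'n) set" and \<beta> :: "(complex ^ 'n) measure" +
  fixes C :: "complex ^ 'n \<Rightarrow> complex ^ 'n \<Rightarrow> complex"
  assumes transitive: "\<And>\<zeta> \<eta>. \<zeta> \<in> bD \<Longrightarrow> \<eta> \<in> bD \<Longrightarrow> \<exists>A\<in>linear_automorphisms D. A *v \<zeta> = \<eta>"
    and unitary: "linear_automorphisms D \<subseteq> unitary_group"
    and kernel: "reproducing_kernel D \<beta> C"
begin

lemma kernel_H2: "w \<in> D \<Longrightarrow> (\<lambda>z. C z w) \<in> H2"
  using kernel by (simp add: reproducing_kernel_def)

lemma kernel_holo: "w \<in> D \<Longrightarrow> holo_on D (\<lambda>z. C z w)"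
  by (rule H2_holo[OF kernel_H2])

lemma kernel_limit:
  assumes "w \<in> D" "f \<in> H2"
  shows "(\<lambda>n. pairing f (\<lambda>z. C z w) (radius n) (radius n)) \<longlonglongrightarrow> f w"
  using hardy_inner_limit[OF assms(2) kernel_H2[OF assms(1)]] kernel assms by (simp add: reproducing_kernel_def)

text \<open>Testing against the kernel itself determines a function of the Hardy space from the functional
  that it represents. All invariance properties of the kernel are obtained in this way.\<close>

lemma kernel_unique:
  assumes g: "g \<in> H2" and z: "z \<in> D"
    and rep: "\<And>f. f \<in> H2 \<Longrightarrow> (\<lambda>n. pairing f g (radius n) (radius n)) \<longlonglongrightarrow> l f"
  shows "g z = cnj (l (\<lambda>x. C x z))"
proof -
  have "(\<lambda>n. cnj (pairing (\<lambda>x. C x z) g (radius n) (radius n))) \<longlonglongrightarrow> cnj (l (\<lambda>x. C x z))"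
    by (intro tendsto_cnj rep kernel_H2 z)
  then have "(\<lambda>n. pairing g (\<lambda>x. C x z) (radius n) (radius n)) \<longlonglongrightarrow> cnj (l (\<lambda>x. C x z))"
    by (simp add: pairing_cnj[of g])
  then show ?thesis using kernel_limit[OF z g] by (rule LIMSEQ_unique[rotated])
qed

lemma kernel_hermitian: "z \<in> D \<Longrightarrow> w \<in> D \<Longrightarrow> C z w = cnj (C w z)"
  using kernel_unique[OF kernel_H2 _ kernel_limit] by blast

text \<open>By \<open>pairing_shift\<close>, dilation by \<open>s\<close> is self-adjoint. Hence the dilation
  of the kernel function with pole \<open>w\<close> represents evaluation at \<open>s w\<close>.\<close>

lemma kernel_dilation:
  assumes z: "z \<in> D" and w: "w \<in> D" and s: "0 \<le> s" "s < 1"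
  shows "C (s *\<^sub>R z) w = C z (s *\<^sub>R w)"
proof -
  have "(\<lambda>n. pairing f (\<lambda>z. C (s *\<^sub>R z) w) (radius n) (radius n)) \<longlonglongrightarrow> f (s *\<^sub>R w)" if f: "f \<in> H2" for f
  proof -
    have "pairing f (\<lambda>z. C (s *\<^sub>R z) w) (radius n) (radius n)
        = pairing (\<lambda>z. f (s *\<^sub>R z)) (\<lambda>z. C z w) (radius n) (radius n)" for n
      using pairing_shift[OF H2_holo[OF f] kernel_holo[OF w] radius[of n] radius[of n] s]
      by (simp add: pairing_def)
    then show ?thesis using kernel_limit[OF w H2_dilation[OF f s]] by simp
  qed
  from kernel_unique[OF H2_dilation[OF kernel_H2[OF w] s] z this]
  show ?thesis using kernel_hermitian[OF z dilate_D[OF w s]] by simp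
qed

lemma kernel_automorphism:
  assumes A: "A \<in> linear_automorphisms D" and z: "z \<in> D" and w: "w \<in> D"
  shows "C (A *v z) (A *v w) = C z w"
proof -
  obtain A' where A': "A' \<in> linear_automorphisms D" "\<And>z. A' *v (A *v z) = z" "\<And>z. A *v (A' *v z) = z"
    using linear_automorphism_inverse[OF A] by auto
  have Aw: "A *v w \<in> D" using A w by (auto simp: linear_automorphisms_def)
  have "(\<lambda>n. pairing f (\<lambda>z. C (A *v z) (A *v w)) (radius n) (radius n)) \<longlonglongrightarrow> f w" if f: "f \<in> H2" for f
  proof -
    have "pairing f (\<lambda>z. C (A *v z) (A *v w)) (radius n) (radius n)
        = pairing (\<lambda>z. f (A' *v z)) (\<lambda>z. C z (A *v w)) (radius n) (radius n)" for n
      using pairing_automorphism[OF A holo_automorphism[OF A'(1) H2_holo[OF f]] kernel_holo[OF Aw] radius[of n]]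
      by (simp add: A')
    then show ?thesis using kernel_limit[OF Aw H2_automorphism[OF A'(1) f]] by (simp add: A')
  qed
  from kernel_unique[OF H2_automorphism[OF A kernel_H2[OF Aw]] z this]
  show ?thesis using kernel_hermitian[OF z w] by simp
qed

text \<open>The value of the extended kernel at the points \<open>r \<zeta>\<close> and \<open>\<eta>\<close>,
  with the dilation shared evenly between the arguments so that both stay inside the domain.\<close>

definition boundary_kernel :: "real \<Rightarrow> complex^'n \<Rightarrow> complex^'n \<Rightarrow> complex" where
  "boundary_kernel r \<zeta> \<eta> = C (sqrt r *\<^sub>R \<zeta>) (sqrt r *\<^sub>R \<eta>)"

lemma sqrt_unit: "0 \<le> r \<Longrightarrow> r < 1 \<Longrightarrow> 0 \<le> sqrt r \<and> sqrt r < 1"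
  by simp

lemma sqrt_dilate: "\<zeta> \<in> bD \<Longrightarrow> 0 \<le> r \<Longrightarrow> r < 1 \<Longrightarrow> sqrt r *\<^sub>R \<zeta> \<in> D"
  by (rule dilate_bD) auto

lemma boundary_kernel_hermitian:
  "\<zeta> \<in> bD \<Longrightarrow> \<eta> \<in> bD \<Longrightarrow> 0 \<le> r \<Longrightarrow> r < 1 \<Longrightarrow> boundary_kernel r \<zeta> \<eta> = cnj (boundary_kernel r \<eta> \<zeta>)"
  unfolding boundary_kernel_def by (rule kernel_hermitian) (auto intro: sqrt_dilate)

lemma kernel_split:
  assumes z: "z \<in> D" and \<eta>: "\<eta> \<in> bD" and r: "0 \<le> r" "r < 1"
  shows "C z (r *\<^sub>R \<eta>) = C (sqrt r *\<^sub>R z) (sqrt r *\<^sub>R \<eta>)"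
  using kernel_dilation[OF z sqrt_dilate[OF \<eta> r], of "sqrt r"] r by simp

text \<open>Moving a dilation by the square root of \<open>r\<close> to the second argument turns the limit at
  a boundary point into a limit at a point of the domain, where the kernel is continuous.\<close>

lemma kernel_boundary_value_eq:
  assumes \<eta>: "\<eta> \<in> bD" and \<zeta>: "\<zeta> \<in> bD" and r: "0 \<le> r" "r < 1"
  shows "kernel_boundary_value D C (r *\<^sub>R \<eta>) \<zeta> = boundary_kernel r \<eta> \<zeta>"
  unfolding kernel_boundary_value_def
proof (rule tendsto_Lim)
  have "\<zeta> \<in> closure D" "\<zeta> \<notin> D" using \<zeta> bD_frontier D_open by (auto simp: frontier_def interior_open)
  then show "\<not> trivial_limit (at \<zeta> within D)"
    by (auto simp: trivial_limit_within closure_def)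
  have a: "sqrt r *\<^sub>R \<eta> \<in> D" by (rule sqrt_dilate[OF \<eta> r])
  have b: "sqrt r *\<^sub>R \<zeta> \<in> D" by (rule sqrt_dilate[OF \<zeta> r])
  have "isCont (\<lambda>z. C z (sqrt r *\<^sub>R \<eta>)) (sqrt r *\<^sub>R \<zeta>)"
    using holo_on_continuous[OF kernel_holo[OF a]] D_open b by (simp add: continuous_on_eq_continuous_at)
  moreover have "((\<lambda>w. sqrt r *\<^sub>R w) \<longlongrightarrow> sqrt r *\<^sub>R \<zeta>) (at \<zeta> within D)"
    by (intro tendsto_intros)
  ultimately have "((\<lambda>w. cnj (C (sqrt r *\<^sub>R w) (sqrt r *\<^sub>R \<eta>))) \<longlongrightarrow> cnj (C (sqrt r *\<^sub>R \<zeta>) (sqrt r *\<^sub>R \<eta>))) (at \<zeta> within D)"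
    by (intro tendsto_cnj isCont_tendsto_compose[where g = "\<lambda>z. C z (sqrt r *\<^sub>R \<eta>)"])
  moreover have "\<forall>\<^sub>F w in at \<zeta> within D. cnj (C (sqrt r *\<^sub>R w) (sqrt r *\<^sub>R \<eta>)) = C (r *\<^sub>R \<eta>) w"
    unfolding eventually_at_filter
    by (intro always_eventually allI impI)
       (simp only: kernel_split[OF _ \<eta> r, symmetric] kernel_hermitian[OF dilate_bD[OF \<eta> r], symmetric])
  ultimately have "((\<lambda>w. C (r *\<^sub>R \<eta>) w) \<longlongrightarrow> cnj (C (sqrt r *\<^sub>R \<zeta>) (sqrt r *\<^sub>R \<eta>))) (at \<zeta> within D)"
    by (rule Lim_transform_eventually)
  then show "((\<lambda>w. C (r *\<^sub>R \<eta>) w) \<longlongrightarrow> boundary_kernel r \<eta> \<zeta>) (at \<zeta> within D)"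
    using kernel_hermitian[OF a b] by (simp add: boundary_kernel_def)
qed

lemma boundary_kernel_automorphism:
  assumes A: "A \<in> linear_automorphisms D" and "\<zeta> \<in> bD" "\<eta> \<in> bD" and r: "0 \<le> r" "r < 1"
  shows "boundary_kernel r (A *v \<zeta>) (A *v \<eta>) = boundary_kernel r \<zeta> \<eta>"
proof -
  have e: "sqrt r *\<^sub>R (A *v z) = A *v (sqrt r *\<^sub>R z)" for z
    unfolding of_real_smult[symmetric] by (rule vector_scalar_commute[symmetric])
  show ?thesis unfolding boundary_kernel_def e by (intro kernel_automorphism A sqrt_dilate assms)
qed

lemma continuous_boundary_kernel_left:
  assumes \<eta>: "\<eta> \<in> bD" and r: "0 \<le> r" "r < 1"
  shows "continuous_on bD (\<lambda>\<zeta>. boundary_kernel r \<zeta> \<eta>)"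
  unfolding boundary_kernel_def
  using sqrt_unit[OF r] by (intro continuous_dilation holo_on_continuous kernel_holo sqrt_dilate \<eta> r) auto

text \<open>The kernel is holomorphic in one variable and antiholomorphic in the other, hence separately
  continuous. Moving the second variable to a fixed point by a linear automorphism, which is an isometry,
  shows that the modulus of continuity in the first variable does not depend on the second one.\<close>

lemma continuous_boundary_kernel:
  assumes r: "0 \<le> r" "r < 1"
  shows "continuous_on (bD \<times> bD) (\<lambda>p. boundary_kernel r (fst p) (snd p))"
proof (cases "bD = {}")
  case False
  then obtain \<eta>0 where \<eta>0: "\<eta>0 \<in> bD" by blast
  let ?k = "boundary_kernel r"
  have uc: "uniformly_continuous_on bD (\<lambda>\<zeta>. ?k \<zeta> \<eta>0)"
    by (rule compact_uniformly_continuous[OF continuous_boundary_kernel_left[OF \<eta>0 r] bD_compact])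
  show ?thesis
    unfolding continuous_on_iff
  proof (intro ballI allI impI)
    fix p and e :: real assume p: "p \<in> bD \<times> bD" and e: "0 < e"
    obtain \<zeta> \<eta> where p_eq: "p = (\<zeta>, \<eta>)" and \<zeta>: "\<zeta> \<in> bD" and \<eta>: "\<eta> \<in> bD" using p by auto
    \<comment> \<open>\<open>d1\<close> controls the first variable, uniformly in the second; \<open>d2\<close> the second, for the fixed first variable \<open>\<zeta>\<close>.\<close>
    obtain d1 where d1: "0 < d1" "\<And>x y. x \<in> bD \<Longrightarrow> y \<in> bD \<Longrightarrow> dist x y < d1 \<Longrightarrow> dist (?k x \<eta>0) (?k y \<eta>0) < e / 2"
      using uc e unfolding uniformly_continuous_on_def by (meson half_gt_zero)
    obtain d2 where d2: "0 < d2" "\<And>y. y \<in> bD \<Longrightarrow> dist y \<eta> < d2 \<Longrightarrow> dist (?k y \<zeta>) (?k \<eta> \<zeta>) < e / 2"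
      using continuous_boundary_kernel_left[OF \<zeta> r] e \<eta> unfolding continuous_on_iff by (meson half_gt_zero)
    have "dist (?k (fst q) (snd q)) (?k (fst p) (snd p)) < e" if q: "q \<in> bD \<times> bD" "dist q p < min d1 d2" for q
    proof -
      obtain x y where q_eq: "q = (x, y)" and x: "x \<in> bD" and y: "y \<in> bD" using q by auto
      have dx: "dist x \<zeta> < d1" and dy: "dist y \<eta> < d2"
        using q(2) dist_fst_le[of q p] dist_snd_le[of q p] by (auto simp: q_eq p_eq)
      obtain A where A: "A \<in> linear_automorphisms D" "A *v y = \<eta>0" using transitive[OF y \<eta>0] by blast
      have iso: "dist (A *v x) (A *v \<zeta>) = dist x \<zeta>"
        using unitary_isometry[of A "x - \<zeta>"] unitary A(1)
        by (simp add: dist_norm matrix_vector_mult_diff_distrib subset_iff)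
      have "?k x y = ?k (A *v x) \<eta>0" "?k \<zeta> y = ?k (A *v \<zeta>) \<eta>0"
        using boundary_kernel_automorphism[OF A(1) x y r] boundary_kernel_automorphism[OF A(1) \<zeta> y r] A(2)
        by simp_all
      then have 1: "dist (?k x y) (?k \<zeta> y) < e / 2"
        using d1(2)[of "A *v x" "A *v \<zeta>"] aut_bD[OF A(1)] x \<zeta> dx iso by simp
      have "?k \<zeta> y = cnj (?k y \<zeta>)" "?k \<zeta> \<eta> = cnj (?k \<eta> \<zeta>)"
        by (rule boundary_kernel_hermitian[OF \<zeta> y r] boundary_kernel_hermitian[OF \<zeta> \<eta> r])+
      then have "dist (?k \<zeta> y) (?k \<zeta> \<eta>) = dist (?k y \<zeta>) (?k \<eta> \<zeta>)"
        by (metis complex_cnj_diff complex_mod_cnj dist_norm)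
      then have 2: "dist (?k \<zeta> y) (?k \<zeta> \<eta>) < e / 2" using d2(2)[OF y dy] by simp
      show ?thesis using dist_triangle[of "?k x y" "?k \<zeta> \<eta>" "?k \<zeta> y"] 1 2 by (simp add: q_eq p_eq)
    qed
    then show "\<exists>d>0. \<forall>q\<in>bD \<times> bD. dist q p < d \<longrightarrow> dist (?k (fst q) (snd q)) (?k (fst p) (snd p)) < e"
      using d1(1) d2(1) by (intro exI[of _ "min d1 d2"]) auto
  qed
qed simp

lemma kernel_bound:
  assumes \<eta>: "\<eta> \<in> bD" and r: "0 \<le> r" "r < 1"
  obtains B where "\<And>\<rho> \<zeta>. 0 \<le> \<rho> \<Longrightarrow> \<rho> < 1 \<Longrightarrow> \<zeta> \<in> bD \<Longrightarrow> cmod (C (\<rho> *\<^sub>R \<zeta>) (r *\<^sub>R \<eta>)) \<le> B"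
proof -
  have s: "0 \<le> sqrt r" "sqrt r < 1" using r by auto
  obtain B where B: "\<And>\<rho> \<zeta>. 0 \<le> \<rho> \<Longrightarrow> \<rho> \<le> sqrt r \<Longrightarrow> \<zeta> \<in> bD \<Longrightarrow> norm (C (\<rho> *\<^sub>R \<zeta>) (sqrt r *\<^sub>R \<eta>)) \<le> B"
    using bounded_on_dilations[OF holo_on_continuous[OF kernel_holo[OF sqrt_dilate[OF \<eta> r]]] s] by blast
  have "cmod (C (\<rho> *\<^sub>R \<zeta>) (r *\<^sub>R \<eta>)) \<le> B" if "0 \<le> \<rho>" "\<rho> < 1" "\<zeta> \<in> bD" for \<rho> \<zeta>
    using B[of "sqrt r * \<rho>" \<zeta>] kernel_split[OF dilate_bD[OF that(3,1,2)] \<eta> r] that s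
    by (simp add: mult_left_le)
  then show ?thesis using that by blast
qed

lemma kernel_boundary_limit:
  assumes \<eta>: "\<eta> \<in> bD" and \<zeta>: "\<zeta> \<in> bD" and r: "0 \<le> r" "r < 1"
  shows "(\<lambda>n. C (radius n *\<^sub>R \<zeta>) (r *\<^sub>R \<eta>)) \<longlonglongrightarrow> boundary_kernel r \<zeta> \<eta>"
proof -
  have "isCont (\<lambda>z. C z (sqrt r *\<^sub>R \<eta>)) (sqrt r *\<^sub>R \<zeta>)"
    using holo_on_continuous[OF kernel_holo[OF sqrt_dilate[OF \<eta> r]]] D_open sqrt_dilate[OF \<zeta> r]
    by (simp add: continuous_on_eq_continuous_at)
  moreover have "(\<lambda>n. sqrt r *\<^sub>R (radius n *\<^sub>R \<zeta>)) \<longlonglongrightarrow> sqrt r *\<^sub>R (1 *\<^sub>R \<zeta>)"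
    by (intro tendsto_intros radius_tendsto)
  ultimately have "(\<lambda>n. C (sqrt r *\<^sub>R (radius n *\<^sub>R \<zeta>)) (sqrt r *\<^sub>R \<eta>)) \<longlonglongrightarrow> C (sqrt r *\<^sub>R \<zeta>) (sqrt r *\<^sub>R \<eta>)"
    by (intro isCont_tendsto_compose[where g = "\<lambda>z. C z (sqrt r *\<^sub>R \<eta>)"]) auto
  then show ?thesis
    using kernel_split[OF dilate_bD[OF \<zeta> radius] \<eta> r] by (simp add: boundary_kernel_def)
qed

text \<open>The reproducing property for functions with bounded radial limits, by dominated convergence along
  the radii.\<close>

lemma boundary_reproducing:
  assumes f: "holo_on D f" and B: "\<And>\<rho> \<zeta>. 0 \<le> \<rho> \<Longrightarrow> \<rho> < 1 \<Longrightarrow> \<zeta> \<in> bD \<Longrightarrow> cmod (f (\<rho> *\<^sub>R \<zeta>)) \<le> B"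
    and F: "\<And>\<zeta>. \<zeta> \<in> bD \<Longrightarrow> (\<lambda>n. f (radius n *\<^sub>R \<zeta>)) \<longlonglongrightarrow> F \<zeta>" "continuous_on bD F"
    and \<eta>: "\<eta> \<in> bD" and r: "0 \<le> r" "r < 1"
  shows "f (r *\<^sub>R \<eta>) = (\<integral>\<zeta>. F \<zeta> * cnj (boundary_kernel r \<zeta> \<eta>) \<partial>\<beta>)"
proof -
  interpret prob_space \<beta> by (rule prob_beta)
  have w: "r *\<^sub>R \<eta> \<in> D" by (rule dilate_bD[OF \<eta> r])
  obtain E where E: "\<And>\<rho> \<zeta>. 0 \<le> \<rho> \<Longrightarrow> \<rho> < 1 \<Longrightarrow> \<zeta> \<in> bD \<Longrightarrow> cmod (C (\<rho> *\<^sub>R \<zeta>) (r *\<^sub>R \<eta>)) \<le> E"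
    using kernel_bound[OF \<eta> r] by blast
  have "(\<lambda>n. pairing f (\<lambda>z. C z (r *\<^sub>R \<eta>)) (radius n) (radius n)) \<longlonglongrightarrow> f (r *\<^sub>R \<eta>)"
    by (rule kernel_limit[OF w H2I[OF f B]])
  moreover have "(\<lambda>n. pairing f (\<lambda>z. C z (r *\<^sub>R \<eta>)) (radius n) (radius n)) \<longlonglongrightarrow> (\<integral>\<zeta>. F \<zeta> * cnj (boundary_kernel r \<zeta> \<eta>) \<partial>\<beta>)"
    unfolding pairing_def
  proof (rule integral_dominated_convergence[where w = "\<lambda>_. \<bar>B\<bar> * \<bar>E\<bar>"])
    show "(\<lambda>\<zeta>. F \<zeta> * cnj (boundary_kernel r \<zeta> \<eta>)) \<in> borel_measurable \<beta>"
      by (intro borel_measurable_continuous[OF finite_beta] continuous_intros F(2) continuous_boundary_kernel_left \<eta> r)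
    show "(\<lambda>\<zeta>. f (radius n *\<^sub>R \<zeta>) * cnj (C (radius n *\<^sub>R \<zeta>) (r *\<^sub>R \<eta>))) \<in> borel_measurable \<beta>" for n
      by (rule borel_measurable_continuous[OF finite_beta], intro continuous_intros,
          rule continuous_dilation[OF holo_on_continuous[OF f] radius],
          rule continuous_dilation[OF holo_on_continuous[OF kernel_holo[OF w]] radius])
    show "AE \<zeta> in \<beta>. (\<lambda>n. f (radius n *\<^sub>R \<zeta>) * cnj (C (radius n *\<^sub>R \<zeta>) (r *\<^sub>R \<eta>))) \<longlonglongrightarrow> F \<zeta> * cnj (boundary_kernel r \<zeta> \<eta>)"
      by (rule AE_I2) (auto simp: space_beta intro!: tendsto_intros F kernel_boundary_limit \<eta> r)
    show "AE \<zeta> in \<beta>. norm (f (radius n *\<^sub>R \<zeta>) * cnj (C (radius n *\<^sub>R \<zeta>) (r *\<^sub>R \<eta>))) \<le> \<bar>B\<bar> * \<bar>E\<bar>" for n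
    proof (rule AE_I2)
      fix \<zeta> assume "\<zeta> \<in> space \<beta>"
      then have \<zeta>: "\<zeta> \<in> bD" by (simp add: space_beta)
      show "norm (f (radius n *\<^sub>R \<zeta>) * cnj (C (radius n *\<^sub>R \<zeta>) (r *\<^sub>R \<eta>))) \<le> \<bar>B\<bar> * \<bar>E\<bar>"
        unfolding norm_mult complex_mod_cnj
        using B[OF radius \<zeta>, of n] E[OF radius \<zeta>, of n] by (intro mult_mono) auto
    qed
  qed simp
  ultimately show ?thesis by (rule LIMSEQ_unique)
qed

lemma kernel_mean:
  assumes \<eta>: "\<eta> \<in> bD" and r: "0 \<le> r" "r < 1"
  shows "(\<integral>\<zeta>. cnj (boundary_kernel r \<zeta> \<eta>) \<partial>\<beta>) = 1"
  using boundary_reproducing[OF holo_on_const, of 1 1 "\<lambda>_. 1", OF _ _ _ \<eta> r] by simp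

text \<open>The product of the kernel with an affine function is reproduced by the kernel: the affine function
  is evaluated at the pole \<open>r \<eta>\<close>, since the pole is \<open>r\<close> times a unit
  vector.\<close>

lemma kernel_weighted_mean:
  assumes \<eta>: "\<eta> \<in> bD" and r: "0 \<le> r" "r < 1"
  shows "C (r *\<^sub>R \<eta>) (r *\<^sub>R \<eta>) * (a + b * of_real r)
    = (\<integral>\<zeta>. (a + b * hermitian_inner \<zeta> \<eta>) * of_real ((cmod (boundary_kernel r \<zeta> \<eta>))\<^sup>2) \<partial>\<beta>)"
proof -
  let ?l = "\<lambda>x. a + b * hermitian_inner x \<eta>"
  have w: "r *\<^sub>R \<eta> \<in> D" by (rule dilate_bD[OF \<eta> r])
  obtain E where E: "\<And>\<rho> \<zeta>. 0 \<le> \<rho> \<Longrightarrow> \<rho> < 1 \<Longrightarrow> \<zeta> \<in> bD \<Longrightarrow> cmod (C (\<rho> *\<^sub>R \<zeta>) (r *\<^sub>R \<eta>)) \<le> E"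
    using kernel_bound[OF \<eta> r] by blast
  have cl: "continuous_on S ?l" for S
    by (intro continuous_intros bounded_linear.continuous_on[OF bounded_linear_hermitian_inner])
  obtain G where "0 \<le> G" and G: "\<And>x. x \<in> cball 0 1 \<Longrightarrow> norm (?l x) \<le> G"
    by (rule continuous_on_compact_bound[OF compact_cball[of 0 1] cl]) (rule that, auto)
  have scale: "?l (\<rho> *\<^sub>R \<eta>) = a + b * of_real \<rho>" for \<rho>
  proof -
    have "norm \<eta> = 1" using \<eta> bD_sphere by auto
    then have "hermitian_inner \<eta> \<eta> = 1" by (simp add: hermitian_inner_self)
    then have "hermitian_inner (\<rho> *\<^sub>R \<eta>) \<eta> = of_real \<rho>"
      using linear_scale[OF bounded_linear.linear[OF bounded_linear_hermitian_inner[of \<eta>]], of \<rho> \<eta>]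
      by (simp add: scaleR_conv_of_real)
    then show ?thesis by simp
  qed
  have "C (r *\<^sub>R \<eta>) (r *\<^sub>R \<eta>) * ?l (r *\<^sub>R \<eta>)
      = (\<integral>\<zeta>. boundary_kernel r \<zeta> \<eta> * ?l \<zeta> * cnj (boundary_kernel r \<zeta> \<eta>) \<partial>\<beta>)"
  proof (rule boundary_reproducing[where B = "\<bar>E\<bar> * \<bar>G\<bar>" and f = "\<lambda>z. C z (r *\<^sub>R \<eta>) * ?l z", OF _ _ _ _ \<eta> r])
    show "holo_on D (\<lambda>z. C z (r *\<^sub>R \<eta>) * ?l z)"
      by (intro holo_on_mult kernel_holo w holo_on_add_mult holo_on_const holo_on_hermitian_inner)
    show "cmod (C (\<rho> *\<^sub>R \<zeta>) (r *\<^sub>R \<eta>) * ?l (\<rho> *\<^sub>R \<zeta>)) \<le> \<bar>E\<bar> * \<bar>G\<bar>" if "0 \<le> \<rho>" "\<rho> < 1" "\<zeta> \<in> bD" for \<rho> \<zeta>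
    proof -
      have "norm \<zeta> = 1" using that bD_sphere by auto
      then have "\<rho> *\<^sub>R \<zeta> \<in> cball 0 1" using that by simp
      from G[OF this] E[OF that] show ?thesis unfolding norm_mult by (intro mult_mono) auto
    qed
    show "(\<lambda>n. C (radius n *\<^sub>R \<zeta>) (r *\<^sub>R \<eta>) * ?l (radius n *\<^sub>R \<zeta>)) \<longlonglongrightarrow> boundary_kernel r \<zeta> \<eta> * ?l \<zeta>"
      if "\<zeta> \<in> bD" for \<zeta>
    proof (rule tendsto_mult[OF kernel_boundary_limit[OF \<eta> that r]])
      have "(\<lambda>n. radius n *\<^sub>R \<zeta>) \<longlonglongrightarrow> 1 *\<^sub>R \<zeta>" by (intro tendsto_intros radius_tendsto)
      moreover have "isCont ?l \<zeta>" using cl[of UNIV] by (simp add: continuous_on_eq_continuous_at)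
      ultimately show "(\<lambda>n. ?l (radius n *\<^sub>R \<zeta>)) \<longlonglongrightarrow> ?l \<zeta>"
        by (intro isCont_tendsto_compose[where g = ?l]) auto
    qed
    show "continuous_on bD (\<lambda>\<zeta>. boundary_kernel r \<zeta> \<eta> * ?l \<zeta>)"
      by (intro continuous_on_mult continuous_boundary_kernel_left \<eta> r cl)
  qed
  also have "\<dots> = (\<integral>\<zeta>. ?l \<zeta> * of_real ((cmod (boundary_kernel r \<zeta> \<eta>))\<^sup>2) \<partial>\<beta>)"
    unfolding complex_norm_square by (simp only: mult_ac)
  finally show ?thesis unfolding scale .
qed

text \<open>The squared Hardy norm of the kernel function with pole \<open>r \<eta>\<close>, that is, the
  diagonal value of the kernel.\<close>

definition kernel_norm :: "real \<Rightarrow> complex^'n \<Rightarrow> real" where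
  "kernel_norm r \<eta> = (\<integral>\<zeta>. (cmod (boundary_kernel r \<zeta> \<eta>))\<^sup>2 \<partial>\<beta>)"

text \<open>The Poisson-Szego kernel at the point \<open>r \<eta>\<close> of the domain and the boundary point
  \<open>\<zeta>\<close>, as a real number.\<close>

definition radial_poisson :: "real \<Rightarrow> complex^'n \<Rightarrow> complex^'n \<Rightarrow> real" where
  "radial_poisson r \<zeta> \<eta> = (cmod (boundary_kernel r \<zeta> \<eta>))\<^sup>2 / kernel_norm r \<eta>"

context
  fixes r :: real assumes r: "0 \<le> r" "r < 1"
begin

lemma kernel_diagonal:
  assumes \<eta>: "\<eta> \<in> bD" shows "C (r *\<^sub>R \<eta>) (r *\<^sub>R \<eta>) = of_real (kernel_norm r \<eta>)"
  using kernel_weighted_mean[OF \<eta> r, of 1 0] unfolding kernel_norm_def by (simp del: of_real_power)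

text \<open>Otherwise the kernel function would vanish almost everywhere on the boundary, although its mean is
  1.\<close>

lemma kernel_norm_pos:
  assumes \<eta>: "\<eta> \<in> bD" shows "0 < kernel_norm r \<eta>"
proof -
  have c: "continuous_on bD (\<lambda>\<zeta>. (cmod (boundary_kernel r \<zeta> \<eta>))\<^sup>2)"
    by (intro continuous_intros continuous_boundary_kernel_left \<eta> r)
  have "kernel_norm r \<eta> \<noteq> 0"
  proof
    assume "kernel_norm r \<eta> = 0"
    then have "AE \<zeta> in \<beta>. (cmod (boundary_kernel r \<zeta> \<eta>))\<^sup>2 = 0"
      unfolding kernel_norm_def
      by (subst (asm) integral_nonneg_eq_0_iff_AE) (auto intro: integrable_continuous[OF finite_beta c])
    then have "(\<integral>\<zeta>. cnj (boundary_kernel r \<zeta> \<eta>) \<partial>\<beta>) = 0"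
      by (intro integral_eq_zero_AE) simp
    then show False using kernel_mean[OF \<eta> r] by simp
  qed
  moreover have "0 \<le> kernel_norm r \<eta>"
    unfolding kernel_norm_def by (rule Bochner_Integration.integral_nonneg) simp
  ultimately show ?thesis by simp
qed

lemma kernel_norm_constant:
  assumes "\<zeta> \<in> bD" "\<eta> \<in> bD" shows "kernel_norm r \<zeta> = kernel_norm r \<eta>"
proof -
  obtain A where A: "A \<in> linear_automorphisms D" "A *v \<zeta> = \<eta>" using transitive[OF assms] by blast
  have "r *\<^sub>R \<eta> = A *v (r *\<^sub>R \<zeta>)"
    unfolding of_real_smult[symmetric] A(2)[symmetric] by (rule vector_scalar_commute[symmetric])
  then have "C (r *\<^sub>R \<eta>) (r *\<^sub>R \<eta>) = C (r *\<^sub>R \<zeta>) (r *\<^sub>R \<zeta>)"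
    using kernel_automorphism[OF A(1) dilate_bD[OF assms(1) r] dilate_bD[OF assms(1) r]] by simp
  then have "complex_of_real (kernel_norm r \<eta>) = of_real (kernel_norm r \<zeta>)"
    using assms by (simp only: kernel_diagonal)
  then show ?thesis by (simp only: of_real_eq_iff)
qed

text \<open>The diagonal values of the kernel agree at \<open>r \<zeta>\<close> and \<open>r \<eta>\<close>,
  as linear automorphisms act transitively on the boundary.\<close>

lemma radial_poisson_symmetric:
  assumes "\<zeta> \<in> bD" "\<eta> \<in> bD" shows "radial_poisson r \<zeta> \<eta> = radial_poisson r \<eta> \<zeta>"
  unfolding radial_poisson_def
  using kernel_norm_constant[OF assms] boundary_kernel_hermitian[OF assms r] by simp

lemma poisson_szego_radial:
  assumes "\<zeta> \<in> bD" "\<eta> \<in> bD"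
  shows "poisson_szego D C (r *\<^sub>R \<eta>) \<zeta> = of_real (radial_poisson r \<zeta> \<eta>)"
  unfolding poisson_szego_def radial_poisson_def
  using kernel_boundary_value_eq[OF assms(2,1) r] kernel_diagonal[OF assms(2)] boundary_kernel_hermitian[OF assms r]
  by simp

lemma radial_poisson_nonneg: "\<eta> \<in> bD \<Longrightarrow> 0 \<le> radial_poisson r \<zeta> \<eta>"
  unfolding radial_poisson_def using kernel_norm_pos[of \<eta>] by simp

lemma continuous_radial_poisson:
  "continuous_on (bD \<times> bD) (\<lambda>p. radial_poisson r (fst p) (snd p))"
proof (cases "bD = {}")
  case False
  then obtain \<eta>0 where \<eta>0: "\<eta>0 \<in> bD" by blast
  have "continuous_on (bD \<times> bD) (\<lambda>p. (cmod (boundary_kernel r (fst p) (snd p)))\<^sup>2 / kernel_norm r \<eta>0)"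
    using kernel_norm_pos[OF \<eta>0] by (intro continuous_intros continuous_boundary_kernel r) auto
  then show ?thesis
    by (rule continuous_on_eq) (auto simp: radial_poisson_def kernel_norm_constant[OF _ \<eta>0])
qed simp

lemma radial_poisson_mass:
  assumes \<eta>: "\<eta> \<in> bD" shows "(\<integral>\<zeta>. radial_poisson r \<zeta> \<eta> \<partial>\<beta>) = 1"
  using kernel_norm_pos[OF \<eta>] unfolding radial_poisson_def kernel_norm_def by simp

text \<open>On the unit sphere the squared distance from \<open>\<eta>\<close> is the real part of an affine
  function, to which \<open>kernel_weighted_mean\<close> applies.\<close>

lemma radial_poisson_spread:
  assumes \<eta>: "\<eta> \<in> bD"
  shows "(\<integral>\<zeta>. (dist \<zeta> \<eta>)\<^sup>2 * radial_poisson r \<zeta> \<eta> \<partial>\<beta>) = 2 - 2 * r"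
proof -
  let ?k = "\<lambda>\<zeta>. (cmod (boundary_kernel r \<zeta> \<eta>))\<^sup>2"
  have c: "continuous_on bD ?k" by (intro continuous_intros continuous_boundary_kernel_left \<eta> r)
  have I: "integrable \<beta> (\<lambda>\<zeta>. (2 + (- 2) * hermitian_inner \<zeta> \<eta>) * of_real (?k \<zeta>))"
    by (intro integrable_continuous[OF finite_beta] continuous_intros bounded_linear.continuous_on[OF bounded_linear_hermitian_inner]
        continuous_boundary_kernel_left \<eta> r)
  have "(\<integral>\<zeta>. (dist \<zeta> \<eta>)\<^sup>2 * ?k \<zeta> \<partial>\<beta>) = (\<integral>\<zeta>. Re ((2 + (- 2) * hermitian_inner \<zeta> \<eta>) * of_real (?k \<zeta>)) \<partial>\<beta>)"
  proof (rule Bochner_Integration.integral_cong)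
    fix \<zeta> assume "\<zeta> \<in> space \<beta>"
    then have "norm \<zeta> = 1" "norm \<eta> = 1" using bD_sphere \<eta> by (auto simp: space_beta)
    then have "\<zeta> \<bullet> \<zeta> = 1" "\<eta> \<bullet> \<eta> = 1" by (simp_all add: dot_square_norm)
    then have "(dist \<zeta> \<eta>)\<^sup>2 = 2 + (- 2) * (\<zeta> \<bullet> \<eta>)"
      by (simp add: dist_norm power2_norm_eq_inner inner_diff_left inner_diff_right inner_commute)
    also have "\<dots> = Re (2 + (- 2) * hermitian_inner \<zeta> \<eta>)"
      by (simp add: Re_hermitian_inner)
    finally show "(dist \<zeta> \<eta>)\<^sup>2 * ?k \<zeta> = Re ((2 + (- 2) * hermitian_inner \<zeta> \<eta>) * of_real (?k \<zeta>))"
      by simp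
  qed simp
  also have "\<dots> = Re (C (r *\<^sub>R \<eta>) (r *\<^sub>R \<eta>) * (2 + (- 2) * of_real r))"
    unfolding kernel_weighted_mean[OF \<eta> r] by (rule integral_Re[OF I])
  also have "\<dots> = kernel_norm r \<eta> * (2 - 2 * r)"
    unfolding kernel_diagonal[OF \<eta>] by simp
  finally show ?thesis
    using kernel_norm_pos[OF \<eta>] unfolding radial_poisson_def by (simp add: field_simps)
qed

end

text \<open>The kernel with pole 0 is constant; its mean being 1, the constant is 1.\<close>

lemma radial_poisson_zero:
  assumes "\<zeta> \<in> bD" "\<eta> \<in> bD" shows "radial_poisson 0 \<zeta> \<eta> = 1"
proof -
  interpret prob_space \<beta> by (rule prob_beta)
  have "boundary_kernel 0 x \<eta> = C 0 0" for x by (simp add: boundary_kernel_def)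
  then have "cnj (C 0 0) = 1" using kernel_mean[OF assms(2), of 0] by (simp add: prob_space)
  then show ?thesis
    by (simp add: radial_poisson_def kernel_norm_def boundary_kernel_def prob_space)
qed

end


section \<open>Mixtures of measures and disintegrations\<close>

lemma sets_restrict_closed:
  fixes K :: "'a::topological_space set"
  assumes "closed K"
  shows "sets (restrict_space borel K) = sigma_sets K {F. closed F \<and> F \<subseteq> K}"
proof -
  have o: "{F. closed F \<and> F \<subseteq> K} = (\<inter>) K ` {S. closed S}" using assms by (auto intro: image_eqI[of _ _ "_"])
  have b: "sets (borel :: 'a measure) = sigma_sets UNIV {S. closed S}"
    by (subst borel_eq_closed) simp
  have "sets (restrict_space borel K) = (\<inter>) K ` sigma_sets UNIV {S. closed S}"
    by (simp add: sets_restrict_space b)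
  also have "\<dots> = sigma_sets K ((\<inter>) K ` {S. closed S})"
    using assms by (intro sigma_sets_Int) (auto simp flip: b)
  finally show ?thesis by (simp add: o)
qed

locale measure_mixture =
  fixes \<mu> :: "'a measure" and \<nu> :: "'b measure" and m :: "'b \<Rightarrow> 'a measure"
  assumes sets_m: "\<And>y. y \<in> space \<nu> \<Longrightarrow> sets (m y) = sets \<mu>"
    and kernel_measurable: "\<And>A. A \<in> sets \<mu> \<Longrightarrow> (\<lambda>y. emeasure (m y) A) \<in> borel_measurable \<nu>"
    and mixture: "\<And>A. A \<in> sets \<mu> \<Longrightarrow> emeasure \<mu> A = (\<integral>\<^sup>+y. emeasure (m y) A \<partial>\<nu>)"

text \<open>The indicator function of a closed set is the limit of a decreasing sequence of continuous
  functions, so that both properties of a mixture hold for closed sets. These form a generating family stable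
  under intersections; complements are handled by means of the common mass.\<close>

lemma measure_mixture_compact:
  fixes K :: "'a::metric_space set"
  assumes \<mu>: "finite_measure_on K \<mu>" and \<nu>: "finite_measure \<nu>"
    and m: "\<And>y. y \<in> space \<nu> \<Longrightarrow> finite_measure_on K (m y)" "\<And>y. y \<in> space \<nu> \<Longrightarrow> emeasure (m y) K = ennreal c" "0 \<le> c"
    and meas: "\<And>g::'a \<Rightarrow> complex. continuous_on K g \<Longrightarrow> (\<lambda>y. \<integral>x. g x \<partial>m y) \<in> borel_measurable \<nu>"
    and int: "\<And>g::'a \<Rightarrow> complex. continuous_on K g \<Longrightarrow> (\<integral>x. g x \<partial>\<mu>) = (\<integral>y. (\<integral>x. g x \<partial>m y) \<partial>\<nu>)"
  shows "measure_mixture \<mu> \<nu> m"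
proof -
  interpret \<nu>: finite_measure \<nu> by (rule \<nu>)
  interpret \<mu>: finite_measure \<mu> using \<mu> by (simp add: finite_measure_on_def)
  have K: "closed K" using \<mu> by (auto simp: finite_measure_on_def compact_imp_closed)
  have s\<mu>: "sets \<mu> = sets (restrict_space borel K)" "space \<mu> = K"
    using \<mu> finite_measure_on_space[OF \<mu>] by (auto simp: finite_measure_on_def)
  have sm: "sets (m y) = sets (restrict_space borel K)" "space (m y) = K" "finite_measure (m y)" if "y \<in> space \<nu>" for y
    using m(1)[OF that] finite_measure_on_space[OF m(1)[OF that]] by (auto simp: finite_measure_on_def)
  have real_meas: "(\<lambda>y. \<integral>x. g x \<partial>m y) \<in> borel_measurable \<nu>"
    and real_int: "(\<integral>x. g x \<partial>\<mu>) = (\<integral>y. (\<integral>x. g x \<partial>m y) \<partial>\<nu>)" if g: "continuous_on K g" for g :: "'a \<Rightarrow> real"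
  proof -
    have g': "continuous_on K (\<lambda>x. complex_of_real (g x))" by (intro continuous_intros g)
    show "(\<lambda>y. \<integral>x. g x \<partial>m y) \<in> borel_measurable \<nu>"
      using measurable_compose[OF meas[OF g'] borel_measurable_Re] by simp
    have "complex_of_real (\<integral>x. g x \<partial>\<mu>) = of_real (\<integral>y. (\<integral>x. g x \<partial>m y) \<partial>\<nu>)"
      using int[OF g'] by simp
    then show "(\<integral>x. g x \<partial>\<mu>) = (\<integral>y. (\<integral>x. g x \<partial>m y) \<partial>\<nu>)" by (simp only: of_real_eq_iff)
  qed
  have bound: "measure (m y) A \<le> c" if "y \<in> space \<nu>" for y A
    using finite_measure.bounded_measure[OF sm(3)[OF that], of A] m(2)[OF that] m(3) sm(2)[OF that]
    by (simp add: measure_def)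
  let ?P = "\<lambda>A. (\<lambda>y. emeasure (m y) A) \<in> borel_measurable \<nu> \<and> emeasure \<mu> A = (\<integral>\<^sup>+y. emeasure (m y) A \<partial>\<nu>)"
  have closed_case: "?P F" if F: "closed F" "F \<subseteq> K" for F
  proof (cases "F = {}")
    case False
    \<comment> \<open>Continuous functions decreasing to the indicator function of \<open>F\<close>.\<close>
    define g where "g n x = max 0 (1 - real n * infdist x F)" for n x
    have g: "continuous_on K (g n)" for n
      unfolding g_def by (intro continuous_intros)
    have g01: "0 \<le> g n x" "g n x \<le> 1" for n x
      by (auto simp: g_def infdist_nonneg)
    have glim: "(\<lambda>n. g n x) \<longlonglongrightarrow> indicator F x" for x
    proof (cases "x \<in> F")
      case True then show ?thesis by (simp add: g_def)
    next
      case out: False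
      then have pos: "infdist x F > 0"
        using F(1) False in_closed_iff_infdist_zero infdist_nonneg[of x F] by (metis less_eq_real_def)
      obtain k :: nat where k: "1 < real k * infdist x F" using reals_Archimedean3[OF pos] by blast
      have "g n x = 0" if "k \<le> n" for n
      proof -
        have "real k * infdist x F \<le> real n * infdist x F" using that pos by simp
        then show ?thesis using k by (simp add: g_def)
      qed
      then have "\<forall>\<^sub>F n in sequentially. g n x = indicator F x"
        using out by (auto simp: eventually_sequentially)
      then show ?thesis by (rule tendsto_eventually)
    qed
    have lim: "(\<lambda>n. \<integral>x. g n x \<partial>M) \<longlonglongrightarrow> measure M F" if M: "finite_measure_on K M" for M
    proof -
      interpret finite_measure M using M by (simp add: finite_measure_on_def)
      have FM: "F \<in> sets M" using M F by (auto simp: finite_measure_on_def sets_restrict_closed[OF K])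
      have "(\<lambda>n. \<integral>x. g n x \<partial>M) \<longlonglongrightarrow> (\<integral>x. indicator F x \<partial>M)"
        by (rule integral_dominated_convergence[where w = "\<lambda>_. 1"])
           (use g01 FM in \<open>auto intro!: borel_measurable_continuous[OF M g] glim\<close>)
      then show ?thesis using FM by simp
    qed
    have mF: "(\<lambda>y. measure (m y) F) \<in> borel_measurable \<nu>"
    proof (rule borel_measurable_LIMSEQ_real)
      show "(\<lambda>n. \<integral>x. g n x \<partial>m y) \<longlonglongrightarrow> measure (m y) F" if "y \<in> space \<nu>" for y
        by (rule lim[OF m(1)[OF that]])
    qed (rule real_meas[OF g])
    have emF: "emeasure (m y) F = ennreal (measure (m y) F)" if "y \<in> space \<nu>" for y
      using finite_measure.emeasure_eq_measure[OF sm(3)[OF that]] .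
    have "(\<lambda>n. \<integral>y. (\<integral>x. g n x \<partial>m y) \<partial>\<nu>) \<longlonglongrightarrow> (\<integral>y. measure (m y) F \<partial>\<nu>)"
    proof (rule integral_dominated_convergence[where w = "\<lambda>_. c"])
      show "AE y in \<nu>. (\<lambda>n. \<integral>x. g n x \<partial>m y) \<longlonglongrightarrow> measure (m y) F"
        by (rule AE_I2) (rule lim[OF m(1)])
      show "AE y in \<nu>. norm (\<integral>x. g n x \<partial>m y) \<le> c" for n
      proof (rule AE_I2)
        fix y assume y: "y \<in> space \<nu>"
        interpret finite_measure "m y" by (rule sm(3)[OF y])
        have "(\<integral>x. g n x \<partial>m y) \<le> (\<integral>x. 1 \<partial>m y)"
          by (rule Bochner_Integration.integral_mono) (auto intro!: integrable_continuous[OF m(1)[OF y] g] g01)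
        also have "\<dots> \<le> c" using bound[OF y, of K] sm(2)[OF y] by simp
        finally show "norm (\<integral>x. g n x \<partial>m y) \<le> c"
          using Bochner_Integration.integral_nonneg[of "m y" "g n"] g01 by simp
      qed
    qed (use mF real_meas[OF g] in auto)
    moreover have "(\<lambda>n. \<integral>x. g n x \<partial>\<mu>) \<longlonglongrightarrow> measure \<mu> F" by (rule lim[OF \<mu>])
    ultimately have "measure \<mu> F = (\<integral>y. measure (m y) F \<partial>\<nu>)"
      using real_int[OF g] by (simp add: LIMSEQ_unique)
    moreover have "integrable \<nu> (\<lambda>y. measure (m y) F)"
      by (rule \<nu>.integrable_const_bound[of _ c]) (use bound mF in auto)
    ultimately have "emeasure \<mu> F = (\<integral>\<^sup>+y. ennreal (measure (m y) F) \<partial>\<nu>)"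
      by (subst nn_integral_eq_integral) (auto simp: \<mu>.emeasure_eq_measure)
    also have "\<dots> = (\<integral>\<^sup>+y. emeasure (m y) F \<partial>\<nu>)"
      by (rule nn_integral_cong) (simp add: emF)
    moreover have "(\<lambda>y. emeasure (m y) F) \<in> borel_measurable \<nu>"
      using measurable_compose[OF mF measurable_ennreal] by (rule measurable_cong[THEN iffD1, rotated]) (simp add: emF)
    ultimately show ?thesis by simp
  qed simp
  have all: "?P A" if "A \<in> sets (restrict_space borel K)" for A
    using that unfolding sets_restrict_closed[OF K]
  proof (rule sigma_sets_induct_disjoint[of "{F. closed F \<and> F \<subseteq> K}" K _ ?P, rotated 2])
    show "Int_stable {F. closed F \<and> F \<subseteq> K}" by (auto simp: Int_stable_def)
    show "{F. closed F \<and> F \<subseteq> K} \<subseteq> Pow K" by auto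
    show "?P A" if "A \<in> {F. closed F \<and> F \<subseteq> K}" for A using closed_case that by auto
    show "?P {}" by simp
    show "?P (K - A)" if A: "A \<in> sigma_sets K {F. closed F \<and> F \<subseteq> K}" and PA: "?P A" for A
    proof -
      have A': "A \<in> sets (restrict_space borel K)" using A by (simp add: sets_restrict_closed[OF K])
      have e: "emeasure (m y) (K - A) = ennreal c - emeasure (m y) A" if y: "y \<in> space \<nu>" for y
        using emeasure_compl[of A "m y"] sm[OF y] A' m(2)[OF y] finite_measure.emeasure_finite[OF sm(3)[OF y]]
        by simp
      have le: "emeasure (m y) A \<le> ennreal c" if "y \<in> space \<nu>" for y
        using emeasure_space[of "m y" A] sm(2)[OF that] m(2)[OF that] by simp
      have fin: "(\<integral>\<^sup>+y. emeasure (m y) A \<partial>\<nu>) \<noteq> \<infinity>" using PA \<mu>.emeasure_finite[of A] by simp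
      have tot: "emeasure \<mu> K = (\<integral>\<^sup>+y. ennreal c \<partial>\<nu>)"
        using closed_case[OF K subset_refl] m(2) by (simp cong: nn_integral_cong)
      have "emeasure \<mu> (K - A) = emeasure \<mu> K - emeasure \<mu> A"
        using emeasure_compl[of A \<mu>] s\<mu> A' \<mu>.emeasure_finite by simp
      also have "\<dots> = (\<integral>\<^sup>+y. ennreal c - emeasure (m y) A \<partial>\<nu>)"
        unfolding tot using PA fin
        by (subst nn_integral_diff) (use le in \<open>auto intro!: AE_I2\<close>)
      also have "\<dots> = (\<integral>\<^sup>+y. emeasure (m y) (K - A) \<partial>\<nu>)"
        by (rule nn_integral_cong) (simp add: e)
      moreover have "(\<lambda>y. emeasure (m y) (K - A)) \<in> borel_measurable \<nu>"
        by (rule measurable_cong[THEN iffD1, of _ "\<lambda>y. ennreal c - emeasure (m y) A"]) (use PA e in auto)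
      ultimately show ?thesis by simp
    qed
    show "?P (\<Union>i. A i)" if dis: "disjoint_family A" and A: "range A \<subseteq> sigma_sets K {F. closed F \<and> F \<subseteq> K}"
      and PA: "\<And>i::nat. ?P (A i)" for A
    proof -
      have A': "range A \<subseteq> sets (restrict_space borel K)" using A by (simp add: sets_restrict_closed[OF K])
      have e: "emeasure (m y) (\<Union>i. A i) = (\<Sum>i. emeasure (m y) (A i))" if y: "y \<in> space \<nu>" for y
        by (rule suminf_emeasure[symmetric]) (use A' sm[OF y] dis in auto)
      have "emeasure \<mu> (\<Union>i. A i) = (\<Sum>i. emeasure \<mu> (A i))"
        by (rule suminf_emeasure[symmetric]) (use A' s\<mu> dis in auto)
      also have "\<dots> = (\<integral>\<^sup>+y. (\<Sum>i. emeasure (m y) (A i)) \<partial>\<nu>)"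
        using PA by (subst nn_integral_suminf) auto
      also have "\<dots> = (\<integral>\<^sup>+y. emeasure (m y) (\<Union>i. A i) \<partial>\<nu>)"
        by (rule nn_integral_cong) (simp add: e)
      moreover have "(\<lambda>y. emeasure (m y) (\<Union>i. A i)) \<in> borel_measurable \<nu>"
      proof (rule measurable_cong[THEN iffD1, of _ "\<lambda>y. \<Sum>i. emeasure (m y) (A i)"])
        show "(\<lambda>y. \<Sum>i. emeasure (m y) (A i)) \<in> borel_measurable \<nu>" using PA[THEN conjunct1] by measurable
      qed (simp add: e)
      ultimately show ?thesis by simp
    qed
  qed
  show ?thesis
    by unfold_locales (use all s\<mu> sm in auto)
qed

context measure_mixture
begin

lemma space_m: "y \<in> space \<nu> \<Longrightarrow> space (m y) = space \<mu>"
  by (rule sets_eq_imp_space_eq[OF sets_m])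

lemma measurable_m: "y \<in> space \<nu> \<Longrightarrow> measurable (m y) N = measurable \<mu> N"
  by (rule measurable_cong_sets[OF sets_m]) auto

lemma nn_integral_mixture:
  assumes "f \<in> borel_measurable \<mu>"
  shows "(\<lambda>y. \<integral>\<^sup>+x. f x \<partial>m y) \<in> borel_measurable \<nu> \<and> (\<integral>\<^sup>+x. f x \<partial>\<mu>) = (\<integral>\<^sup>+y. (\<integral>\<^sup>+x. f x \<partial>m y) \<partial>\<nu>)"
  using assms
proof (induction f rule: borel_measurable_induct)
  case (cong f g)
  have "(\<integral>\<^sup>+x. f x \<partial>m y) = (\<integral>\<^sup>+x. g x \<partial>m y)" if "y \<in> space \<nu>" for y
    by (rule nn_integral_cong) (use cong space_m[OF that] in auto)
  moreover have "(\<integral>\<^sup>+x. f x \<partial>\<mu>) = (\<integral>\<^sup>+x. g x \<partial>\<mu>)"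
    by (rule nn_integral_cong) (use cong in auto)
  ultimately show ?case
    using cong.IH by (simp cong: measurable_cong nn_integral_cong)
next
  case (set A)
  then show ?case
    using kernel_measurable[OF set] mixture[OF set] sets_m
    by (simp cong: measurable_cong nn_integral_cong)
next
  case (mult u c)
  have "(\<integral>\<^sup>+x. c * u x \<partial>m y) = c * (\<integral>\<^sup>+x. u x \<partial>m y)" if "y \<in> space \<nu>" for y
    using mult(2) by (intro nn_integral_cmult) (simp add: measurable_m[OF that])
  moreover have "(\<lambda>y. c * (\<integral>\<^sup>+x. u x \<partial>m y)) \<in> borel_measurable \<nu>"
    using mult.IH[THEN conjunct1] by measurable
  ultimately show ?case
    using mult by (simp add: nn_integral_cmult cong: measurable_cong nn_integral_cong)
next
  case (add u v)
  have "(\<integral>\<^sup>+x. v x + u x \<partial>m y) = (\<integral>\<^sup>+x. v x \<partial>m y) + (\<integral>\<^sup>+x. u x \<partial>m y)" if "y \<in> space \<nu>" for y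
    using add by (intro nn_integral_add) (simp_all add: measurable_m[OF that])
  moreover have "(\<lambda>y. (\<integral>\<^sup>+x. v x \<partial>m y) + (\<integral>\<^sup>+x. u x \<partial>m y)) \<in> borel_measurable \<nu>"
    using add.IH[THEN conjunct1] by measurable
  ultimately show ?case
    using add by (simp add: nn_integral_add cong: measurable_cong nn_integral_cong)
next
  case (seq U)
  have e: "(\<integral>\<^sup>+x. (SUP i. U i x) \<partial>M) = (SUP i. \<integral>\<^sup>+x. U i x \<partial>M)" if "sets M = sets \<mu>" for M
    using seq that by (intro nn_integral_monotone_convergence_SUP) (auto cong: measurable_cong_sets)
  have inc: "incseq (\<lambda>i y. \<integral>\<^sup>+x. U i x \<partial>m y)"
    using seq(3) by (auto simp: incseq_def le_fun_def intro!: nn_integral_mono)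
  have "(\<integral>\<^sup>+y. (\<integral>\<^sup>+x. (SUP i. U i x) \<partial>m y) \<partial>\<nu>) = (\<integral>\<^sup>+y. (SUP i. \<integral>\<^sup>+x. U i x \<partial>m y) \<partial>\<nu>)"
    by (rule nn_integral_cong) (simp add: e sets_m)
  also have "\<dots> = (SUP i. \<integral>\<^sup>+y. (\<integral>\<^sup>+x. U i x \<partial>m y) \<partial>\<nu>)"
    using seq by (intro nn_integral_monotone_convergence_SUP inc) auto
  finally have "(\<integral>\<^sup>+x. (SUP i. U i x) \<partial>\<mu>) = (\<integral>\<^sup>+y. (\<integral>\<^sup>+x. (SUP i. U i x) \<partial>m y) \<partial>\<nu>)"
    using seq by (simp add: e)
  moreover have "(\<lambda>y. \<integral>\<^sup>+x. (SUP i. U i x) \<partial>m y) \<in> borel_measurable \<nu>"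
  proof (rule measurable_cong[THEN iffD1, of _ "\<lambda>y. SUP i. \<integral>\<^sup>+x. U i x \<partial>m y"])
    show "(\<lambda>y. SUP i. \<integral>\<^sup>+x. U i x \<partial>m y) \<in> borel_measurable \<nu>"
      using seq.IH[THEN conjunct1] by measurable
  qed (simp add: e sets_m)
  ultimately show ?case by (simp add: image_comp)
qed

lemma AE_mixture:
  assumes "AE x in \<mu>. P x" shows "AE y in \<nu>. AE x in m y. P x"
proof -
  obtain N where N: "N \<in> null_sets \<mu>" "{x \<in> space \<mu>. \<not> P x} \<subseteq> N"
    using assms by (auto simp: eventually_ae_filter)
  then have "(\<integral>\<^sup>+y. emeasure (m y) N \<partial>\<nu>) = 0" using mixture[of N] by (simp add: null_sets_def)
  then have "AE y in \<nu>. emeasure (m y) N = 0"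
    using kernel_measurable[of N] N by (simp add: nn_integral_0_iff_AE null_setsD2)
  with AE_space show ?thesis
  proof eventually_elim
    case (elim y)
    then have "N \<in> null_sets (m y)" using N sets_m[of y] by auto
    then show ?case using N space_m[of y] elim by (auto simp: eventually_ae_filter)
  qed
qed

text \<open>Where the integral of \<open>f\<close> against \<open>m y\<close> does not exist it has the
  default value 0; the function \<open>F\<close> is a version of it outside a null set, obtained from the
  positive and negative parts.\<close>

lemma integral_mixture_real:
  fixes f :: "'a \<Rightarrow> real"
  assumes f: "integrable \<mu> f"
  obtains F where "integrable \<nu> F" "AE y in \<nu>. integrable (m y) f \<and> (\<integral>x. f x \<partial>m y) = F y"
    "(\<integral>x. f x \<partial>\<mu>) = (\<integral>y. F y \<partial>\<nu>)"
proof -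
  have fm: "f \<in> borel_measurable \<mu>" using f by auto
  define P where "P y = (\<integral>\<^sup>+x. ennreal (f x) \<partial>m y)" for y
  define Q where "Q y = (\<integral>\<^sup>+x. ennreal (- f x) \<partial>m y)" for y
  have P: "P \<in> borel_measurable \<nu>" "(\<integral>\<^sup>+x. ennreal (f x) \<partial>\<mu>) = (\<integral>\<^sup>+y. P y \<partial>\<nu>)"
    and Q: "Q \<in> borel_measurable \<nu>" "(\<integral>\<^sup>+x. ennreal (- f x) \<partial>\<mu>) = (\<integral>\<^sup>+y. Q y \<partial>\<nu>)"
    unfolding P_def Q_def
    using nn_integral_mixture[of "\<lambda>x. ennreal (f x)"] nn_integral_mixture[of "\<lambda>x. ennreal (- f x)"] fm by auto
  have PQfin: "(\<integral>\<^sup>+y. P y \<partial>\<nu>) \<noteq> \<infinity>" "(\<integral>\<^sup>+y. Q y \<partial>\<nu>) \<noteq> \<infinity>"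
    using f P(2) Q(2) by (auto simp: real_integrable_def)
  have aePQ: "AE y in \<nu>. P y \<noteq> \<infinity>" "AE y in \<nu>. Q y \<noteq> \<infinity>"
    using nn_integral_PInf_AE[OF P(1) PQfin(1)] nn_integral_PInf_AE[OF Q(1) PQfin(2)] by auto
  have part: "integrable \<nu> (\<lambda>y. enn2real (S y)) \<and> (\<integral>y. enn2real (S y) \<partial>\<nu>) = enn2real (\<integral>\<^sup>+y. S y \<partial>\<nu>)"
    if S: "S \<in> borel_measurable \<nu>" "(\<integral>\<^sup>+y. S y \<partial>\<nu>) \<noteq> \<infinity>" "AE y in \<nu>. S y \<noteq> \<infinity>" for S
  proof -
    have e: "(\<integral>\<^sup>+y. ennreal (enn2real (S y)) \<partial>\<nu>) = (\<integral>\<^sup>+y. S y \<partial>\<nu>)"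
      by (rule nn_integral_cong_AE) (use S(3) in \<open>eventually_elim, simp add: less_top\<close>)
    have "integrable \<nu> (\<lambda>y. enn2real (S y))"
      using S e by (intro integrableI_bounded) (auto simp: top.not_eq_extremum)
    moreover have "(\<integral>y. enn2real (S y) \<partial>\<nu>) = enn2real (\<integral>\<^sup>+y. S y \<partial>\<nu>)"
      using S(1) e by (subst integral_eq_nn_integral) auto
    ultimately show ?thesis by simp
  qed
  note pP = part[OF P(1) PQfin(1) aePQ(1)] and pQ = part[OF Q(1) PQfin(2) aePQ(2)]
  show ?thesis
  proof (rule that[of "\<lambda>y. enn2real (P y) - enn2real (Q y)"])
    show "integrable \<nu> (\<lambda>y. enn2real (P y) - enn2real (Q y))" using pP pQ by auto
    show "AE y in \<nu>. integrable (m y) f \<and> (\<integral>x. f x \<partial>m y) = enn2real (P y) - enn2real (Q y)"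
      using aePQ AE_space
    proof eventually_elim
      case (elim y)
      then have "integrable (m y) f" using fm by (simp add: real_integrable_def measurable_m P_def Q_def)
      then show ?case using real_lebesgue_integral_def[of "m y" f] by (simp add: P_def Q_def)
    qed
    show "(\<integral>x. f x \<partial>\<mu>) = (\<integral>y. enn2real (P y) - enn2real (Q y) \<partial>\<nu>)"
      unfolding real_lebesgue_integral_def[OF f] P(2) Q(2) using pP pQ by simp
  qed
qed

lemma integral_mixture:
  fixes f :: "'a \<Rightarrow> complex"
  assumes f: "integrable \<mu> f"
  obtains F where "integrable \<nu> F" "AE y in \<nu>. integrable (m y) f \<and> (\<integral>x. f x \<partial>m y) = F y"
    "(\<integral>x. f x \<partial>\<mu>) = (\<integral>y. F y \<partial>\<nu>)"
proof -
  obtain R where R: "integrable \<nu> R" "AE y in \<nu>. integrable (m y) (\<lambda>x. Re (f x)) \<and> (\<integral>x. Re (f x) \<partial>m y) = R y"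
    "(\<integral>x. Re (f x) \<partial>\<mu>) = (\<integral>y. R y \<partial>\<nu>)"
    by (rule integral_mixture_real[OF integrable_Re[OF f]])
  obtain I where I: "integrable \<nu> I" "AE y in \<nu>. integrable (m y) (\<lambda>x. Im (f x)) \<and> (\<integral>x. Im (f x) \<partial>m y) = I y"
    "(\<integral>x. Im (f x) \<partial>\<mu>) = (\<integral>y. I y \<partial>\<nu>)"
    by (rule integral_mixture_real[OF integrable_Im[OF f]])
  have split: "f = (\<lambda>x. of_real (Re (f x)) + \<i> * of_real (Im (f x)))" by (rule ext) (rule complex_eq)
  let ?F = "\<lambda>y. of_real (R y) + \<i> * of_real (I y) :: complex"
  have RI: "integrable \<nu> (\<lambda>y. complex_of_real (R y))" "integrable \<nu> (\<lambda>y. \<i> * complex_of_real (I y))"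
    using R(1) I(1) by (auto intro!: integrable_mult_right integrable_of_real)
  show ?thesis
  proof (rule that[of ?F])
    show "integrable \<nu> ?F" using RI by (rule Bochner_Integration.integrable_add)
    show "AE y in \<nu>. integrable (m y) f \<and> (\<integral>x. f x \<partial>m y) = ?F y"
      using R(2) I(2)
    proof eventually_elim
      case (elim y)
      then have "integrable (m y) f"
        by (subst split, intro Bochner_Integration.integrable_add integrable_mult_right integrable_of_real) auto
      then show ?case using elim by (simp add: complex_eq_iff)
    qed
    show "(\<integral>x. f x \<partial>\<mu>) = (\<integral>y. ?F y \<partial>\<nu>)"
      using f R(3) I(3) by (subst Bochner_Integration.integral_add[OF RI]) (simp add: complex_eq_iff)
  qed
qed

end

text \<open>Reduces integrals of functions which are merely measurable for the completion to those of Borel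
  functions.\<close>

lemma completion_integral_AE:
  fixes f g :: "'a \<Rightarrow> complex"
  assumes eq: "AE x in M. f x = g x" and g: "g \<in> borel_measurable M"
  shows "integrable (completion M) f \<longleftrightarrow> integrable M g" and "(\<integral>x. f x \<partial>completion M) = (\<integral>x. g x \<partial>M)"
proof -
  have eq': "AE x in completion M. f x = g x" using eq by (rule AE_completion)
  have g': "g \<in> borel_measurable (completion M)" using g by (rule measurable_completion)
  have f': "f \<in> borel_measurable (completion M)"
  proof (rule measurableI)
    fix A :: "complex set" assume A: "A \<in> sets borel"
    show "f -` A \<inter> space (completion M) \<in> sets (completion M)"
    proof (rule completion.in_sets_AE)
      show "AE x in completion M. x \<in> g -` A \<inter> space (completion M) \<longleftrightarrow> x \<in> f -` A \<inter> space (completion M)"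
        using eq' by eventually_elim auto
      show "g -` A \<inter> space (completion M) \<in> sets (completion M)" using g' A by (rule measurable_sets)
    qed simp
  qed simp
  have "integrable (completion M) f \<longleftrightarrow> integrable (completion M) g"
    by (rule integrable_cong_AE[OF f' g' eq'])
  then show "integrable (completion M) f \<longleftrightarrow> integrable M g" using integrable_completion[OF g] by simp
  have "(\<integral>x. f x \<partial>completion M) = (\<integral>x. g x \<partial>completion M)"
    by (rule integral_cong_AE[OF f' g' eq'])
  then show "(\<integral>x. f x \<partial>completion M) = (\<integral>x. g x \<partial>M)" using integral_completion[OF g] by simp
qed

lemma completion_ex_borel_measurable_complex:
  fixes f :: "'a \<Rightarrow> complex"
  assumes "f \<in> borel_measurable (completion M)"
  obtains g where "g \<in> borel_measurable M" "AE x in M. f x = g x"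
proof -
  obtain u where u: "u \<in> borel_measurable M" "AE x in M. Re (f x) = u x"
    using completion_ex_borel_measurable_real[of "\<lambda>x. Re (f x)" M] assms by auto
  obtain v where v: "v \<in> borel_measurable M" "AE x in M. Im (f x) = v x"
    using completion_ex_borel_measurable_real[of "\<lambda>x. Im (f x)" M] assms by auto
  show ?thesis
  proof (rule that)
    show "(\<lambda>x. of_real (u x) + \<i> * of_real (v x)) \<in> borel_measurable M" using u(1) v(1) by measurable
    show "AE x in M. f x = of_real (u x) + \<i> * of_real (v x)"
      using u(2) v(2) by eventually_elim (metis complex_eq)
  qed
qed

lemma cm_integral_of_positive: "cm_integral (of_positive M) f = (\<integral>x. f x \<partial>completion M)"
  by (simp add: cm_integral_def of_positive_def)

lemma cm_integral_of_positive_borel: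
  "f \<in> borel_measurable M \<Longrightarrow> cm_integral (of_positive M) f = (\<integral>x. f x \<partial>M)"
  by (simp add: cm_integral_of_positive integral_completion)

text \<open>Borel functions are handled by \<open>integral_mixture\<close>, and null sets of
  \<open>\<mu>\<close> are null sets of almost every \<open>m y\<close>, which covers functions on the
  completion. The delicate point is that a set \<open>N\<close> with null preimage is null: a Borel null set
  \<open>A\<close> containing the preimage need not be a union of fibres.\<close>

lemma (in measure_mixture) disintegration_of_mixture:
  assumes X: "topspace X = space \<mu>" and Y: "topspace Y = space \<nu>"
    and p: "p \<in> \<mu> \<rightarrow>\<^sub>M \<nu>"
    and radon: "\<And>y. y \<in> space \<nu> \<Longrightarrow> radon_measure X (m y)"
    and fibre: "\<And>y. y \<in> space \<nu> \<Longrightarrow> {x \<in> space \<mu>. p x \<noteq> y} \<in> null_sets (m y)"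
    and mass: "\<And>y. y \<in> space \<nu> \<Longrightarrow> emeasure (m y) (space \<mu>) = c" and c: "c \<noteq> 0" "c \<noteq> \<infinity>"
  shows "pseudo_image_measure X Y p (of_positive \<mu>) (of_positive \<nu>)"
    and "disintegration X Y p (of_positive \<mu>) (of_positive \<nu>) (\<lambda>y. of_positive (m y))"
proof -
  show pseudo: "pseudo_image_measure X Y p (of_positive \<mu>) (of_positive \<nu>)"
    unfolding pseudo_image_measure_def cm_negligible_def of_positive_def fst_conv X Y
  proof (intro allI impI iffI)
    fix N assume N: "N \<subseteq> space \<nu>"
    { assume "N \<in> null_sets (completion \<nu>)"
      then obtain N' where N': "N' \<in> null_sets \<nu>" "N \<subseteq> N'" by (auto simp: null_sets_completion_iff2)
      let ?A = "p -` N' \<inter> space \<mu>"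
      have A: "?A \<in> sets \<mu>" using p N' by (auto intro: measurable_sets)
      have "AE y in \<nu>. emeasure (m y) ?A = 0"
        using AE_not_in[OF N'(1)] AE_space
      proof eventually_elim
        case (elim y)
        then have "?A \<subseteq> {x \<in> space \<mu>. p x \<noteq> y}" by auto
        then show ?case using fibre[of y] elim A sets_m[of y]
          by (intro null_setsD1[OF null_sets_subset]) auto
      qed
      then have "emeasure \<mu> ?A = 0"
        unfolding mixture[OF A] using kernel_measurable[OF A] by (simp add: nn_integral_0_iff_AE)
      then have "?A \<in> null_sets \<mu>" using A by auto
      moreover have "{x \<in> space \<mu>. p x \<in> N} \<subseteq> ?A" using N'(2) by auto
      ultimately show "{x \<in> space \<mu>. p x \<in> N} \<in> null_sets (completion \<mu>)"
        by (intro null_sets_completion_subset[OF _ null_sets_completionI]) }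
    { assume "{x \<in> space \<mu>. p x \<in> N} \<in> null_sets (completion \<mu>)"
      then obtain A where A: "A \<in> null_sets \<mu>" "{x \<in> space \<mu>. p x \<in> N} \<subseteq> A"
        by (auto simp: null_sets_completion_iff2)
      \<comment> \<open>The fibre over a point of \<open>N\<close> carries the whole mass of its measure, and lies in \<open>A\<close>.\<close>
      let ?N = "{y \<in> space \<nu>. c \<le> emeasure (m y) A}"
      have Am: "A \<in> sets \<mu>" using A by auto
      have "(\<integral>\<^sup>+y. emeasure (m y) A \<partial>\<nu>) = 0" using mixture[OF Am] A by (simp add: null_sets_def)
      then have "AE y in \<nu>. emeasure (m y) A = 0"
        using kernel_measurable[OF Am] by (simp add: nn_integral_0_iff_AE)
      then have "AE y in \<nu>. y \<notin> ?N"
        by eventually_elim (use c in auto)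
      moreover have "?N \<in> sets \<nu>" using kernel_measurable[OF Am] by measurable
      ultimately have "?N \<in> null_sets \<nu>" by (simp add: AE_iff_null_sets)
      moreover have "N \<subseteq> ?N"
      proof
        fix y assume y: "y \<in> N"
        then have y': "y \<in> space \<nu>" using N by auto
        have "c = emeasure (m y) (space (m y) - {x \<in> space \<mu>. p x \<noteq> y})"
          using emeasure_Diff_null_set[OF fibre[OF y'] sets.top] mass[OF y'] space_m[OF y'] by simp
        also have "\<dots> \<le> emeasure (m y) A"
          by (rule emeasure_mono) (use A y y' Am sets_m[OF y'] space_m[OF y'] in auto)
        finally show "y \<in> ?N" using y' by simp
      qed
      ultimately show "N \<in> null_sets (completion \<nu>)"
        by (intro null_sets_completion_subset[OF _ null_sets_completionI]) }
  qed
  show "disintegration X Y p (of_positive \<mu>) (of_positive \<nu>) (\<lambda>y. of_positive (m y))"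
    unfolding disintegration_def
  proof (intro conjI ballI allI impI)
    show "weak_pseudo_image_measure X Y p (of_positive \<mu>) (of_positive \<nu>)"
      using pseudo by (simp add: pseudo_image_measure_def weak_pseudo_image_measure_def)
    show "complex_radon_measure X (of_positive (m y))" if "y \<in> topspace Y" for y
      using radon that Y by (simp add: complex_radon_measure_def of_positive_def)
    show "AE y in fst (of_positive \<nu>). cm_negligible (of_positive (m y)) {x \<in> topspace X. p x \<noteq> y}"
      using fibre by (auto simp: of_positive_def cm_negligible_def X intro!: AE_I2 null_sets_completionI)
    fix f :: "'a \<Rightarrow> complex" assume "cm_integrable (of_positive \<mu>) f"
    then have f: "integrable (completion \<mu>) f" by (simp add: cm_integrable_def of_positive_def)
    then obtain g where g: "g \<in> borel_measurable \<mu>" "AE x in \<mu>. f x = g x"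
      by (metis completion_ex_borel_measurable_complex borel_measurable_integrable)
    have gi: "integrable \<mu> g" using f completion_integral_AE(1)[OF g(2,1)] by simp
    obtain G where G: "integrable \<nu> G" "AE y in \<nu>. integrable (m y) g \<and> (\<integral>x. g x \<partial>m y) = G y"
      "(\<integral>x. g x \<partial>\<mu>) = (\<integral>y. G y \<partial>\<nu>)"
      by (rule integral_mixture[OF gi])
    have ae: "AE y in \<nu>. integrable (completion (m y)) f \<and> (\<integral>x. f x \<partial>completion (m y)) = G y"
      using AE_mixture[OF g(2)] G(2) AE_space
    proof eventually_elim
      case (elim y)
      have "g \<in> borel_measurable (m y)" using elim by auto
      with elim show ?case using completion_integral_AE[of f g "m y"] by simp
    qed
    then have ae2: "AE y in \<nu>. cm_integral (of_positive (m y)) f = G y"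
      by (simp add: cm_integral_of_positive)
    show "AE y in fst (of_positive \<nu>). cm_integrable (of_positive (m y)) f"
      using ae unfolding of_positive_def cm_integrable_def fst_conv by eventually_elim simp
    have gm: "G \<in> borel_measurable \<nu>" using G(1) by auto
    show "cm_integrable (of_positive \<nu>) (\<lambda>y. cm_integral (of_positive (m y)) f)"
      using completion_integral_AE(1)[OF ae2 gm] G(1) by (simp add: of_positive_def cm_integrable_def)
    show "cm_integral (of_positive \<mu>) f = cm_integral (of_positive \<nu>) (\<lambda>y. cm_integral (of_positive (m y)) f)"
      using completion_integral_AE(2)[OF ae2 gm] G(3) completion_integral_AE(2)[OF g(2,1)]
      by (simp add: cm_integral_of_positive[of \<mu>] cm_integral_of_positive[of \<nu>])
  qed
qed


section \<open>The quotient by the circle action\<close>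

lemma circle_orbit_self: "\<zeta> \<in> circle_orbit \<zeta>"
  unfolding circle_orbit_def by (auto intro!: exI[of _ 1])

lemma circle_orbit_eqD:
  "circle_orbit \<zeta>' = circle_orbit \<zeta> \<Longrightarrow> \<exists>\<alpha>. cmod \<alpha> = 1 \<and> \<zeta>' = \<alpha> *s \<zeta>"
  using circle_orbit_self[of \<zeta>'] by (auto simp: circle_orbit_def)

lemma circle_orbit_rotate:
  assumes "cmod \<alpha> = 1" shows "circle_orbit (\<alpha> *s \<zeta>) = circle_orbit \<zeta>"
proof
  show "circle_orbit (\<alpha> *s \<zeta>) \<subseteq> circle_orbit \<zeta>"
  proof
    fix x assume "x \<in> circle_orbit (\<alpha> *s \<zeta>)"
    then obtain \<gamma> where "cmod \<gamma> = 1" "x = (\<gamma> * \<alpha>) *s \<zeta>" by (auto simp: circle_orbit_def)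
    then show "x \<in> circle_orbit \<zeta>" using assms by (auto simp: circle_orbit_def norm_mult intro!: exI[of _ "\<gamma> * \<alpha>"])
  qed
  show "circle_orbit \<zeta> \<subseteq> circle_orbit (\<alpha> *s \<zeta>)"
  proof
    fix x assume "x \<in> circle_orbit \<zeta>"
    then obtain \<gamma> where \<gamma>: "cmod \<gamma> = 1" "x = \<gamma> *s \<zeta>" by (auto simp: circle_orbit_def)
    have "x = (\<gamma> * cnj \<alpha>) *s (\<alpha> *s \<zeta>)"
      using mult_cnj_sphere[OF assms] by (simp add: \<gamma> mult.assoc mult.commute[of "cnj \<alpha>"])
    then show "x \<in> circle_orbit (\<alpha> *s \<zeta>)"
      using assms \<gamma> unfolding circle_orbit_def by (auto simp: norm_mult intro!: exI[of _ "\<gamma> * cnj \<alpha>"])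
  qed
qed

lemma compact_circle_orbit: "compact (circle_orbit (\<zeta>::complex^'n))"
proof -
  have "circle_orbit \<zeta> = (\<lambda>\<alpha>. \<alpha> *s \<zeta>) ` sphere 0 1" by (auto simp: circle_orbit_def)
  then show ?thesis by (auto intro!: compact_continuous_image continuous_intros)
qed

lemma topspace_hat_boundary: "topspace (hat_boundary B) = circle_orbit ` B"
proof
  show "topspace (hat_boundary B) \<subseteq> circle_orbit ` B"
    using openin_topspace[of "hat_boundary B"] unfolding hat_boundary_def openin_quotient_topology by simp
  have "{x \<in> B. circle_orbit x \<in> circle_orbit ` B} = B" by auto
  then have "openin (hat_boundary B) (circle_orbit ` B)"
    unfolding hat_boundary_def openin_quotient_topology by (auto simp: openin_subtopology_refl)
  then show "circle_orbit ` B \<subseteq> topspace (hat_boundary B)" by (rule openin_subset)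
qed

lemma continuous_map_hat_boundary:
  fixes f :: "(complex^'n) set \<Rightarrow> complex"
  assumes "continuous_on B (\<lambda>\<zeta>. f (circle_orbit \<zeta>))"
  shows "continuous_map (hat_boundary B) euclidean f"
  unfolding continuous_map_def
proof (intro conjI allI impI)
  fix U :: "complex set" assume "openin euclidean U"
  then have "openin (top_of_set B) (B \<inter> (\<lambda>\<zeta>. f (circle_orbit \<zeta>)) -` U)"
    by (intro continuous_openin_preimage_gen[OF assms]) simp
  moreover have "{x \<in> B. circle_orbit x \<in> {y \<in> circle_orbit ` B. f y \<in> U}} = B \<inter> (\<lambda>\<zeta>. f (circle_orbit \<zeta>)) -` U"
    by auto
  ultimately show "openin (hat_boundary B) {x \<in> topspace (hat_boundary B). f x \<in> U}"
    unfolding topspace_hat_boundary unfolding hat_boundary_def openin_quotient_topology by auto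
qed simp

lemma space_borel_of: "space (borel_of X) = topspace X"
  unfolding borel_of_def by (subst space_measure_of) (auto dest: openin_subset)

lemma openin_sets_borel_of: "openin X U \<Longrightarrow> U \<in> sets (borel_of X)"
  unfolding borel_of_def by (subst sets_measure_of) (auto dest: openin_subset)

lemma continuous_map_borel_of:
  fixes f :: "'a \<Rightarrow> 'b::topological_space"
  assumes "continuous_map X euclidean f" shows "f \<in> borel_measurable (borel_of X)"
proof (rule borel_measurableI)
  fix U :: "'b set" assume "open U"
  then have "openin X {x \<in> topspace X. f x \<in> U}" using assms by (simp add: continuous_map_def)
  moreover have "f -` U \<inter> space (borel_of X) = {x \<in> topspace X. f x \<in> U}" by (auto simp: space_borel_of)
  ultimately show "f -` U \<inter> space (borel_of X) \<in> sets (borel_of X)" by (simp add: openin_sets_borel_of)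
qed

lemma measurable_circle_orbit:
  fixes M :: "(complex^'n) measure"
  assumes M: "finite_measure_on B M"
  shows "circle_orbit \<in> M \<rightarrow>\<^sub>M borel_of (hat_boundary B)"
  unfolding borel_of_def
proof (rule measurable_measure_of)
  have space_beta: "space M = B" by (rule finite_measure_on_space[OF M])
  show "{U. openin (hat_boundary B) U} \<subseteq> Pow (topspace (hat_boundary B))" by (auto dest: openin_subset)
  show "circle_orbit \<in> space M \<rightarrow> topspace (hat_boundary B)" by (auto simp: space_beta topspace_hat_boundary)
  fix U assume "U \<in> {U. openin (hat_boundary B) U}"
  then have "openin (top_of_set B) {x \<in> B. circle_orbit x \<in> U}"
    unfolding hat_boundary_def openin_quotient_topology by simp
  then obtain T where "open T" "{x \<in> B. circle_orbit x \<in> U} = B \<inter> T" by (auto simp: openin_open)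
  moreover have "circle_orbit -` U \<inter> space M = {x \<in> B. circle_orbit x \<in> U}" by (auto simp: space_beta)
  ultimately show "circle_orbit -` U \<inter> space M \<in> sets M"
    using M by (auto simp: finite_measure_on_def sets_restrict_space)
qed

lemma radon_measureI:
  fixes B :: "'a::t2_space set"
  assumes M: "finite_measure_on B M" shows "radon_measure (top_of_set B) M"
proof -
  interpret finite_measure M using M by (simp add: finite_measure_on_def)
  show ?thesis
    using M finite_measure_on_space[OF M] sets_borel_of_subspace[of B]
    by (auto simp: radon_measure_def finite_measure_on_def compact_imp_closed less_top[symmetric])
qed

section \<open>The boundary measures of a positive pluriharmonic measure\<close>

text \<open>The shape of the bounds provided by \<open>approximate_identity_bound\<close>: first
  \<open>\<epsilon>\<close> is chosen, then the radius.\<close>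

lemma uniform_limit_from_bound:
  fixes f :: "nat \<Rightarrow> 'a \<Rightarrow> complex"
  assumes c: "0 \<le> c" and bound: "\<And>\<epsilon>. 0 < \<epsilon> \<Longrightarrow> \<exists>L\<ge>0. \<forall>k. \<forall>x\<in>S. norm (f k x - l x) \<le> c * (\<epsilon> + L * (2 - 2 * radius k))"
  shows "uniform_limit S f l sequentially"
proof (rule uniform_limitI)
  fix e :: real assume e: "0 < e"
  define \<epsilon> where "\<epsilon> = e / (2 * (c + 1))"
  have \<epsilon>: "0 < \<epsilon>" using e c by (simp add: \<epsilon>_def)
  have c\<epsilon>: "c * \<epsilon> < e"
  proof -
    have "c * \<epsilon> \<le> (c + 1) * \<epsilon>" using \<epsilon> by simp
    also have "\<dots> = e / 2" using c by (simp add: \<epsilon>_def field_simps)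
    finally show ?thesis using e by simp
  qed
  from bound[OF \<epsilon>] obtain L where L: "\<forall>k. \<forall>x\<in>S. norm (f k x - l x) \<le> c * (\<epsilon> + L * (2 - 2 * radius k))"
    by (elim exE conjE)
  have "(\<lambda>k. c * (\<epsilon> + L * (2 - 2 * radius k))) \<longlonglongrightarrow> c * (\<epsilon> + L * (2 - 2 * 1))"
    by (intro tendsto_intros radius_tendsto)
  then have "\<forall>\<^sub>F k in sequentially. c * (\<epsilon> + L * (2 - 2 * radius k)) < e"
    using c\<epsilon> by (intro order_tendstoD(2)) auto
  then show "\<forall>\<^sub>F k in sequentially. \<forall>x\<in>S. dist (f k x) (l x) < e"
  proof eventually_elim
    case (elim k)
    show ?case
    proof
      fix x assume "x \<in> S"
      then have "norm (f k x - l x) \<le> c * (\<epsilon> + L * (2 - 2 * radius k))" using L by simp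
      then show "dist (f k x) (l x) < e" using elim by (simp add: dist_norm)
    qed
  qed
qed

lemma limit_from_bound:
  fixes a :: "nat \<Rightarrow> complex"
  assumes c: "0 \<le> c" and bound: "\<And>\<epsilon>. 0 < \<epsilon> \<Longrightarrow> \<exists>L\<ge>0. \<forall>k. norm (a k - l) \<le> c * (\<epsilon> + L * (2 - 2 * radius k))"
  shows "a \<longlonglongrightarrow> l"
  using tendsto_uniform_limitI[OF uniform_limit_from_bound[OF c, of UNIV "\<lambda>k x. a k" "\<lambda>x::unit. l"]] bound by simp

lemma continuous_disc_poisson_joint:
  assumes r: "0 \<le> r" "r < 1"
  shows "continuous_on (sphere 0 1 \<times> sphere 0 1) (\<lambda>q. disc_poisson (of_real r * snd q) (fst q))"
  unfolding disc_poisson_def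
proof (intro continuous_intros ballI)
  fix q :: "complex \<times> complex" assume "q \<in> sphere 0 1 \<times> sphere 0 1"
  then have "cmod (fst q) = 1" "cmod (of_real r * snd q) < 1"
    using dilation_in_disc[OF r, of "snd q"] by auto
  then show "(cmod (fst q - of_real r * snd q))\<^sup>2 \<noteq> 0" by auto
qed

locale pluriharmonic_setting = szego_setting D bD \<beta> C
  for D bD :: "(complex ^ 'n) set" and \<beta> :: "(complex ^ 'n) measure" and C +
  fixes \<mu> :: "(complex ^ 'n) measure"
  assumes fin_\<mu>: "finite_measure_on bD \<mu>" and nonzero: "emeasure \<mu> bD \<noteq> 0"
    and pluriharmonic: "pluriharmonic_measure D C (of_positive \<mu>)"
begin

abbreviation u :: "complex^'n \<Rightarrow> complex" where
  "u \<equiv> poisson_integral D C (of_positive \<mu>)"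

text \<open>The value at \<open>r \<zeta>\<close> of the Poisson-Szego integral of
  \<open>\<mu>\<close>.\<close>

definition radial_value :: "real \<Rightarrow> complex^'n \<Rightarrow> real" where
  "radial_value r \<zeta> = (\<integral>\<eta>. radial_poisson r \<zeta> \<eta> \<partial>\<mu>)"

definition total_mass :: real where "total_mass = measure \<mu> bD"

lemma sp_\<mu>: "space \<mu> = bD" by (rule finite_measure_on_space[OF fin_\<mu>])

lemma total_mass_emeasure: "emeasure \<mu> bD = ennreal total_mass"
  using fin_\<mu> unfolding total_mass_def finite_measure_on_def by (intro finite_measure.emeasure_eq_measure) auto

lemma total_mass_pos: "0 < total_mass"
  using nonzero total_mass_emeasure by (metis total_mass_def ennreal_0 measure_nonneg order_le_less)

lemma continuous_radial_poisson_slice: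
  assumes "0 \<le> r" "r < 1" "\<zeta> \<in> bD" shows "continuous_on bD (\<lambda>\<eta>. radial_poisson r \<zeta> \<eta>)"
  using assms by (intro continuous_on_compose2[OF continuous_radial_poisson[OF assms(1,2)], of bD "\<lambda>\<eta>. (\<zeta>, \<eta>)", simplified])
    (auto intro!: continuous_intros)

lemma poisson_integral_radial:
  assumes \<zeta>: "\<zeta> \<in> bD" and r: "0 \<le> r" "r < 1" shows "u (r *\<^sub>R \<zeta>) = of_real (radial_value r \<zeta>)"
proof -
  have "u (r *\<^sub>R \<zeta>) = (\<integral>\<eta>. of_real (radial_poisson r \<zeta> \<eta>) \<partial>completion \<mu>)"
    unfolding poisson_integral_def cm_integral_of_positive
    by (rule Bochner_Integration.integral_cong)
       (auto simp: sp_\<mu> poisson_szego_radial[OF r _ \<zeta>] radial_poisson_symmetric[OF r _ \<zeta>])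
  also have "\<dots> = (\<integral>\<eta>. complex_of_real (radial_poisson r \<zeta> \<eta>) \<partial>\<mu>)"
    by (intro integral_completion borel_measurable_continuous[OF fin_\<mu>] continuous_intros continuous_radial_poisson_slice r \<zeta>)
  finally show ?thesis by (simp add: radial_value_def)
qed

lemma radial_value_nonneg: "0 \<le> r \<Longrightarrow> r < 1 \<Longrightarrow> 0 \<le> radial_value r \<zeta>"
  unfolding radial_value_def by (intro integral_nonneg_AE AE_I2 radial_poisson_nonneg) (auto simp: sp_\<mu>)

lemma radial_value_zero: assumes "\<zeta> \<in> bD" shows "radial_value 0 \<zeta> = total_mass"
proof -
  have "radial_value 0 \<zeta> = (\<integral>\<eta>. 1 \<partial>\<mu>)"
    unfolding radial_value_def by (rule Bochner_Integration.integral_cong) (auto simp: sp_\<mu> radial_poisson_zero assms)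
  then show ?thesis by (simp add: total_mass_def sp_\<mu>)
qed

lemma continuous_radial_value: assumes r: "0 \<le> r" "r < 1" shows "continuous_on bD (radial_value r)"
  unfolding radial_value_def
  by (rule continuous_on_integral_parameter[OF fin_\<mu> bD_compact, of "\<lambda>\<eta> \<zeta>. radial_poisson r \<zeta> \<eta>"])
     (rule continuous_on_compose2[OF continuous_radial_poisson[OF r], of _ "\<lambda>q. (snd q, fst q)", simplified],
      auto intro!: continuous_intros)

text \<open>The properties required of the measure on the orbit of \<open>\<zeta>\<close>. By the last one,
  its integrals are limits of circle means at a rate which does not depend on \<open>\<zeta>\<close>; this is
  what gives continuity in \<open>\<zeta>\<close>.\<close>

definition boundary_measure :: "complex^'n \<Rightarrow> (complex^'n) measure \<Rightarrow> bool" where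
  "boundary_measure \<zeta> m \<longleftrightarrow> finite_measure_on bD m \<and> emeasure m bD = ennreal total_mass \<and>
    emeasure m (bD - circle_orbit \<zeta>) = 0 \<and>
    (\<forall>w. cmod w < 1 \<longrightarrow> u (w *s \<zeta>) = (\<integral>x. of_real ((1 - (norm (w *s \<zeta>))\<^sup>2) / (norm (x - w *s \<zeta>))\<^sup>2) \<partial>m)) \<and>
    (\<forall>(g::complex^'n \<Rightarrow> complex) \<epsilon> L r. continuous_on bD g \<longrightarrow> (\<forall>x\<in>bD. \<forall>y\<in>bD. norm (g x - g y) \<le> \<epsilon> + L * (dist x y)\<^sup>2) \<longrightarrow> 0 \<le> L \<longrightarrow>
      0 \<le> r \<longrightarrow> r < 1 \<longrightarrow>
      norm ((\<integral>\<kappa>. g (\<kappa> *s \<zeta>) * of_real (radial_value r (\<kappa> *s \<zeta>)) \<partial>arc_measure) - (\<integral>x. g x \<partial>m)) \<le> total_mass * (\<epsilon> + L * (2 - 2 * r)))"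

text \<open>The image under \<open>\<kappa> \<mapsto> \<kappa> \<zeta>\<close> of the Herglotz measure of the
  disc through \<open>\<zeta>\<close>. As this map is an isometry on the circle, \<open>g\<close> and its
  composition with it share the same modulus of continuity, so that the bound is uniform in
  \<open>\<zeta>\<close>.\<close>

lemma boundary_measure_exists:
  assumes \<zeta>: "\<zeta> \<in> bD" shows "\<exists>m. boundary_measure \<zeta> m"
proof -
  have n\<zeta>: "norm \<zeta> = 1" using \<zeta> bD_sphere by auto
  then have "\<zeta> \<noteq> 0" by auto
  then have "harmonic_fun_on {w. 0 + w *s \<zeta> \<in> D} (\<lambda>w. u (0 + w *s \<zeta>))"
    using pluriharmonic unfolding pluriharmonic_measure_def pluriharmonic_on_def by blast
  then have "harmonic_fun_on {w. w *s \<zeta> \<in> D} (\<lambda>w. u (w *s \<zeta>))" by simp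
  moreover have "ball 0 1 \<subseteq> {w. w *s \<zeta> \<in> D}" using disc_in_D[OF \<zeta>] by auto
  ultimately obtain F where F: "F holomorphic_on ball 0 1" and ReF: "\<And>w. w \<in> ball 0 1 \<Longrightarrow> Re (u (w *s \<zeta>)) = Re (F w)"
    using harmonic_imp_Re_holomorphic[of _ _ "ball 0 1"] by (metis convex_ball open_ball)
  \<comment> \<open>The circle of radius \<open>r\<close> in the disc through \<open>\<zeta>\<close> is the dilation by \<open>r\<close> of the orbit of \<open>\<zeta>\<close>.\<close>
  have FU: "Re (F (of_real r * \<alpha>)) = radial_value r (\<alpha> *s \<zeta>)" if "0 \<le> r" "r < 1" "cmod \<alpha> = 1" for r \<alpha>
  proof -
    have "cmod (of_real r * \<alpha>) < 1" using that by (simp add: norm_mult)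
    then have "Re (F (of_real r * \<alpha>)) = Re (u ((of_real r * \<alpha>) *s \<zeta>))" using ReF by simp
    also have "(of_real r * \<alpha>) *s \<zeta> = r *\<^sub>R (\<alpha> *s \<zeta>)" by (simp flip: of_real_smult)
    finally show ?thesis using poisson_integral_radial[OF rotate_bD[OF \<zeta> that(3)] that(1,2)] by simp
  qed
  have uF: "u (w *s \<zeta>) = of_real (Re (F w))" if w: "cmod w < 1" for w
  proof -
    obtain r \<alpha> where r: "0 \<le> r" "r < 1" "cmod \<alpha> = 1" "w *s \<zeta> = r *\<^sub>R (\<alpha> *s \<zeta>)" "w = of_real r * \<alpha>"
      using polar[OF w] by metis
    show ?thesis unfolding r(4) poisson_integral_radial[OF rotate_bD[OF \<zeta> r(3)] r(1,2)]
      using FU[OF r(1,2,3)] r(5) by simp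
  qed
  have F0: "Re (F 0) = total_mass" using FU[of 0 1] radial_value_zero[OF \<zeta>] by simp
  have nn: "0 \<le> Re (F w)" if w: "cmod w < 1" for w
  proof -
    obtain r \<alpha> where r: "0 \<le> r" "r < 1" "cmod \<alpha> = 1" "w = of_real r * \<alpha>" using polar[OF w] by metis
    show ?thesis unfolding r(4) FU[OF r(1,2,3)] by (rule radial_value_nonneg[OF r(1,2)])
  qed
  obtain m0 where m0: "finite_measure_on (sphere 0 1) m0" "emeasure m0 (sphere 0 1) = ennreal total_mass"
    and P0: "\<And>w. cmod w < 1 \<Longrightarrow> (\<integral>\<kappa>. disc_poisson w \<kappa> \<partial>m0) = Re (F w)"
    using Herglotz[OF F nn] total_mass_pos unfolding F0 by metis
  have sp0: "space m0 = sphere 0 1" by (rule finite_measure_on_space[OF m0(1)])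
  have meas: "(\<lambda>\<kappa>. \<kappa> *s \<zeta>) \<in> m0 \<rightarrow>\<^sub>M restrict_space borel bD"
    by (rule measurable_restrict_space2)
       (auto simp: sp0 intro!: rotate_bD \<zeta> borel_measurable_continuous[OF m0(1)] continuous_intros)
  define m where "m = distr m0 (restrict_space borel bD) (\<lambda>\<kappa>. \<kappa> *s \<zeta>)"
  have int_m: "(\<integral>x. g x \<partial>m) = (\<integral>\<kappa>. g (\<kappa> *s \<zeta>) \<partial>m0)" if "continuous_on bD g" for g :: "complex^'n \<Rightarrow> complex"
    unfolding m_def by (rule integral_distr[OF meas borel_measurable_continuous_on_restrict[OF that]])
  have pre: "(\<lambda>\<kappa>. \<kappa> *s \<zeta>) -` bD \<inter> space m0 = sphere 0 1" using rotate_bD[OF \<zeta>] by (auto simp: sp0)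
  have bDs: "bD \<in> sets (restrict_space borel bD)" using bD_closed by (auto simp: sets_restrict_space)
  have em: "emeasure m bD = ennreal total_mass"
    unfolding m_def emeasure_distr[OF meas bDs] pre by (rule m0(2))
  have spm: "space m = bD" by (simp add: m_def space_restrict_space)
  have fm: "finite_measure_on bD m"
    unfolding finite_measure_on_def using em spm bD_compact by (auto simp: m_def intro!: finite_measureI)
  have conc: "emeasure m (bD - circle_orbit \<zeta>) = 0"
  proof -
    have "closed (circle_orbit \<zeta>)" by (rule compact_imp_closed[OF compact_circle_orbit])
    then have "bD - circle_orbit \<zeta> \<in> sets (restrict_space borel bD)"
      using bD_closed by (auto simp: sets_restrict_space image_iff intro!: bexI[of _ "bD - circle_orbit \<zeta>"])
    moreover have "(\<lambda>\<kappa>. \<kappa> *s \<zeta>) -` (bD - circle_orbit \<zeta>) \<inter> space m0 = {}"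
      by (auto simp: sp0 circle_orbit_def)
    ultimately show ?thesis unfolding m_def by (subst emeasure_distr[OF meas]) auto
  qed
  have dist_rot: "norm (\<kappa> *s \<zeta> - \<alpha> *s \<zeta>) = cmod (\<kappa> - \<alpha>)" for \<kappa> \<alpha>
  proof -
    have eq: "\<kappa> *s \<zeta> - \<alpha> *s \<zeta> = (\<kappa> - \<alpha>) *s \<zeta>" by (simp add: vec_eq_iff algebra_simps)
    show ?thesis unfolding eq norm_smult n\<zeta> by simp
  qed
  have formula: "u (w *s \<zeta>) = (\<integral>x. of_real ((1 - (norm (w *s \<zeta>))\<^sup>2) / (norm (x - w *s \<zeta>))\<^sup>2) \<partial>m)" if w: "cmod w < 1" for w
  proof -
    have "continuous_on bD (\<lambda>x. complex_of_real ((1 - (norm (w *s \<zeta>))\<^sup>2) / (norm (x - w *s \<zeta>))\<^sup>2))"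
    proof (intro continuous_intros ballI)
      fix x assume "x \<in> bD"
      then have "norm x = 1" using bD_sphere by auto
      moreover have "norm (w *s \<zeta>) < 1" using w by (simp add: norm_smult n\<zeta>)
      ultimately show "(norm (x - w *s \<zeta>))\<^sup>2 \<noteq> 0" by auto
    qed
    then have "(\<integral>x. of_real ((1 - (norm (w *s \<zeta>))\<^sup>2) / (norm (x - w *s \<zeta>))\<^sup>2) \<partial>m)
        = (\<integral>\<kappa>. complex_of_real (disc_poisson w \<kappa>) \<partial>m0)"
      by (subst int_m) (auto simp: dist_rot disc_poisson_def norm_smult n\<zeta>)
    then show ?thesis using P0[OF w] uF[OF w] by simp
  qed
  have approx: "norm ((\<integral>\<kappa>. g (\<kappa> *s \<zeta>) * of_real (radial_value r (\<kappa> *s \<zeta>)) \<partial>arc_measure) - (\<integral>x. g x \<partial>m)) \<le> total_mass * (\<epsilon> + L * (2 - 2 * r))"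
    if g: "continuous_on bD g" "\<forall>x\<in>bD. \<forall>y\<in>bD. norm (g x - g y) \<le> \<epsilon> + L * (dist x y)\<^sup>2" "0 \<le> L"
      and r: "0 \<le> r" "r < 1" for g :: "complex^'n \<Rightarrow> complex" and \<epsilon> L r
  proof -
    have "norm ((\<integral>\<kappa>. g (\<kappa> *s \<zeta>) * of_real (\<integral>\<alpha>. disc_poisson (of_real r * \<alpha>) \<kappa> \<partial>m0) \<partial>arc_measure) - (\<integral>\<kappa>. g (\<kappa> *s \<zeta>) \<partial>m0))
        \<le> measure m0 (sphere 0 1) * (\<epsilon> + L * (2 - 2 * r))"
    proof (rule approximate_identity_bound[OF finite_arc m0(1)])
      show "continuous_on (sphere 0 1 \<times> sphere 0 1) (\<lambda>q. disc_poisson (of_real r * snd q) (fst q))"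
        by (rule continuous_disc_poisson_joint[OF r])
      fix y :: complex assume "y \<in> sphere 0 1"
      then have y: "cmod y = 1" by simp
      then have ry: "cmod (of_real r * y) < 1" using dilation_in_disc[OF r] by simp
      show "0 \<le> disc_poisson (of_real r * y) x" for x by (rule disc_poisson_nonneg[OF ry])
      show "(\<integral>x. disc_poisson (of_real r * y) x \<partial>arc_measure) = 1" by (rule disc_poisson_mass[OF ry])
      show "(\<integral>x. (dist x y)\<^sup>2 * disc_poisson (of_real r * y) x \<partial>arc_measure) \<le> 2 - 2 * r"
        using disc_poisson_spread[OF r y] by simp
      fix x :: complex assume "x \<in> sphere 0 1"
      then have "x *s \<zeta> \<in> bD" "y *s \<zeta> \<in> bD" using rotate_bD[OF \<zeta>] y by auto
      moreover have "dist (x *s \<zeta>) (y *s \<zeta>) = dist x y" by (simp add: dist_norm dist_rot)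
      ultimately show "norm (g (x *s \<zeta>) - g (y *s \<zeta>)) \<le> \<epsilon> + L * (dist x y)\<^sup>2" using g(2) by metis
    next
      show "continuous_on (sphere 0 1) (\<lambda>\<kappa>. g (\<kappa> *s \<zeta>))"
        by (rule continuous_on_compose2[OF g(1)]) (auto intro!: continuous_intros rotate_bD \<zeta>)
    qed (rule g(3))
    moreover have "measure m0 (sphere 0 1) = total_mass" using m0(2) total_mass_pos by (simp add: measure_def)
    moreover have "(\<integral>\<alpha>. disc_poisson (of_real r * \<alpha>) \<kappa> \<partial>m0) = radial_value r (\<kappa> *s \<zeta>)" if \<kappa>: "cmod \<kappa> = 1" for \<kappa>
    proof -
      have "(\<integral>\<alpha>. disc_poisson (of_real r * \<alpha>) \<kappa> \<partial>m0) = (\<integral>\<alpha>. disc_poisson (of_real r * \<kappa>) \<alpha> \<partial>m0)"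
        by (rule Bochner_Integration.integral_cong) (auto simp: sp0 disc_poisson_symmetric[OF _ \<kappa> r(1)])
      also have "\<dots> = Re (F (of_real r * \<kappa>))" using dilation_in_disc[OF r] \<kappa> by (intro P0) simp
      finally show ?thesis using FU[OF r \<kappa>] by simp
    qed
    then have "(\<integral>\<kappa>. g (\<kappa> *s \<zeta>) * of_real (\<integral>\<alpha>. disc_poisson (of_real r * \<alpha>) \<kappa> \<partial>m0) \<partial>arc_measure)
        = (\<integral>\<kappa>. g (\<kappa> *s \<zeta>) * of_real (radial_value r (\<kappa> *s \<zeta>)) \<partial>arc_measure)"
      by (intro Bochner_Integration.integral_cong) (auto simp: finite_measure_on_space[OF finite_arc])
    ultimately show ?thesis using int_m[OF g(1)] by simp
  qed
  have "boundary_measure \<zeta> m"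
    unfolding boundary_measure_def using fm em conc formula approx by blast
  then show ?thesis ..
qed

definition orbit_mean :: "(complex^'n \<Rightarrow> complex) \<Rightarrow> real \<Rightarrow> complex^'n \<Rightarrow> complex" where
  "orbit_mean g r \<zeta> = (\<integral>\<kappa>. g (\<kappa> *s \<zeta>) * of_real (radial_value r (\<kappa> *s \<zeta>)) \<partial>arc_measure)"

lemma continuous_orbit_integrand:
  fixes g :: "complex^'n \<Rightarrow> complex"
  assumes g: "continuous_on bD g" and r: "0 \<le> r" "r < 1"
  shows "continuous_on bD (\<lambda>x. g x * complex_of_real (radial_value r x))"
  by (intro continuous_intros g continuous_radial_value r)

lemma continuous_orbit_joint:
  assumes g: "continuous_on bD g" and r: "0 \<le> r" "r < 1"
  shows "continuous_on (sphere 0 1 \<times> bD) (\<lambda>q. g (fst q *s snd q) * complex_of_real (radial_value r (fst q *s snd q)))"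
  by (rule continuous_on_compose2[OF continuous_orbit_integrand[OF g r]])
     (auto intro!: continuous_intros rotate_bD)

lemma continuous_orbit_mean:
  assumes g: "continuous_on bD g" and r: "0 \<le> r" "r < 1"
  shows "continuous_on bD (orbit_mean g r)"
  unfolding orbit_mean_def
  by (rule continuous_on_integral_parameter[OF finite_arc bD_compact continuous_orbit_joint[OF g r]])

text \<open>Invariance of arc length under rotations.\<close>

lemma orbit_mean_rotate:
  assumes g: "continuous_on bD g" and r: "0 \<le> r" "r < 1" and \<zeta>: "\<zeta> \<in> bD" and \<alpha>: "cmod \<alpha> = 1"
  shows "orbit_mean g r (\<alpha> *s \<zeta>) = orbit_mean g r \<zeta>"
proof -
  let ?\<phi> = "\<lambda>\<kappa>. g (\<kappa> *s \<zeta>) * of_real (radial_value r (\<kappa> *s \<zeta>))"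
  have "continuous_on (sphere 0 1) ?\<phi>"
    by (rule continuous_on_compose2[OF continuous_orbit_integrand[OF g r]])
       (auto intro!: continuous_intros rotate_bD \<zeta>)
  from integral_arc_rotate[OF this \<alpha>] show ?thesis
    by (simp add: orbit_mean_def mult.commute[of \<alpha>])
qed

text \<open>Fubini and the invariance of \<open>\<beta>\<close> under rotations.\<close>

lemma integral_orbit_mean:
  assumes g: "continuous_on bD g" and r: "0 \<le> r" "r < 1"
  shows "(\<integral>\<zeta>. orbit_mean g r \<zeta> \<partial>\<beta>) = (\<integral>\<zeta>. g \<zeta> * of_real (radial_value r \<zeta>) \<partial>\<beta>)"
proof -
  interpret arc: prob_space arc_measure by (rule prob_arc)
  have "(\<integral>\<zeta>. orbit_mean g r \<zeta> \<partial>\<beta>) = (\<integral>\<kappa>. (\<integral>\<zeta>. g (\<kappa> *s \<zeta>) * of_real (radial_value r (\<kappa> *s \<zeta>)) \<partial>\<beta>) \<partial>arc_measure)"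
    unfolding orbit_mean_def by (rule Fubini_continuous[OF finite_arc finite_beta continuous_orbit_joint[OF g r], symmetric])
  also have "\<dots> = (\<integral>\<kappa>. (\<integral>\<zeta>. g \<zeta> * of_real (radial_value r \<zeta>) \<partial>\<beta>) \<partial>arc_measure)"
    by (rule Bochner_Integration.integral_cong)
       (auto simp: finite_measure_on_space[OF finite_arc] integral_rotate[OF _ continuous_orbit_integrand[OF g r]])
  finally show ?thesis by (simp add: arc.prob_space)
qed

definition fibre_measure :: "complex^'n \<Rightarrow> (complex^'n) measure" where
  "fibre_measure \<zeta> = (SOME m. boundary_measure \<zeta> m)"

lemma fibre_measure: "\<zeta> \<in> bD \<Longrightarrow> boundary_measure \<zeta> (fibre_measure \<zeta>)"
  unfolding fibre_measure_def using boundary_measure_exists by (rule someI_ex)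

lemma orbit_mean_bound:
  fixes g :: "complex^'n \<Rightarrow> complex"
  assumes g: "continuous_on bD g" and \<epsilon>: "0 < \<epsilon>"
  shows "\<exists>L\<ge>0. \<forall>k. \<forall>\<zeta>\<in>bD. norm (orbit_mean g (radius k) \<zeta> - (\<integral>x. g x \<partial>fibre_measure \<zeta>))
    \<le> total_mass * (\<epsilon> + L * (2 - 2 * radius k))"
proof -
  from uniform_continuity_quadratic[OF bD_compact g \<epsilon>]
  obtain L where L: "0 \<le> L" "\<And>x y. x \<in> bD \<Longrightarrow> y \<in> bD \<Longrightarrow> norm (g x - g y) \<le> \<epsilon> + L * (dist x y)\<^sup>2" by metis
  have "norm (orbit_mean g (radius k) \<zeta> - (\<integral>x. g x \<partial>fibre_measure \<zeta>))
      \<le> total_mass * (\<epsilon> + L * (2 - 2 * radius k))" if "\<zeta> \<in> bD" for k \<zeta>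
    using fibre_measure[OF that] g L radius[of k] unfolding boundary_measure_def orbit_mean_def by simp
  then show ?thesis using L(1) by blast
qed

lemma uniform_limit_orbit_mean:
  fixes g :: "complex^'n \<Rightarrow> complex"
  assumes g: "continuous_on bD g"
  shows "uniform_limit bD (\<lambda>k. orbit_mean g (radius k)) (\<lambda>\<zeta>. \<integral>x. g x \<partial>fibre_measure \<zeta>) sequentially"
  by (rule uniform_limit_from_bound[where c = total_mass]) (use total_mass_pos orbit_mean_bound[OF g] in auto)

lemma continuous_fibre_integral:
  fixes g :: "complex^'n \<Rightarrow> complex"
  assumes g: "continuous_on bD g" shows "continuous_on bD (\<lambda>\<zeta>. \<integral>x. g x \<partial>fibre_measure \<zeta>)"
  by (rule uniform_limit_theorem[OF _ uniform_limit_orbit_mean[OF g]])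
     (auto intro!: always_eventually continuous_orbit_mean g radius)

lemma fibre_integral_rotate:
  fixes g :: "complex^'n \<Rightarrow> complex"
  assumes g: "continuous_on bD g" and \<zeta>: "\<zeta> \<in> bD" and \<alpha>: "cmod \<alpha> = 1"
  shows "(\<integral>x. g x \<partial>fibre_measure (\<alpha> *s \<zeta>)) = (\<integral>x. g x \<partial>fibre_measure \<zeta>)"
  using tendsto_uniform_limitI[OF uniform_limit_orbit_mean[OF g] rotate_bD[OF \<zeta> \<alpha>]]
    tendsto_uniform_limitI[OF uniform_limit_orbit_mean[OF g] \<zeta>]
  unfolding orbit_mean_rotate[OF g radius \<zeta> \<alpha>] by (rule LIMSEQ_unique)

text \<open>Both sides are limits of the integrals of \<open>g\<close> against \<open>u (r \<sqdot>)
  \<beta>\<close>: the right-hand side because the Poisson-Szego kernel is an approximate identity, the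
  left-hand side by averaging circle means.\<close>

lemma integral_fibre_integral:
  fixes g :: "complex^'n \<Rightarrow> complex"
  assumes g: "continuous_on bD g"
  shows "(\<integral>\<zeta>. (\<integral>x. g x \<partial>fibre_measure \<zeta>) \<partial>\<beta>) = (\<integral>x. g x \<partial>\<mu>)"
proof -
  interpret prob_space \<beta> by (rule prob_beta)
  let ?a = "\<lambda>k. \<integral>\<zeta>. g \<zeta> * complex_of_real (radial_value (radius k) \<zeta>) \<partial>\<beta>"
  have "?a \<longlonglongrightarrow> (\<integral>x. g x \<partial>\<mu>)"
  proof (rule limit_from_bound[where c = total_mass])
    fix \<epsilon> :: real assume "0 < \<epsilon>"
    from uniform_continuity_quadratic[OF bD_compact g this]
    obtain L where L: "0 \<le> L" "\<And>x y. x \<in> bD \<Longrightarrow> y \<in> bD \<Longrightarrow> norm (g x - g y) \<le> \<epsilon> + L * (dist x y)\<^sup>2" by metis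
    have "norm (?a k - (\<integral>x. g x \<partial>\<mu>)) \<le> total_mass * (\<epsilon> + L * (2 - 2 * radius k))" for k
      unfolding radial_value_def total_mass_def
      by (rule approximate_identity_bound[OF finite_beta fin_\<mu> continuous_radial_poisson[OF radius]])
         (use radial_poisson_nonneg[OF radius] radial_poisson_mass[OF radius] radial_poisson_spread[OF radius] g L in auto)
    then show "\<exists>L\<ge>0. \<forall>k. norm (?a k - (\<integral>x. g x \<partial>\<mu>)) \<le> total_mass * (\<epsilon> + L * (2 - 2 * radius k))" using L(1) by blast
  qed (use total_mass_pos in simp)
  moreover have "?a \<longlonglongrightarrow> (\<integral>\<zeta>. (\<integral>x. g x \<partial>fibre_measure \<zeta>) \<partial>\<beta>)"
  proof (rule limit_from_bound[where c = total_mass])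
    fix \<epsilon> :: real assume "0 < \<epsilon>"
    from orbit_mean_bound[OF g this]
    obtain L where L: "0 \<le> L" "\<And>k \<zeta>. \<zeta> \<in> bD \<Longrightarrow> norm (orbit_mean g (radius k) \<zeta> - (\<integral>x. g x \<partial>fibre_measure \<zeta>))
      \<le> total_mass * (\<epsilon> + L * (2 - 2 * radius k))" by metis
    have "norm (?a k - (\<integral>\<zeta>. (\<integral>x. g x \<partial>fibre_measure \<zeta>) \<partial>\<beta>)) \<le> total_mass * (\<epsilon> + L * (2 - 2 * radius k))" for k
    proof -
      note cm = continuous_orbit_mean[OF g radius, of k] continuous_fibre_integral[OF g]
      have "?a k - (\<integral>\<zeta>. (\<integral>x. g x \<partial>fibre_measure \<zeta>) \<partial>\<beta>)
          = (\<integral>\<zeta>. orbit_mean g (radius k) \<zeta> - (\<integral>x. g x \<partial>fibre_measure \<zeta>) \<partial>\<beta>)"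
        unfolding integral_orbit_mean[OF g radius, symmetric]
        by (rule Bochner_Integration.integral_diff[symmetric]) (rule integrable_continuous[OF finite_beta], rule cm)+
      also have "norm \<dots> \<le> (\<integral>\<zeta>. total_mass * (\<epsilon> + L * (2 - 2 * radius k)) \<partial>\<beta>)"
        by (rule Bochner_Integration.integral_norm_bound_integral,
            (intro integrable_continuous[OF finite_beta] continuous_on_diff cm continuous_on_const)+)
           (simp add: space_beta L(2))
      also have "\<dots> = total_mass * (\<epsilon> + L * (2 - 2 * radius k))" by (simp add: prob_space)
      finally show ?thesis .
    qed
    then show "\<exists>L\<ge>0. \<forall>k. norm (?a k - (\<integral>\<zeta>. (\<integral>x. g x \<partial>fibre_measure \<zeta>) \<partial>\<beta>)) \<le> total_mass * (\<epsilon> + L * (2 - 2 * radius k))"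
      using L(1) by blast
  qed (use total_mass_pos in simp)
  ultimately show ?thesis by (rule LIMSEQ_unique[symmetric])
qed

text \<open>An arbitrary point of the orbit. Integrals against the measures of an orbit do not depend on this
  choice, by \<open>orbit_measure_integral\<close>.\<close>

definition orbit_representative :: "(complex^'n) set \<Rightarrow> complex^'n" where
  "orbit_representative \<xi> = (SOME \<zeta>. \<zeta> \<in> bD \<and> circle_orbit \<zeta> = \<xi>)"

definition orbit_measure :: "(complex^'n) set \<Rightarrow> (complex^'n) measure" where
  "orbit_measure \<xi> = fibre_measure (orbit_representative \<xi>)"

lemma orbit_representative:
  assumes "\<xi> \<in> topspace (hat_boundary bD)"
  shows "orbit_representative \<xi> \<in> bD" "circle_orbit (orbit_representative \<xi>) = \<xi>"
proof -
  have "\<exists>\<zeta>. \<zeta> \<in> bD \<and> circle_orbit \<zeta> = \<xi>" using assms by (auto simp: topspace_hat_boundary)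
  from someI_ex[OF this] show "orbit_representative \<xi> \<in> bD" "circle_orbit (orbit_representative \<xi>) = \<xi>"
    by (simp_all add: orbit_representative_def)
qed

lemma orbit_measure:
  "\<xi> \<in> topspace (hat_boundary bD) \<Longrightarrow> boundary_measure (orbit_representative \<xi>) (orbit_measure \<xi>)"
  unfolding orbit_measure_def by (rule fibre_measure[OF orbit_representative(1)])

lemma orbit_measure_integral:
  fixes g :: "complex^'n \<Rightarrow> complex"
  assumes g: "continuous_on bD g" and \<zeta>: "\<zeta> \<in> bD"
  shows "(\<integral>x. g x \<partial>orbit_measure (circle_orbit \<zeta>)) = (\<integral>x. g x \<partial>fibre_measure \<zeta>)"
proof -
  have \<xi>: "circle_orbit \<zeta> \<in> topspace (hat_boundary bD)" using \<zeta> by (simp add: topspace_hat_boundary)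
  obtain \<alpha> where "cmod \<alpha> = 1" "orbit_representative (circle_orbit \<zeta>) = \<alpha> *s \<zeta>"
    using circle_orbit_eqD[OF orbit_representative(2)[OF \<xi>]] by blast
  then show ?thesis using fibre_integral_rotate[OF g \<zeta>] by (simp add: orbit_measure_def)
qed

abbreviation \<nu> :: "(complex^'n) set measure" where "\<nu> \<equiv> hat_measure bD \<beta>"

lemma space_\<nu>: "space \<nu> = topspace (hat_boundary bD)"
  by (simp add: hat_measure_def space_borel_of)

lemma finite_\<nu>: "finite_measure \<nu>"
  unfolding hat_measure_def
  using prob_space.prob_space_distr[OF prob_beta measurable_circle_orbit[OF finite_beta]] by (simp add: prob_space_def)

lemma measurable_\<nu>: "measurable M \<nu> = measurable M (borel_of (hat_boundary bD))"
  "measurable \<nu> N = measurable (borel_of (hat_boundary bD)) N"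
  unfolding hat_measure_def by (auto cong: measurable_cong_sets)

lemma continuous_map_orbit_integral:
  fixes g :: "complex^'n \<Rightarrow> complex"
  assumes g: "continuous_on bD g"
  shows "continuous_map (hat_boundary bD) euclidean (\<lambda>\<xi>. \<integral>x. g x \<partial>orbit_measure \<xi>)"
  by (rule continuous_map_hat_boundary, rule continuous_on_eq[OF continuous_fibre_integral[OF g]])
     (simp add: orbit_measure_integral[OF g])

lemma mixture_orbit_measure: "measure_mixture \<mu> \<nu> orbit_measure"
proof (rule measure_mixture_compact[OF fin_\<mu> finite_\<nu>, where c = total_mass])
  show "finite_measure_on bD (orbit_measure \<xi>)" "emeasure (orbit_measure \<xi>) bD = ennreal total_mass" if "\<xi> \<in> space \<nu>" for \<xi>
    using orbit_measure that by (auto simp: space_\<nu> boundary_measure_def)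
  show "0 \<le> total_mass" using total_mass_pos by simp
  fix g :: "complex^'n \<Rightarrow> complex" assume g: "continuous_on bD g"
  have m: "(\<lambda>\<xi>. \<integral>x. g x \<partial>orbit_measure \<xi>) \<in> borel_measurable (borel_of (hat_boundary bD))"
    by (rule continuous_map_borel_of[OF continuous_map_orbit_integral[OF g]])
  then show "(\<lambda>\<xi>. \<integral>x. g x \<partial>orbit_measure \<xi>) \<in> borel_measurable \<nu>" by (simp add: measurable_\<nu>)
  have "(\<integral>\<xi>. (\<integral>x. g x \<partial>orbit_measure \<xi>) \<partial>\<nu>) = (\<integral>\<zeta>. (\<integral>x. g x \<partial>orbit_measure (circle_orbit \<zeta>)) \<partial>\<beta>)"
    unfolding hat_measure_def by (rule integral_distr[OF measurable_circle_orbit[OF finite_beta] m])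
  also have "\<dots> = (\<integral>\<zeta>. (\<integral>x. g x \<partial>fibre_measure \<zeta>) \<partial>\<beta>)"
    by (rule Bochner_Integration.integral_cong) (auto simp: space_beta orbit_measure_integral[OF g])
  also have "\<dots> = (\<integral>x. g x \<partial>\<mu>)" by (rule integral_fibre_integral[OF g])
  finally show "(\<integral>x. g x \<partial>\<mu>) = (\<integral>\<xi>. (\<integral>x. g x \<partial>orbit_measure \<xi>) \<partial>\<nu>)" by simp
qed

lemma orbit_disintegration:
  "pseudo_image_measure (top_of_set bD) (hat_boundary bD) circle_orbit (of_positive \<mu>) (of_positive \<nu>)"
  "disintegration (top_of_set bD) (hat_boundary bD) circle_orbit (of_positive \<mu>) (of_positive \<nu>)
     (\<lambda>\<xi>. of_positive (orbit_measure \<xi>))"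
proof -
  interpret mix: measure_mixture \<mu> \<nu> orbit_measure by (rule mixture_orbit_measure)
  have p: "circle_orbit \<in> \<mu> \<rightarrow>\<^sub>M \<nu>" using measurable_circle_orbit[OF fin_\<mu>] by (simp add: measurable_\<nu>)
  have fm: "finite_measure_on bD (orbit_measure \<xi>)" if "\<xi> \<in> space \<nu>" for \<xi>
    using orbit_measure that by (auto simp: space_\<nu> boundary_measure_def)
  have null: "{x \<in> space \<mu>. circle_orbit x \<noteq> \<xi>} \<in> null_sets (orbit_measure \<xi>)" if \<xi>: "\<xi> \<in> space \<nu>" for \<xi>
  proof -
    let ?r = "orbit_representative \<xi>"
    have r: "circle_orbit ?r = \<xi>" using orbit_representative \<xi> by (simp add: space_\<nu>)
    have iff: "circle_orbit x = \<xi> \<longleftrightarrow> x \<in> circle_orbit ?r" for x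
    proof
      assume "circle_orbit x = \<xi>" then show "x \<in> circle_orbit ?r" using circle_orbit_self[of x] r by simp
    next
      assume "x \<in> circle_orbit ?r"
      then obtain \<alpha> where "cmod \<alpha> = 1" "x = \<alpha> *s ?r" by (auto simp: circle_orbit_def)
      then show "circle_orbit x = \<xi>" using circle_orbit_rotate[of \<alpha> ?r] r by simp
    qed
    then have eq: "{x \<in> space \<mu>. circle_orbit x \<noteq> \<xi>} = bD - circle_orbit ?r" by (auto simp: sp_\<mu>)
    have "closed (circle_orbit ?r)" by (rule compact_imp_closed[OF compact_circle_orbit])
    then have "bD - circle_orbit ?r \<in> sets (restrict_space borel bD)"
      using bD_closed by (auto simp: sets_restrict_space image_iff intro!: bexI[of _ "bD - circle_orbit ?r"])
    then show ?thesis
      unfolding eq using fm[OF \<xi>] orbit_measure[of \<xi>] \<xi>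
      by (auto simp: null_sets_def finite_measure_on_def boundary_measure_def space_\<nu>)
  qed
  have mass: "emeasure (orbit_measure \<xi>) (space \<mu>) = ennreal total_mass" if "\<xi> \<in> space \<nu>" for \<xi>
    using orbit_measure that by (auto simp: space_\<nu> boundary_measure_def sp_\<mu>)
  note args = _ space_\<nu>[symmetric] p radon_measureI[OF fm] null mass
  show "pseudo_image_measure (top_of_set bD) (hat_boundary bD) circle_orbit (of_positive \<mu>) (of_positive \<nu>)"
    by (rule mix.disintegration_of_mixture(1)[OF args]) (use total_mass_pos in \<open>auto simp: sp_\<mu>\<close>)
  show "disintegration (top_of_set bD) (hat_boundary bD) circle_orbit (of_positive \<mu>) (of_positive \<nu>)
     (\<lambda>\<xi>. of_positive (orbit_measure \<xi>))"
    by (rule mix.disintegration_of_mixture(2)[OF args]) (use total_mass_pos in \<open>auto simp: sp_\<mu>\<close>)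
qed

lemma cm_integral_orbit_measure:
  fixes g :: "complex^'n \<Rightarrow> complex"
  assumes "continuous_on bD g" "\<xi> \<in> topspace (hat_boundary bD)"
  shows "cm_integral (of_positive (orbit_measure \<xi>)) g = (\<integral>x. g x \<partial>orbit_measure \<xi>)"
  using assms orbit_measure[OF assms(2)]
  by (intro cm_integral_of_positive_borel borel_measurable_continuous[of bD]) (auto simp: boundary_measure_def)

lemma vaguely_continuous_orbit_measure:
  "vaguely_continuous (top_of_set bD) (hat_boundary bD) (\<lambda>\<xi>. of_positive (orbit_measure \<xi>))"
  unfolding vaguely_continuous_def
proof (intro allI impI)
  fix g :: "complex^'n \<Rightarrow> complex" assume "continuous_map (top_of_set bD) euclidean g"
  then have g: "continuous_on bD g" by simp
  show "continuous_map (hat_boundary bD) euclidean (\<lambda>\<xi>. cm_integral (of_positive (orbit_measure \<xi>)) g)"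
    by (rule continuous_map_eq[OF continuous_map_orbit_integral[OF g]]) (simp add: cm_integral_orbit_measure[OF g])
qed

lemma orbit_poisson_formula:
  assumes \<xi>: "\<xi> \<in> topspace (hat_boundary bD)" and z: "z \<in> orbit_disc bD \<xi>"
  shows "u z = cm_integral (of_positive (orbit_measure \<xi>)) (\<lambda>\<zeta>. of_real ((1 - (norm z)\<^sup>2) / (norm (\<zeta> - z))\<^sup>2))"
proof -
  let ?r = "orbit_representative \<xi>"
  note r = orbit_representative[OF \<xi>]
  obtain w \<zeta> where w: "cmod w < 1" "\<zeta> \<in> bD" "circle_orbit \<zeta> = \<xi>" "z = w *s \<zeta>"
    using z by (auto simp: orbit_disc_def)
  obtain \<alpha> where \<alpha>: "cmod \<alpha> = 1" "\<zeta> = \<alpha> *s ?r" using circle_orbit_eqD[of \<zeta> ?r] w(3) r(2) by auto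
  have zr: "z = (w * \<alpha>) *s ?r" by (simp add: w(4) \<alpha>(2))
  have wa: "cmod (w * \<alpha>) < 1" using w(1) \<alpha>(1) by (simp add: norm_mult)
  have nz: "norm z < 1" using w bD_sphere by (auto simp: norm_smult subset_iff)
  have "continuous_on bD (\<lambda>\<zeta>. complex_of_real ((1 - (norm z)\<^sup>2) / (norm (\<zeta> - z))\<^sup>2))"
  proof (intro continuous_intros ballI)
    fix x assume "x \<in> bD"
    then have "norm x = 1" using bD_sphere by auto
    then show "(norm (x - z))\<^sup>2 \<noteq> 0" using nz by auto
  qed
  then show ?thesis
    using orbit_measure[OF \<xi>] wa unfolding boundary_measure_def
    by (subst cm_integral_orbit_measure[OF _ \<xi>]) (auto simp: zr)
qed

end

theorem proposition3p4:
  fixes D bD :: "(complex ^ 'n) set"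
    and \<beta> \<mu> :: "(complex ^ 'n) measure"
    and C :: "complex ^ 'n \<Rightarrow> complex ^ 'n \<Rightarrow> complex"
  assumes "bounded_symmetric_domain D" and "convex D" and "circular D"
    and "silov_boundary D bD"
    and "\<forall>\<zeta>\<in>bD. \<forall>\<eta>\<in>bD. \<exists>A\<in>linear_automorphisms D. A *v \<zeta> = \<eta>"
    and "linear_automorphisms D \<subseteq> unitary_group"
    and "bD \<subseteq> sphere 0 1"
    and "K_invariant_probability D bD \<beta>"
    and "reproducing_kernel D \<beta> C"
    and "radon_measure (top_of_set bD) \<mu>" and "emeasure \<mu> bD \<noteq> 0"
    and "pluriharmonic_measure D C (of_positive \<mu>)"
  shows "pseudo_image_measure (top_of_set bD) (hat_boundary bD) circle_orbit
           (of_positive \<mu>) (of_positive (hat_measure bD \<beta>)) \<and>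
         (\<exists>M. disintegration (top_of_set bD) (hat_boundary bD) circle_orbit
                (of_positive \<mu>) (of_positive (hat_measure bD \<beta>)) M \<and>
              vaguely_continuous (top_of_set bD) (hat_boundary bD) M \<and>
              (\<forall>\<xi>\<in>topspace (hat_boundary bD). \<forall>z\<in>orbit_disc bD \<xi>.
                 poisson_integral D C (of_positive \<mu>) z =
                 cm_integral (M \<xi>) (\<lambda>\<zeta>. of_real ((1 - (norm z)\<^sup>2) / (norm (\<zeta> - z))\<^sup>2))))"
proof -
  interpret szego_setting D bD \<beta> C
    using assms by unfold_locales (auto simp: bounded_symmetric_domain_def)
  interpret pluriharmonic_setting D bD \<beta> C \<mu>
    using assms radon_measure_finite_measure_on[OF assms(10) bD_compact] by unfold_locales auto
  show ?thesis
    using orbit_disintegration vaguely_continuous_orbit_measure orbit_poisson_formula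
    by (intro conjI exI[of _ "\<lambda>\<xi>. of_positive (orbit_measure \<xi>)"]) auto
qed

end
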